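(* Let $\{(U^k,Q^k,V^k,W^k,G^k,X^k)\}_{k\ge 0}$ be generated by the SCB-spADMM iteration described in the context, with penalty parameter $\beta>0$, step length $\tau>0$, and semi-proximal operators $\mathcal H_U,\mathcal H_Q,\mathcal H_V,\mathcal H_W,\mathcal H_G$ as in the context. Suppose that one of the following holds: (1) $\tau\in\left(0,\frac{\sqrt5+1}{2}\right)$; or (2) $\tau\ge\frac{\sqrt5+1}{2}$ and $$\sum_{k=0}^{+\infty}\left(\left\|(G^{k+1}-G^k)+(W^{k+1}-W^k)\right\|_F^2+\frac1\tau\Big\|\mathcal P_\Omega(U^{k+1})+V^{k+1}+W^{k+1}+\sum_{j=1}^S R_j^TQ^{k+1}e_j^T-G^{k+1}\Big\|_F^2\right)<+\infty .$$ Then: (i) the iterates $U^k,Q^k,W^k,V^k,G^k$ are well defined (every minimization subproblem of the iteration defines its iterate); (ii) the sequence $\{(U^k,Q^k,W^k,V^k,G^k,X^k)\}_{k\ge1}$ converges to its unique accumulation point $(U^\infty,Q^\infty,W^\infty,V^\infty,G^\infty,X^\infty)$, where $(U^\infty,Q^\infty,W^\infty,V^\infty,G^\infty)$ is an optimal solution of the dual problem (D) and $X^\infty$ is an optimal solution of the primal problem (P).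
   Context: **Data.** $S,M$ are positive integers, and $R=[R_1,\dots,R_S]$ is a $0$-$1$ matrix of size $M\times S^2$ partitioned into blocks $R_j\in\mathbb R^{M\times S}$. $L\in\mathbb R^M$, $\Omega\subset\{1,\dots,S\}^2$, and $e_j\in\mathbb R^S$ is the $j$-th standard basis vector. $\mathcal P_\Omega:\mathbb R^{S\times S}\to\mathbb R^{S\times S}$ keeps the entries indexed by $\Omega$ and sets all other entries to $0$. Given $\rho_1,\rho_2>0$ and $\bar X,\hat X\in\mathbb R^{S\times S}$, put $\alpha=\rho_1+\rho_2$ and $A=\frac{\rho_1\bar X+\rho_2\hat X}{\rho_1+\rho_2}$. Here $\|\cdot\|_*$ is the nuclear norm, $\|\cdot\|_2$ the spectral norm, $\|\cdot\|_F$ the Frobenius norm, $\langle\cdot,\cdot\rangle$ the trace (Euclidean) inner product, and matrix inequalities such as $X\ge0$ are entrywise. **Standing assumption.** The data come from an actual traffic matrix: there is an entrywise nonnegative $X\in\mathbb R^{S\times S}$ with $\mathcal P_\Omega(X)=0$ and $\sum_{j=1}^S R_jXe_j=L$. **Primal problem (P):** $$\min\ \|X\|_*+\alpha\|Z\|_F^2\quad\text{s.t.}\quad \sum_{j=1}^S R_jXe_j=L,\ \ \mathcal P_\Omega(X)=0,\ \ X=Y,\ \ X-A-Z=0,\ \ Y\ge0$$ over $X,Y,Z\in\mathbb R^{S\times S}$. Since $Y=X$ and $Z=X-A$ are determined by $X$, "$X$ is optimal for (P)" means that $(X,X,X-A)$ is optimal. **Dual problem (D):** $$\min_{U,V,W,Q,G}\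 \delta_{\mathbb R^{S\times S}_+}(V)-\langle Q,L\rangle+\delta_{\mathcal B}(G)+\frac1{4\alpha}\|W-2\alpha A\|_F^2\quad\text{s.t.}\quad \mathcal P_\Omega(U)+V+W+\sum_{j=1}^S R_j^TQe_j^T=G$$ over $U,V,W,G\in\mathbb R^{S\times S}$, $Q\in\mathbb R^M$. Here $\mathbb R^{S\times S}_+=\{X:X\ge0\}$, $\mathcal B=\{X\in\mathbb R^{S\times S}:\|X\|_2\le1\}$, and $\delta_{\mathcal C}$ is the indicator function of $\mathcal C$ ($0$ on $\mathcal C$, $+\infty$ elsewhere). **Augmented Lagrangian.** With $\Gamma=\mathcal P_\Omega(U)+V+W+\sum_{j=1}^S R_j^TQe_j^T-G$ and $\beta>0$, $$L_\beta(U,Q,V,W,G;X)=\delta_{\mathbb R^{S\times S}_+}(V)-\langle Q,L\rangle+\delta_{\mathcal B}(G)+\frac1{4\alpha}\|W-2\alpha A\|_F^2+\langle X,\Gamma\rangle+\frac\beta2\|\Gamma\|_F^2 .$$ **Semi-proximal operators.** Let $\mathcal A:\mathbb R^M\to\mathbb R^{S\times S}$, $\mathcal AQ=\sum_{j=1}^S R_j^TQe_j^T$, so that $\mathcal A^*\mathcal AQ=\sum_{j=1}^SR_jR_j^TQ$, and let $\mathcal I$ be the identity. $\mathcal G_U,\mathcal G_Q,\mathcal G_W,\mathcal G_V,\mathcal G_G$ are invertible self-adjoint positive semidefinite linear operators (on the spaces of the corresponding variables) such that the following operators are self-adjoint positive semidefinite: $$\mathcal H_U=\mathcal G_U-\mathcal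 P_\Omega,\quad \mathcal H_Q=\mathcal G_Q-\mathcal A^*\mathcal A,\quad \mathcal H_W=\mathcal G_W-\Big(\frac1\beta+1\Big)\mathcal I,\quad \mathcal H_V=\mathcal G_V-\mathcal I,\quad \mathcal H_G=\mathcal G_G-\mathcal I .$$ For a self-adjoint positive semidefinite $\mathcal H$, $\|Y\|_{\mathcal H}^2=\langle Y,\mathcal HY\rangle$. **SCB-spADMM iteration.** Start with $U^0,Q^0,V^0,W^0,G^0,X^0$ all zero. For $k=0,1,2,\dots$ compute, in this order: - $U^{k+\frac12}=\arg\min_U L_\beta(U,Q^k,V^k,W^k,G^k;X^k)+\frac\beta2\|U-U^k\|_{\mathcal H_U}^2$ - $Q^{k+\frac12}=\arg\min_Q L_\beta(U^{k+\frac12},Q,V^k,W^k,G^k;X^k)+\frac\beta2\|Q-Q^k\|_{\mathcal H_Q}^2$ - $V^{k+1}=\arg\min_V L_\beta(U^{k+\frac12},Q^{k+\frac12},V,W^k,G^k;X^k)+\frac\beta2\|V-V^k\|_{\mathcal H_V}^2$ - $Q^{k+1}=\arg\min_Q L_\beta(U^{k+\frac12},Q,V^{k+1},W^k,G^k;X^k)+\frac\beta2\|Q-Q^{k+\frac12}\|_{\mathcal H_Q}^2$ - $U^{k+1}=\arg\min_U L_\beta(U,Q^{k+1},V^{k+1},W^k,G^k;X^k)+\frac\beta2\|U-U^{k+\frac12}\|_{\mathcal H_U}^2$ - $W^{k+\frac12}=\arg\min_W L_\beta(U^{k+1},Q^{k+1},V^{k+1},W,G^k;X^k)+\frac\beta2\|W-W^k\|_{\mathcal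 H_W}^2$ - $G^{k+1}=\arg\min_G L_\beta(U^{k+1},Q^{k+1},V^{k+1},W^{k+\frac12},G;X^k)+\frac\beta2\|G-G^k\|_{\mathcal H_G}^2$ - $W^{k+1}=\arg\min_W L_\beta(U^{k+1},Q^{k+1},V^{k+1},W,G^{k+1};X^k)+\frac\beta2\|W-W^{k+\frac12}\|_{\mathcal H_W}^2$ - $X^{k+1}=X^k+\tau\beta\Big(\mathcal P_\Omega(U^{k+1})+V^{k+1}+W^{k+1}+\sum_{j=1}^SR_j^TQ^{k+1}e_j^T-G^{k+1}\Big)$ The iteration is run indefinitely (no stopping criterion). *)

theory Defs
  imports "HOL-Analysis.Analysis"
begin

text \<open>
  The numbers \<open>S\<close> and \<open>M\<close> are the cardinalities of the index types \<open>'s\<close> and \<open>'m\<close>.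
  On \<open>real^'s^'s\<close> the library's \<open>norm\<close> is the Frobenius norm, \<open>\<bullet>\<close> is the trace inner product
  and \<open>\<le>\<close> is the entrywise order.
\<close>

type_synonym 's sqmat = "real^'s^'s"

text \<open>
  An \<open>M \<times> S\<^sup>2\<close> matrix has its columns indexed by pairs \<open>(j, k)\<close>: column \<open>k\<close> of block \<open>j\<close>.
\<close>

definition block :: "real^('s::finite \<times> 's)^'m::finite \<Rightarrow> 's \<Rightarrow> real^'s^'m" where
  "block R j = (\<chi> i k. R $ i $ (j, k))"

definition proj_on :: "('s \<times> 's) set \<Rightarrow> 's::finite sqmat \<Rightarrow> 's sqmat" where
  "proj_on \<Omega> X = (\<chi> i j. if (i, j) \<in> \<Omega> then X $ i $ j else 0)"

definition outer :: "real^'a \<Rightarrow> real^'b \<Rightarrow> real^'b^'a" where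
  "outer u v = (\<chi> i j. u $ i * v $ j)"

definition A_op :: "real^('s::finite \<times> 's)^'m::finite \<Rightarrow> real^'m \<Rightarrow> 's sqmat" where
  "A_op R Q = (\<Sum>j\<in>UNIV. outer (transpose (block R j) *v Q) (axis j 1))"

definition link_load :: "real^('s::finite \<times> 's)^'m::finite \<Rightarrow> 's sqmat \<Rightarrow> real^'m" where
  "link_load R X = (\<Sum>j\<in>UNIV. block R j *v (X *v axis j 1))"

definition eigenspace :: "real^'n^'n \<Rightarrow> real \<Rightarrow> (real^'n) set" where
  "eigenspace M \<mu> = {v. M *v v = \<mu> *\<^sub>R v}"

definition eigenvalues :: "real^'n^'n \<Rightarrow> real set" where
  "eigenvalues M = {\<mu>. \<exists>v\<in>eigenspace M \<mu>. v \<noteq> 0}"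

text \<open>
  The sum of the singular values of \<open>X\<close>, i.e. of the square roots of the eigenvalues of
  \<open>X\<^sup>T X\<close>. As \<open>X\<^sup>T X\<close> is symmetric, the multiplicity of an eigenvalue is the dimension of
  its eigenspace.
\<close>

definition nuclear_norm :: "real^'n^'m \<Rightarrow> real" where
  "nuclear_norm X =
     (\<Sum>\<mu>\<in>eigenvalues (transpose X ** X).
        real (dim (eigenspace (transpose X ** X) \<mu>)) * sqrt \<mu>)"

lemma finite_eigenvalues_symmetric:
  fixes M :: "real^'n^'n"
  assumes "transpose M = M"
  shows "finite (eigenvalues M)"
proof -
  define v where "v \<mu> = (SOME v. v \<in> eigenspace M \<mu> \<and> v \<noteq> 0)" for \<mu>
  have v: "M *v v \<mu> = \<mu> *\<^sub>R v \<mu>" "v \<mu> \<noteq> 0" if "\<mu> \<in> eigenvalues M" for \<mu>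
  proof -
    have "v \<mu> \<in> eigenspace M \<mu> \<and> v \<mu> \<noteq> 0"
      unfolding v_def by (rule someI_ex) (use that in \<open>auto simp: eigenvalues_def\<close>)
    then show "M *v v \<mu> = \<mu> *\<^sub>R v \<mu>" "v \<mu> \<noteq> 0"
      by (auto simp: eigenspace_def)
  qed
  have orth: "v \<mu> \<bullet> v \<nu> = 0"
    if "\<mu> \<in> eigenvalues M" "\<nu> \<in> eigenvalues M" "\<mu> \<noteq> \<nu>" for \<mu> \<nu>
  proof -
    have "(M *v v \<mu>) \<bullet> v \<nu> = v \<mu> \<bullet> (M *v v \<nu>)"
      using assms by (metis dot_lmul_matrix vector_transpose_matrix)
    then have "(\<mu> - \<nu>) * (v \<mu> \<bullet> v \<nu>) = 0"
      using v that by (simp add: algebra_simps)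
    then show ?thesis using that by simp
  qed
  have inj: "inj_on v (eigenvalues M)"
    by (rule inj_onI) (metis inner_eq_zero_iff orth v(2))
  have "pairwise orthogonal (v ` eigenvalues M)"
    using orth by (auto simp: pairwise_def orthogonal_def)
  moreover have "0 \<notin> v ` eigenvalues M"
    using v by force
  ultimately have "independent (v ` eigenvalues M)"
    by (rule pairwise_orthogonal_independent)
  then have "finite (v ` eigenvalues M)"
    using independent_bound by blast
  then show ?thesis
    using inj finite_imageD by blast
qed

definition spectral_norm :: "real^'n^'m \<Rightarrow> real" where
  "spectral_norm X = onorm ((*v) X)"

definition indicator_fn :: "'a set \<Rightarrow> 'a \<Rightarrow> ereal" where
  "indicator_fn C x = (if x \<in> C then 0 else \<infinity>)"

definition selfadjoint_psd :: "('a::euclidean_space \<Rightarrow> 'a) \<Rightarrow> bool" where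
  "selfadjoint_psd H \<longleftrightarrow> linear H \<and> adjoint H = H \<and> (\<forall>x. 0 \<le> x \<bullet> H x)"

definition primal_objective :: "real \<Rightarrow> 's::finite sqmat \<times> 's sqmat \<times> 's sqmat \<Rightarrow> real" where
  "primal_objective \<alpha> = (\<lambda>(X, Y, Z). nuclear_norm X + \<alpha> * (norm Z)\<^sup>2)"

definition primal_feasible ::
  "real^('s::finite \<times> 's)^'m::finite \<Rightarrow> real^'m \<Rightarrow> ('s \<times> 's) set \<Rightarrow> 's sqmat
   \<Rightarrow> 's sqmat \<times> 's sqmat \<times> 's sqmat \<Rightarrow> bool" where
  "primal_feasible R L \<Omega> A = (\<lambda>(X, Y, Z).
     link_load R X = L \<and> proj_on \<Omega> X = 0 \<and> X = Y \<and> X - A - Z = 0 \<and> 0 \<le> Y)"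

definition primal_optimal ::
  "real^('s::finite \<times> 's)^'m::finite \<Rightarrow> real^'m \<Rightarrow> ('s \<times> 's) set \<Rightarrow> real \<Rightarrow> 's sqmat
   \<Rightarrow> 's sqmat \<Rightarrow> bool" where
  "primal_optimal R L \<Omega> \<alpha> A X \<longleftrightarrow>
     is_arg_min (primal_objective \<alpha>) (primal_feasible R L \<Omega> A) (X, X, X - A)"

text \<open>Variable order in the dual and in the augmented Lagrangian: \<open>U, Q, V, W, G\<close>.\<close>

definition dual_objective ::
  "real^'m::finite \<Rightarrow> real \<Rightarrow> 's::finite sqmat
   \<Rightarrow> 's sqmat \<times> (real^'m) \<times> 's sqmat \<times> 's sqmat \<times> 's sqmat \<Rightarrow> ereal" where
  "dual_objective L \<alpha> A = (\<lambda>(U, Q, V, W, G).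
     indicator_fn {X. 0 \<le> X} V + ereal (- (Q \<bullet> L)) + indicator_fn {X. spectral_norm X \<le> 1} G
     + ereal (1 / (4 * \<alpha>) * (norm (W - (2 * \<alpha>) *\<^sub>R A))\<^sup>2))"

definition dual_residual ::
  "real^('s::finite \<times> 's)^'m::finite \<Rightarrow> ('s \<times> 's) set
   \<Rightarrow> 's sqmat \<times> (real^'m) \<times> 's sqmat \<times> 's sqmat \<times> 's sqmat \<Rightarrow> 's sqmat" where
  "dual_residual R \<Omega> = (\<lambda>(U, Q, V, W, G). proj_on \<Omega> U + V + W + A_op R Q - G)"

definition dual_feasible ::
  "real^('s::finite \<times> 's)^'m::finite \<Rightarrow> ('s \<times> 's) set
   \<Rightarrow> 's sqmat \<times> (real^'m) \<times> 's sqmat \<times> 's sqmat \<times> 's sqmat \<Rightarrow> bool" where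
  "dual_feasible R \<Omega> = (\<lambda>(U, Q, V, W, G). proj_on \<Omega> U + V + W + A_op R Q = G)"

definition dual_optimal ::
  "real^('s::finite \<times> 's)^'m::finite \<Rightarrow> real^'m \<Rightarrow> ('s \<times> 's) set \<Rightarrow> real \<Rightarrow> 's sqmat
   \<Rightarrow> 's sqmat \<times> (real^'m) \<times> 's sqmat \<times> 's sqmat \<times> 's sqmat \<Rightarrow> bool" where
  "dual_optimal R L \<Omega> \<alpha> A = is_arg_min (dual_objective L \<alpha> A) (dual_feasible R \<Omega>)"

definition aug_lagrangian ::
  "real^('s::finite \<times> 's)^'m::finite \<Rightarrow> real^'m \<Rightarrow> ('s \<times> 's) set \<Rightarrow> real \<Rightarrow> 's sqmat \<Rightarrow> real
   \<Rightarrow> 's sqmat \<Rightarrow> real^'m \<Rightarrow> 's sqmat \<Rightarrow> 's sqmat \<Rightarrow> 's sqmat \<Rightarrow> 's sqmat \<Rightarrow> ereal" where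
  "aug_lagrangian R L \<Omega> \<alpha> A \<beta> U Q V W G X =
     dual_objective L \<alpha> A (U, Q, V, W, G)
     + ereal (X \<bullet> dual_residual R \<Omega> (U, Q, V, W, G))
     + ereal (\<beta> / 2 * (norm (dual_residual R \<Omega> (U, Q, V, W, G)))\<^sup>2)"

definition semi_prox ::
  "real \<Rightarrow> ('a::euclidean_space \<Rightarrow> 'a) \<Rightarrow> ('a \<Rightarrow> ereal) \<Rightarrow> 'a \<Rightarrow> 'a \<Rightarrow> ereal" where
  "semi_prox \<beta> H f y\<^sub>0 = (\<lambda>y. f y + ereal (\<beta> / 2 * ((y - y\<^sub>0) \<bullet> H (y - y\<^sub>0))))"

end

theory Submission
  imports Defs
begin

text \<open>
  A symmetric Gauss--Seidel sweep over \<open>(U, Q, V)\<close> is a single proximal minimization in the joint variable,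
  with a positive semidefinite weight obtained by eliminating the half iterates; the same holds for \<open>(W, G)\<close>.
  SCB-spADMM is therefore a two-block semi-proximal ADMM. For each KKT point \<open>(y', z', x')\<close> the sum
  \<open>|x - x'|\<^sup>2 / (\<tau>\<beta>\<^sup>2) + s(y - y') + t(z - z') + |B(z - z')|\<^sup>2\<close> decreases along the iteration up to
  terms that are absorbed when \<open>\<tau> < (1 + \<surd>5) / 2\<close> and summable in case (2). So the iterates are bounded,
  all increments and residuals tend to \<open>0\<close>, every cluster point is a KKT point, and taking that point as
  the reference gives convergence of the whole sequence.

  A KKT point exists because the primal constraints are polyhedral: their normal cone at the primal
  solution is finitely generated, hence closed, and can be separated from the compact convex set of
  subgradients of the objective.
\<close>

subsection \<open>Convergence of the two-block semi-proximal ADMM\<close>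

text \<open>ADMM with three or more blocks can diverge, hence the grouping into two. The obstacle in
  the grouped scheme is degeneracy: the weights \<open>s\<close> and \<open>t\<close> are only
  semidefinite, and definiteness holds only for \<open>s v v + |A v|^2\<close> and
  \<open>t v v + |B v|^2\<close>. So \<open>y\<close> is controlled only jointly with the residual,
  and Cauchy-Schwarz for the two forms does the work that vanishing increments would do.

  The golden ratio comes from the mixed term \<open>B (dz k) \<bullet> r (Suc k)\<close> of the
  descent estimate. Comparing two consecutive z-steps trades it for \<open>1 - \<tau>\<close> times
  a product with the previous residual. For \<tau> > 1, Young's inequality with weight \<tau> then
  leaves positive multiples of the squares exactly when \<tau>^2 < 1 + \<tau>.

  No strictly feasible traffic matrix is assumed, so multipliers cannot come from an interior point.
  No duality theorem is invoked for the limit either: a KKT point is compared directly with all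
  competitors of both problems, its \<open>X\<close> being at once the multiplier of the dual
  constraint and the primal solution.\<close>

lemma bilinear_coercive:
  fixes q :: "'a::euclidean_space \<Rightarrow> 'a \<Rightarrow> real"
  assumes "bilinear q" and pos: "\<And>x. x \<noteq> 0 \<Longrightarrow> 0 < q x x"
  obtains c where "0 < c" "\<And>x. c * (norm x)\<^sup>2 \<le> q x x"
proof -
  interpret bounded_bilinear q
    using assms(1) by (simp add: bilinear_conv_bounded_bilinear)
  obtain b :: 'a where b: "b \<in> sphere 0 1"
    using vector_choose_size[of 1] by auto
  have "continuous_on (sphere 0 1) (\<lambda>x. q x x)"
    by (rule continuous_on[OF continuous_on_id continuous_on_id])
  then obtain m where m: "m \<in> sphere 0 1" "\<And>x. x \<in> sphere 0 1 \<Longrightarrow> q m m \<le> q x x"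
    using continuous_attains_inf[of "sphere 0 1 :: 'a set" "\<lambda>x. q x x"] b compact_sphere
    by (metis empty_iff)
  show thesis
  proof
    have "m \<noteq> 0" using m(1) by auto
    then show "0 < q m m" by (rule pos)
    show "q m m * (norm x)\<^sup>2 \<le> q x x" for x
    proof (cases "x = 0")
      case False
      have "q m m \<le> q (x /\<^sub>R norm x) (x /\<^sub>R norm x)"
        using False by (intro m) auto
      then show ?thesis
        using False by (simp add: scaleR_left scaleR_right field_simps power2_eq_square)
    qed (simp add: zero_left)
  qed
qed

text \<open>The proximal weights are carried as bilinear forms instead of operators: those of the
  two sweeps live on product spaces and arise as sums of pullbacks, which are awkward to write as
  block operators. Definiteness is deliberately absent.\<close>

locale psd_form =
  fixes s :: "'a::euclidean_space \<Rightarrow> 'a \<Rightarrow> real"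
  assumes bilinear: "bilinear s"
    and sym: "s x y = s y x"
    and nonneg: "0 \<le> s x x"
begin

sublocale bounded_bilinear s
  using bilinear by (simp add: bilinear_conv_bounded_bilinear)

lemma cauchy_schwarz: "(s x y)\<^sup>2 \<le> s x x * s y y"
proof (cases "s y y = 0")
  case True
  have *: "0 \<le> s x x + 2 * a * s x y" for a
    using nonneg[of "x + a *\<^sub>R y"] True
    by (simp add: add_left add_right scaleR_left scaleR_right sym[of y x] algebra_simps)
  \<comment> \<open>When \<open>s y y = 0\<close> the quadratic in \<open>a\<close> is affine, and a
    nonnegative affine function has slope 0. The chosen \<open>a\<close> would give it the value
    -1.\<close>
  have "s x y = 0"
    using *[of "- (s x x + 1) / (2 * s x y)"] by (cases "s x y = 0") (auto simp: field_simps)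
  then show ?thesis using True by simp
next
  case False
  then have p: "0 < s y y" using nonneg[of y] by simp
  have "0 \<le> s (x - (s x y / s y y) *\<^sub>R y) (x - (s x y / s y y) *\<^sub>R y)"
    by (rule nonneg)
  also have "\<dots> = s x x - (s x y)\<^sup>2 / s y y"
    using p by (simp add: diff_left diff_right scaleR_left scaleR_right sym[of y x]
        power2_eq_square field_simps)
  finally show ?thesis using p by (simp add: field_simps)
qed

lemma polarization: "2 * s (x - y) x = s x x - s y y + s (x - y) (x - y)"
  by (simp add: diff_left diff_right sym[of y x])

lemma double_le: "2 * s x y \<le> s x x + s y y"
  using nonneg[of "x - y"] by (simp add: diff_left diff_right sym[of y x])

text \<open>For a degenerate form, \<open>s (u k) (u k)\<close> tending to 0 says nothing about
  \<open>u k\<close> itself. Cauchy-Schwarz still makes the pairing with a convergent sequence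
  vanish, which is how the proximal terms leave the optimality conditions in the limit.\<close>

lemma tendsto_zero_left:
  assumes "(\<lambda>k. s (u k) (u k)) \<longlonglongrightarrow> 0" "v \<longlonglongrightarrow> v0"
  shows "(\<lambda>k. s (u k) (v k)) \<longlonglongrightarrow> 0"
proof -
  have "(\<lambda>k. s (u k) (u k) * s (v k) (v k)) \<longlonglongrightarrow> 0 * s v0 v0"
    by (intro tendsto_intros assms tendsto)
  then have *: "(\<lambda>k. s (u k) (u k) * s (v k) (v k)) \<longlonglongrightarrow> 0" by simp
  have "(\<lambda>k. (s (u k) (v k))\<^sup>2) \<longlonglongrightarrow> 0"
    by (rule real_tendsto_sandwich[OF _ _ tendsto_const *]) (auto intro: always_eventually cauchy_schwarz)
  then have "(\<lambda>k. sqrt ((s (u k) (v k))\<^sup>2)) \<longlonglongrightarrow> sqrt 0"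
    by (intro tendsto_intros)
  then show ?thesis by (simp add: tendsto_rabs_zero_iff)
qed

end

text \<open>\<open>P\<close> is the Lyapunov function, \<open>e\<close> a correction that makes the
  sum decrease, \<open>D\<close> the dissipation. The sum \<open>P + e\<close> converges, so its
  decrements tend to 0 and force \<open>D\<close> to 0. The last hypothesis is conditional because
  in one of the two step-length regimes \<open>e\<close> is itself bounded by a multiple of the
  dissipation.\<close>

lemma energy_descent:
  fixes P e D :: "nat \<Rightarrow> real"
  assumes "\<And>k. 0 \<le> P k" "\<And>k. 0 \<le> e k" "\<And>k. 0 \<le> D k" "0 < \<epsilon>"
    and desc: "\<And>k. P (Suc k) + e (Suc k) + \<epsilon> * D k \<le> P k + e k"
    and e0: "D \<longlonglongrightarrow> 0 \<Longrightarrow> e \<longlonglongrightarrow> 0"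
  shows "D \<longlonglongrightarrow> 0" "convergent P"
proof -
  define F where "F k = P k + e k" for k
  have "decseq F"
    unfolding F_def decseq_Suc_iff using desc assms(3,4)
    by (metis add_increasing2 add_le_cancel_left dual_order.trans le_add_same_cancel1 mult_nonneg_nonneg order_less_imp_le)
  moreover have "0 \<le> F k" for k using assms by (simp add: F_def)
  ultimately obtain l where l: "F \<longlonglongrightarrow> l"
    using decseq_convergent[of F 0] by blast
  have "(\<lambda>k. (F k - F (Suc k)) / \<epsilon>) \<longlonglongrightarrow> (l - l) / \<epsilon>"
    using assms(4) by (intro tendsto_intros l LIMSEQ_Suc) auto
  then have "(\<lambda>k. (F k - F (Suc k)) / \<epsilon>) \<longlonglongrightarrow> 0" by simp
  moreover have "D k \<le> (F k - F (Suc k)) / \<epsilon>" for k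
    using desc[of k] assms(4) by (simp add: F_def field_simps)
  ultimately show D: "D \<longlonglongrightarrow> 0"
    using assms(3) by (intro real_tendsto_sandwich[of "\<lambda>_. 0" D]) auto
  have "(\<lambda>k. F k - e k) \<longlonglongrightarrow> l - 0"
    by (intro tendsto_intros l e0 D)
  then show "convergent P"
    unfolding F_def convergent_def by auto
qed

lemma inner_young: "2 * (a \<bullet> b) \<le> \<mu> * (norm a)\<^sup>2 + (norm b)\<^sup>2 / \<mu>"
  if "0 < \<mu>" for a b :: "'a::real_inner"
proof -
  have "0 \<le> (norm (\<mu> *\<^sub>R a - b))\<^sup>2 / \<mu>" using that by simp
  also have "\<dots> = \<mu> * (norm a)\<^sup>2 + (norm b)\<^sup>2 / \<mu> - 2 * (a \<bullet> b)"
    using that by (simp add: power2_norm_eq_inner algebra_simps inner_commute field_simps)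
  finally show ?thesis by simp
qed

lemma lyap_large_arith:
  fixes P P' n S T b c \<tau> :: real
  assumes "P' + (2 - \<tau>) * n + S + T + b - 2 * c \<le> P" "2 * c \<le> b / 2 + 2 * n"
    and "0 \<le> S" "0 \<le> T" "0 \<le> n"
  shows "P' + 1 / 2 * (n + S + T + b) \<le> P + (\<tau> + 3) * n"
proof -
  have "(2 - \<tau>) * n = 2 * n - \<tau> * n" "(\<tau> + 3) * n = \<tau> * n + 3 * n"
    by (simp_all add: algebra_simps)
  then show ?thesis using assms by argo
qed

text \<open>The two subproblems enter only through variational inequalities: objectives as
  differences over the constraint sets, coupling and proximal terms by their gradients. The residual
  in \<open>y_opt\<close> contains the old \<open>z k\<close>, that in \<open>z_opt\<close> the new
  one. Membership in \<open>Cy\<close> and \<open>Cz\<close> starts at index 1, so the starting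
  point is unrestricted.\<close>

locale sp_admm = s: psd_form s + t: psd_form t
  for s :: "'y::euclidean_space \<Rightarrow> 'y \<Rightarrow> real" and t :: "'z::euclidean_space \<Rightarrow> 'z \<Rightarrow> real" +
  fixes f :: "'y \<Rightarrow> real" and g :: "'z \<Rightarrow> real" and Cy :: "'y set" and Cz :: "'z set"
    and A :: "'y \<Rightarrow> 'x::euclidean_space" and B :: "'z \<Rightarrow> 'x"
    and \<beta> \<tau> :: real
    and y :: "nat \<Rightarrow> 'y" and z :: "nat \<Rightarrow> 'z" and x :: "nat \<Rightarrow> 'x"
  assumes linear_A: "linear A" and linear_B: "linear B"
    and cont_f: "continuous_on UNIV f" and cont_g: "continuous_on UNIV g"
    and closed_Cy: "closed Cy" and closed_Cz: "closed Cz"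
    and definite_y: "\<And>v. s v v = 0 \<Longrightarrow> A v = 0 \<Longrightarrow> v = 0"
    and definite_z: "\<And>v. t v v = 0 \<Longrightarrow> B v = 0 \<Longrightarrow> v = 0"
    and beta: "0 < \<beta>" and tau: "0 < \<tau>"
    and y_in: "\<And>k. y (Suc k) \<in> Cy" and z_in: "\<And>k. z (Suc k) \<in> Cz"
    and y_opt: "\<And>k v. v \<in> Cy \<Longrightarrow>
      0 \<le> f v - f (y (Suc k)) + (x k + \<beta> *\<^sub>R (A (y (Suc k)) + B (z k))) \<bullet> A (v - y (Suc k))
          + \<beta> * s (y (Suc k) - y k) (v - y (Suc k))"
    and z_opt: "\<And>k v. v \<in> Cz \<Longrightarrow>
      0 \<le> g v - g (z (Suc k)) + (x k + \<beta> *\<^sub>R (A (y (Suc k)) + B (z (Suc k)))) \<bullet> B (v - z (Suc k))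
          + \<beta> * t (z (Suc k) - z k) (v - z (Suc k))"
    and x_upd: "\<And>k. x (Suc k) = x k + (\<tau> * \<beta>) *\<^sub>R (A (y (Suc k)) + B (z (Suc k)))"
    and step: "\<tau> < (1 + sqrt 5) / 2 \<or> summable (\<lambda>k. (norm (A (y (Suc k)) + B (z (Suc k))))\<^sup>2)"
begin

text \<open>These are the saddle points of the ordinary Lagrangian: \<open>v\<close> minimizes
  \<open>f\<close> plus the pairing of \<open>p\<close> with \<open>A\<close> over
  \<open>Cy\<close>, \<open>w\<close> does the same for \<open>g\<close> and \<open>B\<close>, and
  the pair is feasible.\<close>

definition kkt :: "'y \<Rightarrow> 'z \<Rightarrow> 'x \<Rightarrow> bool" where
  "kkt v w p \<longleftrightarrow> v \<in> Cy \<and> w \<in> Cz \<and> A v + B w = 0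
     \<and> (\<forall>v'\<in>Cy. 0 \<le> f v' - f v + p \<bullet> A (v' - v))
     \<and> (\<forall>w'\<in>Cz. 0 \<le> g w' - g w + p \<bullet> B (w' - w))"

definition r :: "nat \<Rightarrow> 'x" where "r k = A (y k) + B (z k)"

abbreviation dy :: "nat \<Rightarrow> 'y" where "dy k \<equiv> y (Suc k) - y k"
abbreviation dz :: "nat \<Rightarrow> 'z" where "dz k \<equiv> z (Suc k) - z k"

text \<open>Everything is divided by \<open>\<beta>\<close>, so that only the multiplier term
  carries the parameters. The term in \<open>B\<close> compensates for the y-step working with the
  old \<open>z\<close>.\<close>

definition lyap :: "'y \<Rightarrow> 'z \<Rightarrow> 'x \<Rightarrow> nat \<Rightarrow> real" where
  "lyap v w p k = (norm (x k - p))\<^sup>2 / (\<tau> * \<beta>\<^sup>2) + s (y k - v) (y k - v)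
     + t (z k - w) (z k - w) + (norm (B (z k - w)))\<^sup>2"

section \<open>Descent of the Lyapunov function\<close>

lemma lyap_nonneg: "0 \<le> lyap v w p k"
  using tau beta by (simp add: lyap_def s.nonneg t.nonneg)

lemma z_opt': "v \<in> Cz \<Longrightarrow>
      0 \<le> g v - g (z (Suc k)) + (x k + \<beta> *\<^sub>R r (Suc k)) \<bullet> B (v - z (Suc k))
          + \<beta> * t (z (Suc k) - z k) (v - z (Suc k))"
  unfolding r_def by (rule z_opt)

lemma x_upd': "x (Suc k) = x k + (\<tau> * \<beta>) *\<^sub>R r (Suc k)"
  unfolding r_def by (rule x_upd)

lemmas A_simps = linear_diff[OF linear_A] linear_add[OF linear_A]
lemmas B_simps = linear_diff[OF linear_B] linear_add[OF linear_B]

text \<open>The lag between the two blocks is isolated as \<open>B (dz k)\<close>, so that both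
  optimality conditions refer to the same residual \<open>r (Suc k)\<close>.\<close>

lemma y_opt': "v \<in> Cy \<Longrightarrow>
      0 \<le> f v - f (y (Suc k)) + (x k + \<beta> *\<^sub>R (r (Suc k) - B (dz k))) \<bullet> A (v - y (Suc k))
          + \<beta> * s (y (Suc k) - y k) (v - y (Suc k))"
  using y_opt[of v k] by (simp add: r_def B_simps)

text \<open>The optimality conditions of the step are tested at the KKT point and the KKT
  inequalities at the new iterate. The objective differences cancel in the sum, and polarization
  turns the remaining products into differences of squares that telescope.\<close>

lemma lyap_step:
  assumes "kkt v w p"
  shows "lyap v w p (Suc k) + (2 - \<tau>) * (norm (r (Suc k)))\<^sup>2 + s (dy k) (dy k) + t (dz k) (dz k)
     + (norm (B (dz k)))\<^sup>2 - 2 * (B (dz k) \<bullet> r (Suc k)) \<le> lyap v w p k"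
proof -
  define ye ze xe where "ye = y (Suc k) - v" and "ze = z (Suc k) - w" and "xe = x k - p"
  have r: "r (Suc k) = A ye + B ze"
    using assms by (simp add: r_def kkt_def ye_def ze_def A_simps B_simps algebra_simps
        add_eq_0_iff)
  have neg: "A (v - y (Suc k)) = - A ye" "B (w - z (Suc k)) = - B ze"
    "s d (v - y (Suc k)) = - s d ye" "t d' (w - z (Suc k)) = - t d' ze" for d d'
    by (simp_all add: ye_def ze_def A_simps B_simps s.diff_right t.diff_right)
  have 1: "0 \<le> f v - f (y (Suc k)) - (x k + \<beta> *\<^sub>R (r (Suc k) - B (dz k))) \<bullet> A ye
       - \<beta> * s (dy k) ye"
    using y_opt'[of v k] assms unfolding kkt_def neg by simp
  have 2: "0 \<le> g w - g (z (Suc k)) - (x k + \<beta> *\<^sub>R r (Suc k)) \<bullet> B ze - \<beta> * t (dz k) ze"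
    using z_opt'[of w k] assms unfolding kkt_def neg by simp
  have 3: "0 \<le> f (y (Suc k)) - f v + p \<bullet> A ye" "0 \<le> g (z (Suc k)) - g w + p \<bullet> B ze"
    using assms y_in[of k] z_in[of k] unfolding kkt_def ye_def ze_def by auto
  \<comment> \<open>This substitution splits the lag term: the part with \<open>B ze\<close>
    telescopes by polarization, the part with \<open>r (Suc k)\<close> stays as the mixed term of
    the statement.\<close>
  have Aye: "A ye = r (Suc k) - B ze" using r by simp
  have "(xe + \<beta> *\<^sub>R r (Suc k)) \<bullet> r (Suc k) - \<beta> * (B (dz k) \<bullet> A ye)
      + \<beta> * s (dy k) ye + \<beta> * t (dz k) ze \<le> 0"
    using 1 2 3 unfolding xe_def r by (simp add: algebra_simps inner_commute)
  then have *: "2 * ((xe + \<beta> *\<^sub>R r (Suc k)) \<bullet> r (Suc k) - \<beta> * (B (dz k) \<bullet> A ye)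
      + \<beta> * s (dy k) ye + \<beta> * t (dz k) ze) / \<beta> \<le> 0"
    using beta by (simp add: field_simps)
  have main: "2 * (xe \<bullet> r (Suc k)) / \<beta> + 2 * (norm (r (Suc k)))\<^sup>2 - 2 * (B (dz k) \<bullet> r (Suc k))
      + 2 * (B (dz k) \<bullet> B ze) + 2 * s (dy k) ye + 2 * t (dz k) ze \<le> 0"
  proof -
    have "(xe + \<beta> *\<^sub>R r (Suc k)) \<bullet> r (Suc k) = xe \<bullet> r (Suc k) + \<beta> * (norm (r (Suc k)))\<^sup>2"
      by (simp only: inner_add_left[of xe] inner_scaleR_left power2_norm_eq_inner)
    moreover have "B (dz k) \<bullet> A ye = B (dz k) \<bullet> r (Suc k) - B (dz k) \<bullet> B ze"
      by (simp only: Aye inner_diff_right)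
    ultimately have "2 * ((xe \<bullet> r (Suc k) + \<beta> * (norm (r (Suc k)))\<^sup>2)
        - \<beta> * (B (dz k) \<bullet> r (Suc k) - B (dz k) \<bullet> B ze)
        + \<beta> * s (dy k) ye + \<beta> * t (dz k) ze) / \<beta> \<le> 0"
      using * by (simp only:)
    then show ?thesis
      using beta by (simp add: field_simps del: inner_add_right)
  qed
  have "x (Suc k) - p = xe + (\<tau> * \<beta>) *\<^sub>R r (Suc k)"
    by (simp add: x_upd' xe_def)
  moreover have "(norm (a + c *\<^sub>R b))\<^sup>2 = (norm a)\<^sup>2 + 2 * c * (a \<bullet> b) + c\<^sup>2 * (norm b)\<^sup>2"
    for a b :: 'x and c
    unfolding power2_norm_eq_inner
    by (simp add: inner_commute power2_eq_square algebra_simps)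
  ultimately have "(norm (x (Suc k) - p))\<^sup>2
      = (norm xe)\<^sup>2 + 2 * (\<tau> * \<beta>) * (xe \<bullet> r (Suc k)) + (\<tau> * \<beta>)\<^sup>2 * (norm (r (Suc k)))\<^sup>2"
    by (simp only:)
  \<comment> \<open>The weight \<open>1 / (\<tau> * \<beta>^2)\<close> makes the cross term equal to
    the one in \<open>main\<close>. The leftover \<open>\<tau> |r|^2\<close> is what reduces the
    factor 2 there to \<open>2 - \<tau>\<close>.\<close>
  then have e1: "(norm (x (Suc k) - p))\<^sup>2 / (\<tau> * \<beta>\<^sup>2)
      = (norm xe)\<^sup>2 / (\<tau> * \<beta>\<^sup>2) + 2 * (xe \<bullet> r (Suc k)) / \<beta> + \<tau> * (norm (r (Suc k)))\<^sup>2"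
    using tau beta by (simp add: field_simps power2_eq_square)
  have e2: "2 * s (dy k) ye = s ye ye - s (y k - v) (y k - v) + s (dy k) (dy k)"
    using s.polarization[of ye "y k - v"] by (simp add: ye_def)
  have e3: "2 * t (dz k) ze = t ze ze - t (z k - w) (z k - w) + t (dz k) (dz k)"
    using t.polarization[of ze "z k - w"] by (simp add: ze_def)
  have "B (dz k) = B ze - B (z k - w)"
    by (simp add: ze_def B_simps)
  then have e4: "2 * (B (dz k) \<bullet> B ze) = (norm (B ze))\<^sup>2 - (norm (B (z k - w)))\<^sup>2 + (norm (B (dz k)))\<^sup>2"
    by (simp add: power2_norm_eq_inner inner_diff_left inner_diff_right inner_commute)
  show ?thesis
    using main e1 e2 e3 e4 unfolding lyap_def xe_def ye_def ze_def
    by (simp add: algebra_simps)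
qed

text \<open>Monotonicity: the conditions of two consecutive z-steps are tested at each other's
  iterate and added, so \<open>g\<close> cancels. The multiplier update turns the difference of the
  two dual arguments into \<open>\<beta>\<close> times
  \<open>r (k+2) - (1 - \<tau>) r (k+1)\<close>. Both iterates must lie in \<open>Cz\<close>, hence
  the comparison starts with \<open>z 1\<close>.\<close>

lemma dz_step:
  "(r (Suc (Suc k)) - (1 - \<tau>) *\<^sub>R r (Suc k)) \<bullet> B (dz (Suc k))
     + t (dz (Suc k)) (dz (Suc k)) - t (dz k) (dz (Suc k)) \<le> 0"
proof -
  let ?z0 = "z (Suc k)" and ?z1 = "z (Suc (Suc k))"
  have m: "B (?z0 - ?z1) = - B (dz (Suc k))" "t d (?z0 - ?z1) = - t d (dz (Suc k))" for d
    by (simp_all add: B_simps t.diff_right)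
  have "0 \<le> g ?z0 - g ?z1 - (x (Suc k) + \<beta> *\<^sub>R r (Suc (Suc k))) \<bullet> B (dz (Suc k))
     - \<beta> * t (dz (Suc k)) (dz (Suc k))"
    using z_opt'[of ?z0 "Suc k"] z_in unfolding m by simp
  moreover have "0 \<le> g ?z1 - g ?z0 + (x k + \<beta> *\<^sub>R r (Suc k)) \<bullet> B (dz (Suc k))
     + \<beta> * t (dz k) (dz (Suc k))"
    using z_opt'[of ?z1 k] z_in by simp
  ultimately have "0 \<le> - (\<beta> *\<^sub>R (r (Suc (Suc k)) - (1 - \<tau>) *\<^sub>R r (Suc k))) \<bullet> B (dz (Suc k))
     - \<beta> * t (dz (Suc k)) (dz (Suc k)) + \<beta> * t (dz k) (dz (Suc k))"
    unfolding x_upd' by (simp add: algebra_simps inner_diff_left inner_add_left)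
  then have "\<beta> * ((r (Suc (Suc k)) - (1 - \<tau>) *\<^sub>R r (Suc k)) \<bullet> B (dz (Suc k))
     + t (dz (Suc k)) (dz (Suc k)) - t (dz k) (dz (Suc k))) \<le> 0"
    by (simp add: algebra_simps)
  then show ?thesis using beta by (simp add: mult_le_0_iff)
qed

definition D :: "nat \<Rightarrow> real" where
  "D k = (norm (r (Suc k)))\<^sup>2 + s (dy k) (dy k) + t (dz k) (dz k) + (norm (B (dz k)))\<^sup>2"

lemma D_nonneg: "0 \<le> D k"
  by (simp add: D_def s.nonneg t.nonneg)

text \<open>\<open>dz_step\<close> exchanges the mixed term with the new residual for one with the
  old residual. Its cross product of consecutive increments under \<open>t\<close> is split evenly:
  one half is the correction carried from the previous step, the other is paid by the dissipation.
  The correction \<open>c |r|^2\<close> pays for the old residual.\<close>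

lemma lyap_step_golden:
  assumes "\<tau> < (1 + sqrt 5) / 2"
  obtains c \<epsilon> where "0 \<le> c" "0 < \<epsilon>"
    "\<And>v w p k. kkt v w p \<Longrightarrow>
       lyap v w p (Suc (Suc k)) + (t (dz (Suc k)) (dz (Suc k)) + c * (norm (r (Suc (Suc k))))\<^sup>2)
         + \<epsilon> * D (Suc k)
       \<le> lyap v w p (Suc k) + (t (dz k) (dz k) + c * (norm (r (Suc k)))\<^sup>2)"
proof -
  \<comment> \<open>For \<tau> \<le> 1 Young's inequality is used with weight 1, for \<tau> > 1 with
    weight \<tau>; \<open>c\<close> is the resulting coefficient of the old residual. In the second
    case the remaining coefficients are \<open>1 + 1/\<tau> - \<tau>\<close> for the new residual
    and \<open>1 + \<tau> - \<tau>^2\<close> for \<open>B (dz (Suc k))\<close>, and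
    \<open>\<epsilon>\<close> is the smaller one.\<close>
  define c where "c = (if \<tau> \<le> 1 then 1 - \<tau> else 1 - 1 / \<tau>)"
  define \<epsilon> where "\<epsilon> = (if \<tau> \<le> 1 then \<tau> else min (1 + 1 / \<tau> - \<tau>) (1 + \<tau> - \<tau>\<^sup>2))"
  have c0: "0 \<le> c" using tau by (simp add: c_def)
  \<comment> \<open>Completing the square, the golden ratio inequality reads
    \<open>(2\<tau> - 1)^2 < 5\<close>.\<close>
  have gold: "\<tau>\<^sup>2 < 1 + \<tau>"
  proof -
    have "1 < sqrt 5" by (rule real_less_rsqrt) simp
    then have "\<bar>2 * \<tau> - 1\<bar> < sqrt 5" using assms tau
      unfolding abs_less_iff by argo
    then have "\<bar>2 * \<tau> - 1\<bar>\<^sup>2 < (sqrt 5)\<^sup>2"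
      by (intro power_strict_mono) auto
    then have "(2 * \<tau> - 1)\<^sup>2 < 5" by simp
    then show ?thesis by (simp add: power2_eq_square algebra_simps)
  qed
  have e0: "0 < \<epsilon>"
    using tau gold by (auto simp: \<epsilon>_def field_simps power2_eq_square)
  have e1: "\<epsilon> \<le> 1"
  proof (cases "\<tau> \<le> 1")
    case False
    then have "1 + \<tau> - \<tau>\<^sup>2 \<le> 1" by (simp add: power2_eq_square)
    with False show ?thesis unfolding \<epsilon>_def by (simp add: min.coboundedI2)
  qed (simp add: \<epsilon>_def)
  show thesis
  proof (rule that[OF c0 e0])
    fix v w p k assume kkt: "kkt v w p"
    let ?r1 = "(norm (r (Suc (Suc k))))\<^sup>2" and ?r0 = "(norm (r (Suc k)))\<^sup>2"
    let ?b = "(norm (B (dz (Suc k))))\<^sup>2" and ?T1 = "t (dz (Suc k)) (dz (Suc k))"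
    let ?S = "s (dy (Suc k)) (dy (Suc k))" and ?c = "B (dz (Suc k)) \<bullet> r (Suc k)"
    have T: "2 * t (dz k) (dz (Suc k)) \<le> t (dz k) (dz k) + ?T1"
      by (rule t.double_le)
    have "2 * (B (dz (Suc k)) \<bullet> r (Suc (Suc k))) \<le> 2 * (1 - \<tau>) * ?c - ?T1 + t (dz k) (dz k)"
      using dz_step[of k] T
      by (simp only: inner_diff_left inner_scaleR_left inner_commute[of "B (dz (Suc k))"] mult.assoc)
    with lyap_step[OF kkt, of "Suc k"]
    have main: "lyap v w p (Suc (Suc k)) + ?T1 + (2 - \<tau>) * ?r1 + ?S + ?T1 + ?b - 2 * (1 - \<tau>) * ?c
        \<le> lyap v w p (Suc k) + t (dz k) (dz k)"
      by linarith
    have "2 * (1 - \<tau>) * ?c \<le> c * ?r0 + (2 - \<tau> - c - \<epsilon>) * ?r1 + (1 - \<epsilon>) * ?b"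
    proof (cases "\<tau> \<le> 1")
      case True
      have "(1 - \<tau>) * (2 * ?c) \<le> (1 - \<tau>) * (?b + ?r0)"
        using inner_young[of 1 "B (dz (Suc k))" "r (Suc k)"] True by (intro mult_left_mono) auto
      moreover have "0 \<le> (2 - \<tau> - c - \<epsilon>) * ?r1" using True by (simp add: c_def \<epsilon>_def)
      ultimately show ?thesis using True by (simp add: c_def \<epsilon>_def algebra_simps)
    next
      case False
      \<comment> \<open>Here \<open>1 - \<tau>\<close> is negative, so the minus sign is moved to
        the increment before Young's inequality is applied.\<close>
      have "(\<tau> - 1) * (2 * ((- B (dz (Suc k))) \<bullet> r (Suc k))) \<le> (\<tau> - 1) * (\<tau> * ?b + ?r0 / \<tau>)"
        using inner_young[of \<tau> "- B (dz (Suc k))" "r (Suc k)"] False by (intro mult_left_mono) auto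
      then have "2 * (1 - \<tau>) * ?c \<le> c * ?r0 + (\<tau>\<^sup>2 - \<tau>) * ?b"
        using False by (simp add: c_def algebra_simps diff_divide_distrib power2_eq_square)
      moreover have "(\<tau>\<^sup>2 - \<tau>) * ?b \<le> (1 - \<epsilon>) * ?b" "0 \<le> (2 - \<tau> - c - \<epsilon>) * ?r1"
        using False by (auto simp: \<epsilon>_def c_def min_def intro!: mult_right_mono mult_nonneg_nonneg)
      ultimately show ?thesis by linarith
    qed
    moreover have "\<epsilon> * ?S \<le> ?S" "\<epsilon> * ?T1 \<le> ?T1"
      using e1 e0 s.nonneg t.nonneg by (auto intro!: mult_left_le_one_le)
    ultimately show "lyap v w p (Suc (Suc k)) + (?T1 + c * ?r1) + \<epsilon> * D (Suc k)
       \<le> lyap v w p (Suc k) + (t (dz k) (dz k) + c * ?r0)"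
      using main unfolding D_def by (simp add: algebra_simps)
  qed
qed

text \<open>The residual is not absorbed: it is moved to the right-hand side with a generous factor,
  where it will be a summable perturbation.\<close>

lemma lyap_step_large:
  assumes "kkt v w p"
  shows "lyap v w p (Suc k) + 1 / 2 * D k \<le> lyap v w p k + (\<tau> + 3) * (norm (r (Suc k)))\<^sup>2"
proof -
  let ?r = "(norm (r (Suc k)))\<^sup>2"
  have "2 * (B (dz k) \<bullet> r (Suc k)) \<le> (norm (B (dz k)))\<^sup>2 / 2 + 2 * ?r"
    using inner_young[of "1/2" "B (dz k)" "r (Suc k)"] by simp
  with lyap_step[OF assms, of k] show ?thesis
    unfolding D_def by (rule lyap_large_arith) (simp_all add: s.nonneg t.nonneg)
qed

lemma lyap_convergent:
  assumes kkt: "kkt v w p"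
  shows "D \<longlonglongrightarrow> 0" "convergent (lyap v w p)"
proof -
  have "(\<lambda>k. D (Suc k)) \<longlonglongrightarrow> 0 \<and> convergent (\<lambda>k. lyap v w p (Suc k))"
  proof (cases "\<tau> < (1 + sqrt 5) / 2")
    case True
    obtain c \<epsilon> where ce: "0 \<le> c" "0 < \<epsilon>"
      "\<And>v w p k. kkt v w p \<Longrightarrow>
       lyap v w p (Suc (Suc k)) + (t (dz (Suc k)) (dz (Suc k)) + c * (norm (r (Suc (Suc k))))\<^sup>2)
         + \<epsilon> * D (Suc k)
       \<le> lyap v w p (Suc k) + (t (dz k) (dz k) + c * (norm (r (Suc k)))\<^sup>2)"
      using lyap_step_golden[OF True] by blast
    \<comment> \<open>The correction is at most \<open>(1 + c) * D k\<close>, so it vanishes once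
      the dissipation does.\<close>
    define e where "e k = t (dz k) (dz k) + c * (norm (r (Suc k)))\<^sup>2" for k
    have e: "0 \<le> e k" "e k \<le> (1 + c) * D k" for k
      using ce(1) s.nonneg[of "dy k"] t.nonneg[of "dz k"]
      by (auto simp: e_def D_def algebra_simps intro: add_increasing)
    have "e \<longlonglongrightarrow> 0" if "(\<lambda>k. D (Suc k)) \<longlonglongrightarrow> 0"
    proof -
      have "D \<longlonglongrightarrow> 0" using that LIMSEQ_imp_Suc by blast
      then have "(\<lambda>k. (1 + c) * D k) \<longlonglongrightarrow> (1 + c) * 0"
        by (intro tendsto_intros)
      then show ?thesis using e
        by (intro real_tendsto_sandwich[of "\<lambda>_. 0" e _ "\<lambda>k. (1 + c) * D k"]) auto
    qed
    then show ?thesis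
      using energy_descent[of "\<lambda>k. lyap v w p (Suc k)" e "\<lambda>k. D (Suc k)" \<epsilon>]
        lyap_nonneg e(1) D_nonneg ce(2) ce(3)[OF kkt] unfolding e_def by blast
  next
    case False
    define q where "q k = (norm (r (Suc k)))\<^sup>2" for k
    have q: "summable q" using False step by (simp add: q_def[abs_def] r_def)
    \<comment> \<open>The tail of the residual series: its decrement is exactly the amount by which
      the Lyapunov function may grow in the step from \<open>Suc k\<close> to
      \<open>Suc (Suc k)\<close>, so the sum of the two decreases.\<close>
    define e where "e k = (\<tau> + 3) * (\<Sum>j. q (j + Suc k))" for k
    have tail: "summable (\<lambda>j. q (j + m))" for m using q by (simp add: summable_iff_shift)
    have e_nonneg: "0 \<le> e k" for k
      using tau tail[of "Suc k"] by (auto simp: e_def q_def intro!: mult_nonneg_nonneg suminf_nonneg)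
    have es: "e k = e (Suc k) + (\<tau> + 3) * q (Suc k)" for k
    proof -
      have "(\<Sum>j. q (j + Suc k)) = (\<Sum>j. q (j + Suc (Suc k))) + q (Suc k)"
        using suminf_split_head[OF tail[of "Suc k"]] by simp
      then show ?thesis by (simp only: e_def distrib_left)
    qed
    have desc: "lyap v w p (Suc (Suc k)) + e (Suc k) + 1/2 * D (Suc k) \<le> lyap v w p (Suc k) + e k" for k
      using lyap_step_large[OF kkt, of "Suc k"] es[of k] unfolding q_def by linarith
    have "(\<lambda>k. (\<tau> + 3) * (\<Sum>j. q (j + Suc k))) \<longlonglongrightarrow> (\<tau> + 3) * 0"
      by (intro tendsto_intros LIMSEQ_Suc suminf_exist_split2 q)
    then have "e \<longlonglongrightarrow> 0" by (simp add: e_def[abs_def])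
    then show ?thesis
      using energy_descent[of "\<lambda>k. lyap v w p (Suc k)" e "\<lambda>k. D (Suc k)" "1/2"]
        lyap_nonneg e_nonneg D_nonneg desc by simp
  qed
  then show "D \<longlonglongrightarrow> 0" "convergent (lyap v w p)"
    using LIMSEQ_imp_Suc convergent_Suc_iff by blast+
qed

lemma D_tendsto_0:
  assumes "D \<longlonglongrightarrow> 0"
  shows "r \<longlonglongrightarrow> 0" "(\<lambda>k. s (dy k) (dy k)) \<longlonglongrightarrow> 0" "(\<lambda>k. t (dz k) (dz k)) \<longlonglongrightarrow> 0"
    "(\<lambda>k. B (dz k)) \<longlonglongrightarrow> 0"
proof -
  have *: "q \<longlonglongrightarrow> 0" if "\<And>k. 0 \<le> q k" "\<And>k. q k \<le> D k" for q
    using that assms by (intro real_tendsto_sandwich[of "\<lambda>_. 0" q _ D]) auto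
  have sq: "q \<longlonglongrightarrow> 0" if "\<And>k. (norm (q k))\<^sup>2 \<le> D k" for q :: "nat \<Rightarrow> 'x"
  proof -
    have "(\<lambda>k. sqrt ((norm (q k))\<^sup>2)) \<longlonglongrightarrow> sqrt 0"
      by (intro tendsto_intros * that) auto
    then show ?thesis by (simp add: tendsto_norm_zero_iff)
  qed
  have "(\<lambda>k. r (Suc k)) \<longlonglongrightarrow> 0"
    by (rule sq) (simp add: D_def s.nonneg t.nonneg)
  then show "r \<longlonglongrightarrow> 0" by (rule LIMSEQ_imp_Suc)
  show "(\<lambda>k. B (dz k)) \<longlonglongrightarrow> 0"
    by (rule sq) (simp add: D_def s.nonneg t.nonneg)
  show "(\<lambda>k. s (dy k) (dy k)) \<longlonglongrightarrow> 0" "(\<lambda>k. t (dz k) (dz k)) \<longlonglongrightarrow> 0"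
    by (rule *; simp add: D_def s.nonneg t.nonneg)+
qed

section \<open>Boundedness and convergence of the iterates\<close>

lemma coercive_y: obtains c where "0 < c" "\<And>v. c * (norm v)\<^sup>2 \<le> s v v + (norm (A v))\<^sup>2"
proof -
  have "bilinear (\<lambda>v w. s v w + A v \<bullet> A w)"
    by (auto simp: bilinear_def intro!: linearI simp: s.add_left s.add_right s.scaleR_left s.scaleR_right
       A_simps linear_scale[OF linear_A] algebra_simps)
  moreover have "0 < s v v + A v \<bullet> A v" if "v \<noteq> 0" for v
  proof -
    have "s v v \<noteq> 0 \<or> A v \<bullet> A v \<noteq> 0" using definite_y[of v] that by auto
    then show ?thesis using s.nonneg[of v] inner_ge_zero[of "A v"] by linarith
  qed
  ultimately obtain c where "0 < c" "\<And>v. c * (norm v)\<^sup>2 \<le> s v v + A v \<bullet> A v"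
    using bilinear_coercive[of "\<lambda>v w. s v w + A v \<bullet> A w"] by auto
  then show thesis by (intro that[of c]) (auto simp: power2_norm_eq_inner)
qed

lemma coercive_z: obtains c where "0 < c" "\<And>v. c * (norm v)\<^sup>2 \<le> t v v + (norm (B v))\<^sup>2"
proof -
  have "bilinear (\<lambda>v w. t v w + B v \<bullet> B w)"
    by (auto simp: bilinear_def intro!: linearI simp: t.add_left t.add_right t.scaleR_left t.scaleR_right
       B_simps linear_scale[OF linear_B] algebra_simps)
  moreover have "0 < t v v + B v \<bullet> B v" if "v \<noteq> 0" for v
  proof -
    have "t v v \<noteq> 0 \<or> B v \<bullet> B v \<noteq> 0" using definite_z[of v] that by auto
    then show ?thesis using t.nonneg[of v] inner_ge_zero[of "B v"] by linarith
  qed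
  ultimately obtain c where "0 < c" "\<And>v. c * (norm v)\<^sup>2 \<le> t v v + B v \<bullet> B v"
    using bilinear_coercive[of "\<lambda>v w. t v w + B v \<bullet> B w"] by auto
  then show thesis by (intro that[of c]) (auto simp: power2_norm_eq_inner)
qed


text \<open>The multiplier and \<open>z\<close> are controlled by the Lyapunov function alone, since
  it contains \<open>t\<close> and the \<open>B\<close> term. For \<open>y\<close> it contains only
  \<open>s\<close>; the missing \<open>A (y k - v)\<close> equals the residual minus
  \<open>B (z k - w)\<close> by feasibility of the KKT point, so the residual appears in the
  bound.\<close>

lemma lyap_bounds:
  assumes "kkt v w p"
  obtains c where "0 < c"
    "\<And>k. (norm (x k - p))\<^sup>2 \<le> c * lyap v w p k"
    "\<And>k. (norm (z k - w))\<^sup>2 \<le> c * lyap v w p k"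
    "\<And>k. (norm (y k - v))\<^sup>2 \<le> c * (lyap v w p k + (norm (r k))\<^sup>2)"
proof -
  obtain cy where cy: "0 < cy" "\<And>u. cy * (norm u)\<^sup>2 \<le> s u u + (norm (A u))\<^sup>2"
    using coercive_y by blast
  obtain cz where cz: "0 < cz" "\<And>u. cz * (norm u)\<^sup>2 \<le> t u u + (norm (B u))\<^sup>2"
    using coercive_z by blast
  let ?L = "lyap v w p"
  have terms: "(norm (x k - p))\<^sup>2 / (\<tau> * \<beta>\<^sup>2) \<le> ?L k" "s (y k - v) (y k - v) + (norm (B (z k - w)))\<^sup>2 \<le> ?L k"
    "t (z k - w) (z k - w) + (norm (B (z k - w)))\<^sup>2 \<le> ?L k" for k
    using tau beta s.nonneg[of "y k - v"] t.nonneg[of "z k - w"] by (simp_all add: lyap_def)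
  have x: "(norm (x k - p))\<^sup>2 \<le> (\<tau> * \<beta>\<^sup>2) * ?L k" for k
    using terms(1)[of k] tau beta by (simp add: field_simps)
  have z: "(norm (z k - w))\<^sup>2 \<le> (1 / cz) * ?L k" for k
    using order_trans[OF cz(2) terms(3)[of k]] cz(1) by (simp add: field_simps)
  have y: "(norm (y k - v))\<^sup>2 \<le> (2 / cy) * (?L k + (norm (r k))\<^sup>2)" for k
  proof -
    have "A (y k - v) = r k - B (z k - w)"
      using assms by (simp add: r_def kkt_def A_simps B_simps add_eq_0_iff)
    moreover have "(norm (r k - B (z k - w)))\<^sup>2 \<le> 2 * (norm (r k))\<^sup>2 + 2 * (norm (B (z k - w)))\<^sup>2"
      using inner_young[of 1 "r k" "- B (z k - w)"]
      by (simp add: power2_norm_eq_inner inner_diff_left inner_diff_right inner_commute)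
    ultimately have "cy * (norm (y k - v))\<^sup>2 \<le> s (y k - v) (y k - v) + (2 * (norm (r k))\<^sup>2 + 2 * (norm (B (z k - w)))\<^sup>2)"
      using cy(2)[of "y k - v"] by simp
    also have "\<dots> \<le> 2 * (?L k + (norm (r k))\<^sup>2)"
      using terms(2)[of k] s.nonneg[of "y k - v"] by simp
    finally show ?thesis using cy(1) by (simp add: field_simps)
  qed
  define c where "c = max (\<tau> * \<beta>\<^sup>2) (max (1 / cz) (2 / cy))"
  have c: "\<tau> * \<beta>\<^sup>2 \<le> c" "1 / cz \<le> c" "2 / cy \<le> c" by (auto simp: c_def)
  show thesis
  proof
    show "0 < c" using c(2) cz(1) by (smt (verit) zero_less_divide_1_iff)
    show "(norm (x k - p))\<^sup>2 \<le> c * ?L k" "(norm (z k - w))\<^sup>2 \<le> c * ?L k"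
      "(norm (y k - v))\<^sup>2 \<le> c * (?L k + (norm (r k))\<^sup>2)" for k
      using lyap_nonneg[of v w p k]
      by (auto intro: order_trans[OF x mult_right_mono[OF c(1)]] order_trans[OF z mult_right_mono[OF c(2)]]
          order_trans[OF y mult_right_mono[OF c(3)]])
  qed
qed

lemma tendsto_A: "u \<longlonglongrightarrow> u0 \<Longrightarrow> (\<lambda>k. A (u k)) \<longlonglongrightarrow> A u0"
  using linear_A linear_conv_bounded_linear bounded_linear.tendsto by blast

lemma tendsto_B: "u \<longlonglongrightarrow> u0 \<Longrightarrow> (\<lambda>k. B (u k)) \<longlonglongrightarrow> B u0"
  using linear_B linear_conv_bounded_linear bounded_linear.tendsto by blast

text \<open>The optimality inequalities pass to the limit: the lag \<open>B (dz k)\<close> and the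
  proximal pairings vanish. The subsequence is taken at successor indices, where the iterates
  satisfy the constraints and the inequalities hold.\<close>

lemma cluster_point_kkt:
  assumes D: "D \<longlonglongrightarrow> 0" and \<rho>: "strict_mono \<rho>"
    and y: "(\<lambda>i. y (Suc (\<rho> i))) \<longlonglongrightarrow> v" and z: "(\<lambda>i. z (Suc (\<rho> i))) \<longlonglongrightarrow> w"
    and x: "(\<lambda>i. x (Suc (\<rho> i))) \<longlonglongrightarrow> p"
  shows "kkt v w p"
proof -
  note sub = LIMSEQ_subseq_LIMSEQ[OF _ \<rho>, unfolded o_def]
  have r: "(\<lambda>i. r (Suc (\<rho> i))) \<longlonglongrightarrow> 0"
    by (rule sub[OF LIMSEQ_Suc[OF D_tendsto_0(1)[OF D]]])
  have Bdz: "(\<lambda>i. B (dz (\<rho> i))) \<longlonglongrightarrow> 0"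
    by (rule sub[OF D_tendsto_0(4)[OF D]])
  have ss: "(\<lambda>i. s (dy (\<rho> i)) (dy (\<rho> i))) \<longlonglongrightarrow> 0"
    by (rule sub[OF D_tendsto_0(2)[OF D]])
  have tt: "(\<lambda>i. t (dz (\<rho> i)) (dz (\<rho> i))) \<longlonglongrightarrow> 0"
    by (rule sub[OF D_tendsto_0(3)[OF D]])
  \<comment> \<open>The inequalities involve the multiplier before the update; it differs from the
    updated one by a multiple of the vanishing residual.\<close>
  have x0: "(\<lambda>i. x (\<rho> i)) \<longlonglongrightarrow> p"
  proof -
    have "(\<lambda>i. x (Suc (\<rho> i)) - (\<tau> * \<beta>) *\<^sub>R r (Suc (\<rho> i))) \<longlonglongrightarrow> p - (\<tau> * \<beta>) *\<^sub>R 0"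
      by (intro tendsto_intros x r)
    then show ?thesis by (simp add: x_upd')
  qed
  have f: "(\<lambda>i. f (y (Suc (\<rho> i)))) \<longlonglongrightarrow> f v"
    using cont_f y by (auto simp: continuous_on_eq_continuous_at intro: isCont_tendsto_compose)
  have g: "(\<lambda>i. g (z (Suc (\<rho> i)))) \<longlonglongrightarrow> g w"
    using cont_g z by (auto simp: continuous_on_eq_continuous_at intro: isCont_tendsto_compose)
  show ?thesis
    unfolding kkt_def
  proof (intro conjI ballI)
    show "v \<in> Cy" using closed_Cy y y_in closed_sequentially by metis
    show "w \<in> Cz" using closed_Cz z z_in closed_sequentially by metis
    have "(\<lambda>i. r (Suc (\<rho> i))) \<longlonglongrightarrow> A v + B w"
      unfolding r_def by (intro tendsto_intros tendsto_A tendsto_B y z)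
    with r show "A v + B w = 0" using LIMSEQ_unique by blast
    show "0 \<le> f v' - f v + p \<bullet> A (v' - v)" if "v' \<in> Cy" for v'
    proof -
      have "(\<lambda>i. f v' - f (y (Suc (\<rho> i)))
            + (x (\<rho> i) + \<beta> *\<^sub>R (r (Suc (\<rho> i)) - B (dz (\<rho> i)))) \<bullet> A (v' - y (Suc (\<rho> i)))
            + \<beta> * s (dy (\<rho> i)) (v' - y (Suc (\<rho> i))))
          \<longlonglongrightarrow> f v' - f v + (p + \<beta> *\<^sub>R (0 - 0)) \<bullet> A (v' - v) + \<beta> * 0"
        by (intro tendsto_intros tendsto_A s.tendsto_zero_left[OF ss tendsto_diff[OF tendsto_const y]] x0 r Bdz f y)
      from LIMSEQ_le_const[OF this, of 0] show ?thesis
        using y_opt'[OF that] by auto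
    qed
    show "0 \<le> g w' - g w + p \<bullet> B (w' - w)" if "w' \<in> Cz" for w'
    proof -
      have "(\<lambda>i. g w' - g (z (Suc (\<rho> i)))
            + (x (\<rho> i) + \<beta> *\<^sub>R r (Suc (\<rho> i))) \<bullet> B (w' - z (Suc (\<rho> i)))
            + \<beta> * t (dz (\<rho> i)) (w' - z (Suc (\<rho> i))))
          \<longlonglongrightarrow> g w' - g w + (p + \<beta> *\<^sub>R 0) \<bullet> B (w' - w) + \<beta> * 0"
        by (intro tendsto_intros tendsto_B t.tendsto_zero_left[OF tt tendsto_diff[OF tendsto_const z]] x0 r g z)
      from LIMSEQ_le_const[OF this, of 0] show ?thesis
        using z_opt'[OF that] by auto
    qed
  qed
qed

theorem converges:
  assumes "kkt v0 w0 p0"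
  obtains v w p where "kkt v w p" "y \<longlonglongrightarrow> v" "z \<longlonglongrightarrow> w" "x \<longlonglongrightarrow> p"
proof -
  have D: "D \<longlonglongrightarrow> 0" by (rule lyap_convergent(1)[OF assms])
  have r: "r \<longlonglongrightarrow> 0" by (rule D_tendsto_0(1)[OF D])
  obtain c where c: "0 < c"
    "\<And>k. (norm (x k - p0))\<^sup>2 \<le> c * lyap v0 w0 p0 k"
    "\<And>k. (norm (z k - w0))\<^sup>2 \<le> c * lyap v0 w0 p0 k"
    "\<And>k. (norm (y k - v0))\<^sup>2 \<le> c * (lyap v0 w0 p0 k + (norm (r k))\<^sup>2)"
    using lyap_bounds[OF assms] by blast
  obtain L0 where "lyap v0 w0 p0 \<longlonglongrightarrow> L0"
    using lyap_convergent(2)[OF assms] by (auto simp: convergent_def)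
  then have "(\<lambda>k. c * (lyap v0 w0 p0 k + (norm (r k))\<^sup>2)) \<longlonglongrightarrow> c * (L0 + (norm (0::'x))\<^sup>2)"
    by (intro tendsto_intros r)
  then have "convergent (\<lambda>k. c * (lyap v0 w0 p0 k + (norm (r k))\<^sup>2))"
    by (auto simp: convergent_def)
  then have "Bseq (\<lambda>k. c * (lyap v0 w0 p0 k + (norm (r k))\<^sup>2))"
    by (rule convergent_imp_Bseq)
  then obtain M where M: "0 < M" "\<And>k. norm (c * (lyap v0 w0 p0 k + (norm (r k))\<^sup>2)) \<le> M"
    by (auto elim: BseqE)
  have M: "c * (lyap v0 w0 p0 k + (norm (r k))\<^sup>2) \<le> M" for k
    using M(2)[of k] by simp
  have le: "c * lyap v0 w0 p0 k \<le> c * (lyap v0 w0 p0 k + (norm (r k))\<^sup>2)" for k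
    using c(1) by simp
  have bnd: "bounded (range q)" if "\<And>k. (norm (q k - q0))\<^sup>2 \<le> M" for q :: "nat \<Rightarrow> 'b::euclidean_space" and q0
  proof -
    have "norm (q k) \<le> sqrt M + norm q0" for k
      using real_le_rsqrt[OF that[of k]] norm_triangle_sub[of "q k" q0] by simp
    then show ?thesis by (auto simp: bounded_iff)
  qed
  have bx: "bounded (range x)" by (rule bnd[OF order_trans[OF c(2) order_trans[OF le M]]])
  have bz: "bounded (range z)" by (rule bnd[OF order_trans[OF c(3) order_trans[OF le M]]])
  have byy: "bounded (range y)" by (rule bnd[OF order_trans[OF c(4) M]])
  have "bounded (range (\<lambda>k. (y (Suc k), z (Suc k), x (Suc k))))"
    by (rule bounded_subset[OF bounded_Times[OF byy bounded_Times[OF bz bx]]]) auto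
  then obtain l \<rho> where \<rho>: "strict_mono \<rho>" "((\<lambda>k. (y (Suc k), z (Suc k), x (Suc k))) \<circ> \<rho>) \<longlonglongrightarrow> l"
    using bounded_imp_convergent_subsequence by blast
  obtain v w p where l: "l = (v, w, p)" by (cases l)
  note lim = tendsto_fst[OF \<rho>(2)] tendsto_fst[OF tendsto_snd[OF \<rho>(2)]] tendsto_snd[OF tendsto_snd[OF \<rho>(2)]]
  have ys: "(\<lambda>i. y (Suc (\<rho> i))) \<longlonglongrightarrow> v" and zs: "(\<lambda>i. z (Suc (\<rho> i))) \<longlonglongrightarrow> w"
    and xs: "(\<lambda>i. x (Suc (\<rho> i))) \<longlonglongrightarrow> p"
    using lim by (simp_all add: l o_def)
  have kkt: "kkt v w p" by (rule cluster_point_kkt[OF D \<rho>(1) ys zs xs])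
  \<comment> \<open>With the cluster point as reference, the Lyapunov function tends to 0 along the
    subsequence. As it converges along the whole sequence, its limit is 0.\<close>
  have "(\<lambda>i. lyap v w p (Suc (\<rho> i))) \<longlonglongrightarrow>
     (norm (p - p))\<^sup>2 / (\<tau> * \<beta>\<^sup>2) + s (v - v) (v - v) + t (w - w) (w - w) + (norm (B (w - w)))\<^sup>2"
    unfolding lyap_def using tau beta
    by (intro tendsto_intros tendsto_B s.tendsto t.tendsto ys zs xs) auto
  then have "(\<lambda>i. lyap v w p (Suc (\<rho> i))) \<longlonglongrightarrow> 0"
    by (simp add: s.zero_left t.zero_left linear_0[OF linear_B])
  moreover obtain L where L: "lyap v w p \<longlonglongrightarrow> L"
    using lyap_convergent(2)[OF kkt] by (auto simp: convergent_def)
  moreover have "(\<lambda>i. lyap v w p (Suc (\<rho> i))) \<longlonglongrightarrow> L"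
    using LIMSEQ_subseq_LIMSEQ[OF LIMSEQ_Suc[OF L] \<rho>(1)] by (simp add: o_def)
  ultimately have L0: "lyap v w p \<longlonglongrightarrow> 0" using LIMSEQ_unique by blast
  obtain c' where c': "0 < c'"
    "\<And>k. (norm (x k - p))\<^sup>2 \<le> c' * lyap v w p k"
    "\<And>k. (norm (z k - w))\<^sup>2 \<le> c' * lyap v w p k"
    "\<And>k. (norm (y k - v))\<^sup>2 \<le> c' * (lyap v w p k + (norm (r k))\<^sup>2)"
    using lyap_bounds[OF kkt] by blast
  have sq: "q \<longlonglongrightarrow> q0" if "\<And>k. (norm (q k - q0))\<^sup>2 \<le> h k" "h \<longlonglongrightarrow> 0"
    for q :: "nat \<Rightarrow> 'b::euclidean_space" and q0 h
  proof -
    have "(\<lambda>k. (norm (q k - q0))\<^sup>2) \<longlonglongrightarrow> 0"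
      by (rule real_tendsto_sandwich[OF _ _ tendsto_const that(2)]) (auto simp: that(1))
    then have "(\<lambda>k. sqrt ((norm (q k - q0))\<^sup>2)) \<longlonglongrightarrow> sqrt 0"
      by (intro tendsto_intros)
    then show ?thesis by (simp add: tendsto_norm_zero_iff LIM_zero_iff)
  qed
  have lim1: "(\<lambda>k. c' * lyap v w p k) \<longlonglongrightarrow> 0"
    using tendsto_mult_left[OF L0, of c'] by simp
  have "(\<lambda>k. c' * (lyap v w p k + (norm (r k))\<^sup>2)) \<longlonglongrightarrow> c' * (0 + (norm (0::'x))\<^sup>2)"
    by (intro tendsto_intros L0 r)
  then have lim2: "(\<lambda>k. c' * (lyap v w p k + (norm (r k))\<^sup>2)) \<longlonglongrightarrow> 0" by simp
  show thesis
    by (rule that[OF kkt sq[OF c'(4) lim2] sq[OF c'(3) lim1] sq[OF c'(2) lim1]])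
qed

end

subsection \<open>Duality of the nuclear and the spectral norm\<close>

lemma spectral_norm_le_1_iff: "spectral_norm G \<le> 1 \<longleftrightarrow> (\<forall>v. norm (G *v v) \<le> norm v)"
proof
  assume "spectral_norm G \<le> 1"
  then show "\<forall>v. norm (G *v v) \<le> norm v"
    unfolding spectral_norm_def
    by (metis (no_types, lifting) matrix_vector_mul_bounded_linear mult_le_cancel_right1 mult_right_mono norm_ge_zero onorm order_trans mult_1)
next
  assume "\<forall>v. norm (G *v v) \<le> norm v"
  then show "spectral_norm G \<le> 1"
    unfolding spectral_norm_def by (intro onorm_bound) auto
qed

text \<open>The eigenvalue of a unit eigenvector is written as its Rayleigh quotient, which saves a
  separate assignment of eigenvalues to basis vectors.\<close>

definition orthonormal_eigenbasis :: "real^'n^'n \<Rightarrow> (real^'n) set \<Rightarrow> bool" where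
  "orthonormal_eigenbasis M B \<longleftrightarrow> finite B \<and> pairwise orthogonal B \<and> (\<forall>v\<in>B. norm v = 1)
     \<and> span B = UNIV \<and> (\<forall>v\<in>B. M *v v = (v \<bullet> (M *v v)) *\<^sub>R v)"

section \<open>Spectral theorem for real symmetric matrices\<close>

lemma symmetric_inner: "transpose M = M \<Longrightarrow> (M *v x) \<bullet> y = x \<bullet> (M *v (y::real^'n))"
  by (metis dot_lmul_matrix vector_transpose_matrix)

text \<open>First-order optimality without derivatives: moving from \<open>v\<close> along the
  defect \<open>w = M v - \<mu> v\<close>, which stays in the invariant subspace, gives
  \<open>2 t a \<le> t^2 K\<close> for every \<open>t\<close>, where \<open>a\<close> is the squared
  length of the defect.\<close>

lemma rayleigh_maximizer_eigenvector:
  fixes M :: "real^'n^'n"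
  assumes sym: "transpose M = M" and S: "subspace S" "\<And>x. x \<in> S \<Longrightarrow> M *v x \<in> S"
    and v: "v \<in> S" "norm v = 1" "\<And>u. u \<in> S \<Longrightarrow> norm u = 1 \<Longrightarrow> u \<bullet> (M *v u) \<le> v \<bullet> (M *v v)"
  shows "M *v v = (v \<bullet> (M *v v)) *\<^sub>R v"
proof -
  let ?\<mu> = "v \<bullet> (M *v v)"
  have le: "u \<bullet> (M *v u) \<le> ?\<mu> * (u \<bullet> u)" if "u \<in> S" for u
  proof (cases "u = 0")
    case False
    have "(u /\<^sub>R norm u) \<bullet> (M *v (u /\<^sub>R norm u)) \<le> ?\<mu>"
      using False that by (intro v(3) subspace_scale[OF S(1)]) auto
    then show ?thesis
      using False by (simp add: scaleR_matrix_vector_assoc[symmetric] matrix_vector_mult_scaleR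
          field_simps power2_norm_eq_inner[symmetric] power2_eq_square)
  qed simp
  define w where "w = M *v v - ?\<mu> *\<^sub>R v"
  define a K where "a = w \<bullet> w" and "K = ?\<mu> * (w \<bullet> w) - w \<bullet> (M *v w)"
  have w: "w \<in> S" unfolding w_def by (intro subspace_diff subspace_scale S v)
  have vv: "v \<bullet> v = 1" using v(2) by (simp add: power2_norm_eq_inner[symmetric])
  have quad: "2 * t * a \<le> t\<^sup>2 * K" for t
  proof -
    have "(v + t *\<^sub>R w) \<bullet> (M *v (v + t *\<^sub>R w)) \<le> ?\<mu> * ((v + t *\<^sub>R w) \<bullet> (v + t *\<^sub>R w))"
      by (intro le subspace_add subspace_scale S v w)
    moreover have "(v + t *\<^sub>R w) \<bullet> (M *v (v + t *\<^sub>R w))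
       = ?\<mu> + 2 * t * (w \<bullet> (M *v v)) + t\<^sup>2 * (w \<bullet> (M *v w))"
      using symmetric_inner[OF sym, of w v]
      by (simp add: matrix_vector_right_distrib matrix_vector_mult_scaleR inner_add_left inner_add_right
          inner_commute power2_eq_square algebra_simps)
    moreover have "?\<mu> * ((v + t *\<^sub>R w) \<bullet> (v + t *\<^sub>R w)) = ?\<mu> + 2 * t * (?\<mu> * (w \<bullet> v)) + t\<^sup>2 * (?\<mu> * (w \<bullet> w))"
      by (simp add: inner_add_left inner_add_right vv inner_commute power2_eq_square algebra_simps)
    moreover have "a = w \<bullet> (M *v v) - ?\<mu> * (w \<bullet> v)"
      unfolding a_def by (subst (2) w_def) (simp add: inner_diff_right)
    moreover have "t\<^sup>2 * K = t\<^sup>2 * (?\<mu> * (w \<bullet> w)) - t\<^sup>2 * (w \<bullet> (M *v w))"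
      by (simp only: K_def right_diff_distrib)
    moreover have "2 * t * (w \<bullet> (M *v v) - ?\<mu> * (w \<bullet> v)) = 2 * t * (w \<bullet> (M *v v)) - 2 * t * (?\<mu> * (w \<bullet> v))"
      by (simp only: right_diff_distrib)
    ultimately show ?thesis by simp
  qed
  have "a = 0"
  proof (rule ccontr)
    assume "a \<noteq> 0"
    then have a: "0 < a" by (simp add: a_def)
    \<comment> \<open>With this step \<open>t K \<le> t (|K| + 1) = a\<close>, while the inequality
      divided by \<open>t\<close> demands \<open>2 a \<le> t K\<close>.\<close>
    define t where "t = a / (\<bar>K\<bar> + 1)"
    have t: "0 < t" using a by (simp add: t_def)
    have "2 * a \<le> t * K" using quad[of t] t by (simp add: power2_eq_square)
    also have "\<dots> \<le> t * (\<bar>K\<bar> + 1)" using t by (intro mult_left_mono) auto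
    also have "\<dots> = a" by (simp add: t_def)
    finally show False using a by simp
  qed
  then show ?thesis by (simp add: a_def w_def)
qed

lemma orthonormal_independent:
  fixes B :: "'a::euclidean_space set"
  assumes "pairwise orthogonal B" "\<forall>v\<in>B. norm v = 1"
  shows "independent B"
  using assms by (intro pairwise_orthogonal_independent) auto

text \<open>An orthonormal set of eigenvectors of greatest cardinality exists, because independence
  bounds the cardinality. Its orthogonal complement is invariant by symmetry, so a nonzero
  complement would supply one more eigenvector by maximizing the Rayleigh quotient.\<close>

lemma orthonormal_eigenbasis_exists:
  fixes M :: "real^'n^'n"
  assumes sym: "transpose M = M"
  obtains B where "orthonormal_eigenbasis M B"
proof -
  define P where "P B \<longleftrightarrow> pairwise orthogonal B \<and> (\<forall>v\<in>B. norm v = 1)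
      \<and> (\<forall>v\<in>B. M *v v = (v \<bullet> (M *v v)) *\<^sub>R v)" for B
  have bound: "finite B" "card B < Suc (DIM(real^'n))" if "P B" for B
    using independent_bound[OF orthonormal_independent, of B] that
    unfolding P_def by (auto simp: less_Suc_eq_le)
  have "P {}" by (simp add: P_def)
  then obtain B where B: "P B" "\<And>C. P C \<Longrightarrow> card C \<le> card B"
    using ex_has_greatest_nat[of P "{}" card] bound(2) by (metis less_imp_le)
  have fin: "finite B" by (rule bound(1)[OF B(1)])
  define S where "S = {x. \<forall>b\<in>B. b \<bullet> x = 0}"
  have subS: "subspace S"
    by (auto simp: S_def subspace_def inner_add_right)
  have inv: "M *v x \<in> S" if "x \<in> S" for x
  proof -
    have "b \<bullet> (M *v x) = 0" if "b \<in> B" for b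
    proof -
      have "b \<bullet> (M *v x) = (M *v b) \<bullet> x" by (rule symmetric_inner[OF sym, symmetric])
      also have "M *v b = (b \<bullet> (M *v b)) *\<^sub>R b" using B(1) that by (simp add: P_def)
      finally show ?thesis using \<open>x \<in> S\<close> that by (simp add: S_def)
    qed
    then show ?thesis by (simp add: S_def)
  qed
  have "S \<subseteq> {0}"
  proof (rule ccontr)
    assume "\<not> S \<subseteq> {0}"
    then obtain x where x: "x \<in> S" "x \<noteq> 0" by auto
    have "x /\<^sub>R norm x \<in> sphere 0 1 \<inter> S"
      using x subspace_scale[OF subS] by auto
    moreover have "compact (sphere 0 1 \<inter> S)"
      by (intro compact_Int_closed closed_subspace subS compact_sphere)
    moreover have "continuous_on (sphere 0 1 \<inter> S) (\<lambda>u. u \<bullet> (M *v u))"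
      by (intro continuous_intros linear_continuous_on matrix_vector_mul_bounded_linear)
    ultimately obtain v where v: "v \<in> sphere 0 1 \<inter> S"
      "\<And>u. u \<in> sphere 0 1 \<inter> S \<Longrightarrow> u \<bullet> (M *v u) \<le> v \<bullet> (M *v v)"
      using continuous_attains_sup[of "sphere 0 1 \<inter> S" "\<lambda>u. u \<bullet> (M *v u)"] by (metis empty_iff)
    have "M *v v = (v \<bullet> (M *v v)) *\<^sub>R v"
      using v by (intro rayleigh_maximizer_eigenvector[OF sym subS inv]) auto
    then have "P (insert v B)"
      using B(1) v(1) by (auto simp: P_def S_def pairwise_insert orthogonal_def inner_commute)
    moreover have "v \<notin> B"
      using v(1) by (auto simp: S_def)
    ultimately show False using B(2)[of "insert v B"] fin by simp
  qed
  have "span B = UNIV"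
  proof -
    have "x \<in> span B" for x
    proof -
      obtain p q where pq: "p \<in> span B" "\<And>w. w \<in> span B \<Longrightarrow> orthogonal q w" "x = p + q"
        using orthogonal_subspace_decomp_exists[of B x] by blast
      then have "q \<in> S" by (auto simp: S_def orthogonal_def inner_commute span_base)
      then show ?thesis using \<open>S \<subseteq> {0}\<close> pq by auto
    qed
    then show ?thesis by auto
  qed
  then show thesis
    using B(1) fin by (intro that[of B]) (simp add: P_def orthonormal_eigenbasis_def)
qed

lemma orthonormal_expansion:
  fixes B :: "'a::euclidean_space set"
  assumes "finite B" "pairwise orthogonal B" "\<forall>v\<in>B. norm v = 1" "span B = UNIV"
  shows "x = (\<Sum>v\<in>B. (x \<bullet> v) *\<^sub>R v)"
proof -
  let ?y = "x - (\<Sum>v\<in>B. (x \<bullet> v) *\<^sub>R v)"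
  have y0: "?y \<bullet> w = 0" if "w \<in> B" for w
  proof -
    have "(\<Sum>v\<in>B. (x \<bullet> v) * (v \<bullet> w)) = (\<Sum>v\<in>B. if v = w then x \<bullet> w else 0)"
      using assms(2,3) that
      by (intro sum.cong) (auto simp: pairwise_def orthogonal_def norm_eq_1)
    then show ?thesis
      using assms(1) that by (simp add: inner_diff_left inner_sum_left)
  qed
  have "orthogonal ?y u" if "u \<in> span B" for u
    by (rule orthogonal_to_span[OF that]) (simp only: orthogonal_def y0)
  then have "?y = 0" using assms(4) by (metis UNIV_I orthogonal_self)
  then show ?thesis by simp
qed

lemma parseval:
  fixes B :: "'a::euclidean_space set"
  assumes "finite B" "pairwise orthogonal B" "\<forall>v\<in>B. norm v = 1" "span B = UNIV"
  shows "x \<bullet> y = (\<Sum>v\<in>B. (x \<bullet> v) * (y \<bullet> v))"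
  by (subst orthonormal_expansion[OF assms, of x]) (simp only: inner_sum_left inner_scaleR_left inner_commute[of y])

section \<open>The nuclear norm as a sum over an eigenbasis\<close>

context
  fixes M :: "real^'n^'n" and B
  assumes sym: "transpose M = M" and B: "orthonormal_eigenbasis M B"
begin

private lemma ON: "finite B" "pairwise orthogonal B" "\<forall>v\<in>B. norm v = 1" "span B = UNIV"
  and eig: "v \<in> B \<Longrightarrow> M *v v = (v \<bullet> (M *v v)) *\<^sub>R v"
  using B unfolding orthonormal_eigenbasis_def by auto

text \<open>An eigenvector for \<open>\<mu>\<close> is orthogonal to every basis vector with a
  different eigenvalue, so only basis vectors belonging to \<open>\<mu>\<close> occur in its
  expansion.\<close>

lemma eigenspace_eq_span: "eigenspace M \<mu> = span {v \<in> B. v \<bullet> (M *v v) = \<mu>}"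
proof
  show "eigenspace M \<mu> \<subseteq> span {v \<in> B. v \<bullet> (M *v v) = \<mu>}"
  proof
    fix x assume "x \<in> eigenspace M \<mu>"
    then have x: "M *v x = \<mu> *\<^sub>R x" by (simp add: eigenspace_def)
    have "x \<bullet> v = 0" if v: "v \<in> B" "v \<bullet> (M *v v) \<noteq> \<mu>" for v
    proof -
      have "\<mu> * (x \<bullet> v) = (v \<bullet> (M *v v)) * (x \<bullet> v)"
        using symmetric_inner[OF sym, of x v] x eig[OF v(1)] by (metis inner_scaleR_left inner_scaleR_right)
      then show ?thesis using v(2) by simp
    qed
    then have "(x \<bullet> v) *\<^sub>R v \<in> span {v \<in> B. v \<bullet> (M *v v) = \<mu>}" if "v \<in> B" for v
      using that by (cases "v \<bullet> (M *v v) = \<mu>") (auto intro: span_scale span_base simp: span_zero)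
    then have "(\<Sum>v\<in>B. (x \<bullet> v) *\<^sub>R v) \<in> span {v \<in> B. v \<bullet> (M *v v) = \<mu>}"
      by (rule span_sum)
    then show "x \<in> span {v \<in> B. v \<bullet> (M *v v) = \<mu>}"
      using orthonormal_expansion[OF ON, of x] by simp
  qed
  have "subspace (eigenspace M \<mu>)"
    by (auto simp: eigenspace_def subspace_def matrix_vector_right_distrib matrix_vector_mult_scaleR algebra_simps)
  moreover have "{v \<in> B. v \<bullet> (M *v v) = \<mu>} \<subseteq> eigenspace M \<mu>"
    using eig by (auto simp: eigenspace_def)
  ultimately show "span {v \<in> B. v \<bullet> (M *v v) = \<mu>} \<subseteq> eigenspace M \<mu>"
    by (rule span_minimal[rotated])
qed

lemma dim_eigenspace: "dim (eigenspace M \<mu>) = card {v \<in> B. v \<bullet> (M *v v) = \<mu>}"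
proof -
  have "independent {v \<in> B. v \<bullet> (M *v v) = \<mu>}"
    using orthonormal_independent[OF ON(2,3)] by (rule independent_mono) auto
  then show ?thesis by (simp add: eigenspace_eq_span dim_eq_card_independent)
qed

lemma eigenvalues_eq_image: "eigenvalues M = (\<lambda>v. v \<bullet> (M *v v)) ` B"
proof -
  have "\<mu> \<in> eigenvalues M \<longleftrightarrow> {v \<in> B. v \<bullet> (M *v v) = \<mu>} \<noteq> {}" for \<mu>
  proof -
    have "\<mu> \<in> eigenvalues M \<longleftrightarrow> \<not> eigenspace M \<mu> \<subseteq> {0}" by (auto simp: eigenvalues_def)
    also have "\<dots> \<longleftrightarrow> dim (eigenspace M \<mu>) \<noteq> 0" by (simp only: dim_eq_0)
    also have "\<dots> \<longleftrightarrow> {v \<in> B. v \<bullet> (M *v v) = \<mu>} \<noteq> {}"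
      using ON(1) by (simp add: dim_eigenspace)
    finally show ?thesis .
  qed
  then show ?thesis by auto
qed

text \<open>Passes from the summation by distinct eigenvalues with multiplicity, as in
  \<open>nuclear_norm\<close>, to a sum over basis vectors.\<close>

lemma sum_eigenvalues:
  "(\<Sum>\<mu>\<in>eigenvalues M. real (dim (eigenspace M \<mu>)) * h \<mu>) = (\<Sum>v\<in>B. h (v \<bullet> (M *v v)))"
proof -
  have "(\<Sum>v\<in>B. h (v \<bullet> (M *v v)))
     = (\<Sum>\<mu>\<in>(\<lambda>v. v \<bullet> (M *v v)) ` B. \<Sum>v\<in>{v \<in> B. v \<bullet> (M *v v) = \<mu>}. h (v \<bullet> (M *v v)))"
    by (rule sum.image_gen[OF ON(1)])
  then show ?thesis by (simp add: eigenvalues_eq_image dim_eigenspace)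
qed

end

lemma inner_transpose_mult: "v \<bullet> ((transpose X ** X) *v w) = (X *v v) \<bullet> (X *v w)"
  for X :: "real^'n^'m"
  by (metis dot_lmul_matrix matrix_vector_mul_assoc vector_transpose_matrix inner_commute)

text \<open>On an eigenbasis of the Gram matrix the eigenvalue at \<open>v\<close> is the squared
  norm of \<open>X *v v\<close>, so these norms are the singular values.\<close>

lemma gram_eigenbasis:
  fixes X :: "real^'n^'m"
  obtains B where "orthonormal_eigenbasis (transpose X ** X) B" "nuclear_norm X = (\<Sum>v\<in>B. norm (X *v v))"
proof -
  have sym: "transpose (transpose X ** X) = transpose X ** X"
    by (simp add: matrix_transpose_mul)
  obtain B where B: "orthonormal_eigenbasis (transpose X ** X) B"
    using orthonormal_eigenbasis_exists[OF sym] .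
  have "nuclear_norm X = (\<Sum>v\<in>B. norm (X *v v))"
    unfolding nuclear_norm_def sum_eigenvalues[OF sym B]
    by (simp add: inner_transpose_mult norm_eq_sqrt_inner)
  with B show thesis by (rule that)
qed

lemma inner_matrix_eq_sum:
  fixes X G :: "real^'n^'m"
  assumes "orthonormal_eigenbasis M B"
  shows "G \<bullet> X = (\<Sum>v\<in>B. (G *v v) \<bullet> (X *v v))"
proof -
  have ON: "finite B" "pairwise orthogonal B" "\<forall>v\<in>B. norm v = 1" "span B = UNIV"
    using assms by (auto simp: orthonormal_eigenbasis_def)
  have "G \<bullet> X = (\<Sum>i\<in>UNIV. \<Sum>v\<in>B. (G $ i \<bullet> v) * (X $ i \<bullet> v))"
    by (simp add: inner_vec_def[of G X] parseval[OF ON, symmetric])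
  also have "\<dots> = (\<Sum>v\<in>B. \<Sum>i\<in>UNIV. (G $ i \<bullet> v) * (X $ i \<bullet> v))"
    by (rule sum.swap)
  also have "\<dots> = (\<Sum>v\<in>B. (G *v v) \<bullet> (X *v v))"
    by (simp add: inner_vec_def[of "_ *v _"] matrix_vector_mul_component)
  finally show ?thesis .
qed

lemma inner_le_nuclear_norm:
  assumes "spectral_norm G \<le> 1"
  shows "G \<bullet> X \<le> nuclear_norm X"
proof -
  obtain B where B: "orthonormal_eigenbasis (transpose X ** X) B" "nuclear_norm X = (\<Sum>v\<in>B. norm (X *v v))"
    by (rule gram_eigenbasis)
  have "(G *v v) \<bullet> (X *v v) \<le> norm (X *v v)" if "v \<in> B" for v
  proof -
    have "norm (G *v v) \<le> 1"
      using assms B(1) that by (metis orthonormal_eigenbasis_def spectral_norm_le_1_iff)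
    then have "norm (G *v v) * norm (X *v v) \<le> 1 * norm (X *v v)"
      by (intro mult_right_mono) auto
    then show ?thesis
      using norm_cauchy_schwarz[of "G *v v" "X *v v"] by simp
  qed
  then show ?thesis
    unfolding B(2) inner_matrix_eq_sum[OF B(1)] by (rule sum_mono)
qed

lemma sgn_inner_self: "sgn x \<bullet> x = norm (x :: 'a::real_inner)"
  by (cases "x = 0") (simp_all add: sgn_div_norm dot_square_norm power2_eq_square)

text \<open>The maximizer is the partial isometry of the polar decomposition: it sends each
  eigenvector \<open>v\<close> of the Gram matrix to the normalized \<open>X *v v\<close>. These
  images are orthogonal, which makes it a contraction; \<open>sgn 0 = 0\<close> takes care of the
  kernel of \<open>X\<close>.\<close>

lemma nuclear_norm_attained:
  fixes X :: "real^'n^'m"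
  obtains G where "spectral_norm G \<le> 1" "G \<bullet> X = nuclear_norm X"
proof -
  obtain B where B: "orthonormal_eigenbasis (transpose X ** X) B" "nuclear_norm X = (\<Sum>v\<in>B. norm (X *v v))"
    by (rule gram_eigenbasis)
  have ON: "finite B" "pairwise orthogonal B" "\<forall>v\<in>B. norm v = 1" "span B = UNIV"
    using B(1) by (auto simp: orthonormal_eigenbasis_def)
  have orth: "(X *v v) \<bullet> (X *v w) = 0" if "v \<in> B" "w \<in> B" "v \<noteq> w" for v w
  proof -
    have "(transpose X ** X) *v w = (w \<bullet> ((transpose X ** X) *v w)) *\<^sub>R w"
      using B(1) that by (simp add: orthonormal_eigenbasis_def)
    then have "v \<bullet> ((transpose X ** X) *v w) = (w \<bullet> ((transpose X ** X) *v w)) * (v \<bullet> w)"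
      by (metis inner_scaleR_right)
    then show ?thesis
      using ON(2) that by (simp add: inner_transpose_mult pairwise_def orthogonal_def)
  qed
  define g where "g u = (\<Sum>v\<in>B. (u \<bullet> v) *\<^sub>R sgn (X *v v))" for u
  have lin: "linear g"
    unfolding g_def by (intro linear_compose_sum) (auto intro!: linearI simp: algebra_simps)
  have "norm (g u) \<le> norm u" for u
  proof -
    have "(norm (g u))\<^sup>2 = (\<Sum>v\<in>B. (norm ((u \<bullet> v) *\<^sub>R sgn (X *v v)))\<^sup>2)"
      unfolding g_def using orth
      by (intro norm_sum_Pythagorean ON) (auto simp: pairwise_def orthogonal_def sgn_div_norm)
    also have "\<dots> \<le> (\<Sum>v\<in>B. (u \<bullet> v) * (u \<bullet> v))"
      by (intro sum_mono) (auto simp: norm_sgn power2_eq_square)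
    also have "\<dots> = (norm u)\<^sup>2"
      by (simp add: parseval[OF ON, symmetric] power2_norm_eq_inner)
    finally show ?thesis by (simp add: power2_le_iff_abs_le)
  qed
  then have 1: "spectral_norm (matrix g) \<le> 1"
    by (simp add: spectral_norm_le_1_iff matrix_works lin)
  have "g v = sgn (X *v v)" if "v \<in> B" for v
  proof -
    have "g v = (\<Sum>w\<in>B. if w = v then sgn (X *v v) else 0)"
      unfolding g_def using ON(2,3) that
      by (intro sum.cong) (auto simp: pairwise_def orthogonal_def norm_eq_1)
    then show ?thesis using ON(1) that by simp
  qed
  then have "matrix g \<bullet> X = nuclear_norm X"
    unfolding B(2) inner_matrix_eq_sum[OF B(1)]
    by (intro sum.cong) (auto simp: matrix_works lin sgn_inner_self)
  with 1 show thesis by (rule that)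
qed

lemma spectral_ball_closed_convex:
  "closed {G :: real^'n^'m. spectral_norm G \<le> 1}" "convex {G :: real^'n^'m. spectral_norm G \<le> 1}"
proof -
  show "closed {G :: real^'n^'m. spectral_norm G \<le> 1}"
    unfolding spectral_norm_le_1_iff matrix_vector_mult_def
    by (intro closed_Collect_all closed_Collect_le continuous_intros)
  show "convex {G :: real^'n^'m. spectral_norm G \<le> 1}"
    unfolding convex_def spectral_norm_le_1_iff
  proof clarify
    fix G H :: "real^'n^'m" and u v :: real and w
    assume *: "\<forall>v. norm (G *v v) \<le> norm v" "\<forall>v. norm (H *v v) \<le> norm v" "0 \<le> u" "0 \<le> v" "u + v = 1"
    have "norm ((u *\<^sub>R G + v *\<^sub>R H) *v w) \<le> u * norm (G *v w) + v * norm (H *v w)"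
      using * norm_triangle_ineq[of "u *\<^sub>R (G *v w)" "v *\<^sub>R (H *v w)"]
      by (simp add: matrix_vector_mult_add_rdistrib scaleR_matrix_vector_assoc[symmetric])
    also have "\<dots> \<le> u * norm w + v * norm w"
      using * by (intro add_mono mult_left_mono) auto
    also have "\<dots> = norm w" using *(5) by (metis distrib_right mult_1)
    finally show "norm ((u *\<^sub>R G + v *\<^sub>R H) *v w) \<le> norm w" .
  qed
qed

text \<open>In an orthonormal basis the squared Frobenius norm is the sum of the squared norms of
  \<open>G *v v\<close>, each at most 1.\<close>

lemma spectral_ball_compact: "compact {G :: real^'n^'m. spectral_norm G \<le> 1}"
proof -
  have "norm G \<le> sqrt (real CARD('n))" if "spectral_norm G \<le> 1" for G :: "real^'n^'m"
  proof -
    obtain B where B: "orthonormal_eigenbasis (transpose G ** G) B" by (rule gram_eigenbasis)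
    have card: "card B = CARD('n)"
      using B orthonormal_independent[of B] dim_span_eq_card_independent[of B]
      by (auto simp: orthonormal_eigenbasis_def)
    have "(norm G)\<^sup>2 = (\<Sum>v\<in>B. (norm (G *v v))\<^sup>2)"
      unfolding power2_norm_eq_inner by (rule inner_matrix_eq_sum[OF B])
    also have "\<dots> \<le> (\<Sum>v\<in>B. 1)"
    proof (rule sum_mono)
      fix v assume "v \<in> B"
      then have "norm (G *v v) \<le> 1"
        using B that by (metis orthonormal_eigenbasis_def spectral_norm_le_1_iff)
      then show "(norm (G *v v))\<^sup>2 \<le> 1" by (simp add: power_le_one)
    qed
    finally show ?thesis by (simp add: card real_le_rsqrt)
  qed
  then have "bounded {G :: real^'n^'m. spectral_norm G \<le> 1}"
    by (auto simp: bounded_iff)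
  then show ?thesis
    using spectral_ball_closed_convex(1) by (simp add: compact_eq_bounded_closed)
qed

subsection \<open>Existence and optimality of KKT points\<close>

text \<open>A support function is Lipschitz with the bound of its set as constant. This yields
  continuity of the nuclear norm without perturbation theory for eigenvalues.\<close>

lemma support_function_continuous:
  fixes h :: "'a::euclidean_space \<Rightarrow> real"
  assumes "bounded K" and le: "\<And>G X. G \<in> K \<Longrightarrow> G \<bullet> X \<le> h X"
    and att: "\<And>X. \<exists>G\<in>K. G \<bullet> X = h X"
  shows "continuous_on UNIV h"
proof -
  obtain M where M: "0 < M" "\<And>G. G \<in> K \<Longrightarrow> norm G \<le> M"
    using assms(1) by (auto simp: bounded_pos)
  have one: "h X - h Y \<le> M * norm (X - Y)" for X Y
  proof -
    obtain G where G: "G \<in> K" "G \<bullet> X = h X" using att by blast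
    have "h X - h Y \<le> G \<bullet> (X - Y)" using le[OF G(1), of Y] G(2) by (simp add: inner_diff_right)
    also have "\<dots> \<le> norm G * norm (X - Y)" by (rule norm_cauchy_schwarz)
    also have "\<dots> \<le> M * norm (X - Y)" by (intro mult_right_mono M(2)[OF G(1)]) auto
    finally show ?thesis .
  qed
  have "M-lipschitz_on UNIV h"
  proof (rule lipschitz_onI)
    show "dist (h X) (h Y) \<le> M * dist X Y" for X Y
      using one[of X Y] one[of Y X] by (simp add: dist_norm norm_minus_commute abs_le_iff)
  qed (use M in auto)
  then show ?thesis by (rule lipschitz_on_continuous_on)
qed

text \<open>Since \<open>h\<close> is nonnegative, the quadratic term confines every point no worse
  than \<open>T\<close> to a ball around \<open>A\<close>, and the minimum over a compact set is
  attained.\<close>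

lemma support_prox_minimizer_exists:
  fixes h :: "'a::euclidean_space \<Rightarrow> real"
  assumes F: "closed F" "T \<in> F" and \<alpha>: "0 < \<alpha>"
    and cont: "continuous_on UNIV h" and h0: "\<And>X. 0 \<le> h X"
  obtains Xb where "Xb \<in> F" "\<And>X. X \<in> F \<Longrightarrow> h Xb + \<alpha> * (norm (Xb - A))\<^sup>2 \<le> h X + \<alpha> * (norm (X - A))\<^sup>2"
proof -
  define \<phi> where "\<phi> X = h X + \<alpha> * (norm (X - A))\<^sup>2" for X
  have \<phi>0: "\<alpha> * (norm (X - A))\<^sup>2 \<le> \<phi> X" for X using h0 by (simp add: \<phi>_def)
  define \<rho> where "\<rho> = sqrt (\<phi> T / \<alpha>)"
  have in_ball: "X \<in> cball A \<rho>" if "\<phi> X \<le> \<phi> T" for X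
  proof -
    have "(norm (X - A))\<^sup>2 \<le> \<phi> T / \<alpha>"
      using order_trans[OF \<phi>0 that] \<alpha> by (simp add: field_simps)
    then show ?thesis by (simp add: \<rho>_def dist_norm norm_minus_commute real_le_rsqrt)
  qed
  have "continuous_on (F \<inter> cball A \<rho>) \<phi>"
    unfolding \<phi>_def by (intro continuous_intros continuous_on_subset[OF cont]) auto
  moreover have "compact (F \<inter> cball A \<rho>)" by (intro closed_Int_compact F(1) compact_cball)
  moreover have T: "T \<in> F \<inter> cball A \<rho>" using F(2) in_ball by auto
  ultimately obtain Xb where Xb: "Xb \<in> F \<inter> cball A \<rho>" "\<And>X. X \<in> F \<inter> cball A \<rho> \<Longrightarrow> \<phi> Xb \<le> \<phi> X"
    using continuous_attains_inf[of "F \<inter> cball A \<rho>" \<phi>] by (metis empty_iff)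
  show thesis
  proof
    show "Xb \<in> F" using Xb(1) by simp
    show "h Xb + \<alpha> * (norm (Xb - A))\<^sup>2 \<le> h X + \<alpha> * (norm (X - A))\<^sup>2" if "X \<in> F" for X
    proof (cases "\<phi> X \<le> \<phi> T")
      case True
      then show ?thesis using Xb(2)[of X] in_ball[of X] that by (simp add: \<phi>_def)
    next
      case False
      then show ?thesis using Xb(2)[OF T] by (simp add: \<phi>_def)
    qed
  qed
qed

text \<open>\<open>N\<close> is the cone dual to the feasible directions, and the face
  \<open>D\<close> of \<open>K\<close> exposed by \<open>Xb\<close> is the subdifferential of
  \<open>h\<close> there. If \<open>D\<close> shifted by the gradient of the quadratic term missed
  \<open>N\<close>, a separating \<open>d\<close> would be a feasible direction of strict
  descent.\<close>

lemma support_prox_multiplier: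
  fixes h :: "'a::euclidean_space \<Rightarrow> real"
  assumes K: "compact K" "convex K"
    and le: "\<And>G X. G \<in> K \<Longrightarrow> G \<bullet> X \<le> h X" and att: "\<And>X. \<exists>G\<in>K. G \<bullet> X = h X"
    and min: "\<And>X. X \<in> F \<Longrightarrow> h Xb + \<alpha> * (norm (Xb - A))\<^sup>2 \<le> h X + \<alpha> * (norm (X - A))\<^sup>2"
    and N: "convex_cone N" "closed N"
    and feas: "\<And>d. (\<And>n. n \<in> N \<Longrightarrow> 0 \<le> d \<bullet> n) \<Longrightarrow> \<forall>\<^sub>F \<epsilon> in at_right (0::real). Xb + \<epsilon> *\<^sub>R d \<in> F"
  obtains G where "G \<in> K" "G \<bullet> Xb = h Xb" "G + (2 * \<alpha>) *\<^sub>R (Xb - A) \<in> N"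
proof -
  define D where "D = K \<inter> {G. Xb \<bullet> G = h Xb}"
  let ?c = "(2 * \<alpha>) *\<^sub>R (Xb - A)"
  obtain G' where G': "G' \<in> K" "G' \<bullet> Xb = h Xb" using att by blast
  have D: "compact D" "convex D" "D \<noteq> {}"
    unfolding D_def
    by (intro compact_Int_closed closed_hyperplane K, intro convex_Int convex_hyperplane K)
       (use G' in \<open>auto simp: inner_commute\<close>)
  have "(\<lambda>G. ?c + G) ` D \<inter> N \<noteq> {}"
  proof
    assume disj: "(\<lambda>G. ?c + G) ` D \<inter> N = {}"
    obtain d b where sep: "\<And>G. G \<in> D \<Longrightarrow> d \<bullet> (?c + G) < b" "\<And>n. n \<in> N \<Longrightarrow> b < d \<bullet> n"
      using separating_hyperplane_compact_closed[OF convex_translation[OF D(2)] compact_translation[OF D(1)] _ _ N(2) disj]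
        D(3) N(1) by (auto simp: convex_cone_def)
    have b: "b < 0" using sep(2)[of 0] convex_cone_contains_0[OF N(1)] by simp
    have "0 \<le> d \<bullet> n" if "n \<in> N" for n
    proof (rule ccontr)
      assume "\<not> 0 \<le> d \<bullet> n"
      then have neg: "d \<bullet> n < 0" by simp
      \<comment> \<open>Scaled by this positive factor, \<open>n\<close> stays in the cone and pairs
        with \<open>d\<close> to exactly \<open>b\<close>, against the strict separation.\<close>
      have "(b / (d \<bullet> n)) *\<^sub>R n \<in> N"
        using b neg by (intro convex_cone_scaleR[OF N(1)] that) (simp add: divide_nonpos_neg)
      from sep(2)[OF this] show False using neg by simp
    qed
    then obtain e where e: "0 < e" "\<And>\<epsilon>. 0 < \<epsilon> \<Longrightarrow> \<epsilon> < e \<Longrightarrow> Xb + \<epsilon> *\<^sub>R d \<in> F"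
      using feas[of d] unfolding eventually_at_right_field by blast
    define \<epsilon> where "\<epsilon> i = e / real (Suc (Suc i))" for i
    have \<epsilon>: "0 < \<epsilon> i" "\<epsilon> i < e" for i
      using e(1) by (simp_all add: \<epsilon>_def divide_less_eq)
    have \<epsilon>0: "\<epsilon> \<longlonglongrightarrow> 0"
      unfolding \<epsilon>_def using LIMSEQ_Suc[OF LIMSEQ_Suc[OF lim_const_over_n[of e]]] by simp
    \<comment> \<open>Only the maximizers of \<open>h\<close> are at hand, so the one-sided
      derivative along \<open>d\<close> is reached through maximizers at the points
      \<open>Xb + \<epsilon> i *\<^sub>R d\<close>. By compactness they cluster at some
      \<open>G0\<close>.\<close>
    obtain G where G: "\<And>i. G i \<in> K" "\<And>i. G i \<bullet> (Xb + \<epsilon> i *\<^sub>R d) = h (Xb + \<epsilon> i *\<^sub>R d)"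
    proof -
      obtain g where "\<And>X. g X \<in> K" "\<And>X. g X \<bullet> X = h X" using att by metis
      then show ?thesis by (intro that[of "\<lambda>i. g (Xb + \<epsilon> i *\<^sub>R d)"])
    qed
    obtain G0 \<rho> where G0: "G0 \<in> K" "strict_mono \<rho>" "(G \<circ> \<rho>) \<longlonglongrightarrow> G0"
      using seq_compactE[of K G] compact_imp_seq_compact[OF K(1)] G(1) by blast
    have lim: "(\<lambda>i. G (\<rho> i)) \<longlonglongrightarrow> G0" "(\<lambda>i. \<epsilon> (\<rho> i)) \<longlonglongrightarrow> 0"
      using G0(3) LIMSEQ_subseq_LIMSEQ[OF \<epsilon>0 G0(2)] by (simp_all add: o_def)
    have "(\<lambda>i. (G (\<rho> i) - G') \<bullet> (Xb + \<epsilon> (\<rho> i) *\<^sub>R d)) \<longlonglongrightarrow> (G0 - G') \<bullet> (Xb + 0 *\<^sub>R d)"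
      by (intro tendsto_intros lim)
    moreover have "0 \<le> (G (\<rho> i) - G') \<bullet> (Xb + \<epsilon> (\<rho> i) *\<^sub>R d)" for i
      using le[OF G'(1), of "Xb + \<epsilon> (\<rho> i) *\<^sub>R d"] G(2)[of "\<rho> i"] by (simp only: inner_diff_left)
    ultimately have "0 \<le> (G0 - G') \<bullet> (Xb + 0 *\<^sub>R d)"
      by (intro LIMSEQ_le_const) auto
    \<comment> \<open>In the limit \<open>G0\<close> does at least as well at \<open>Xb\<close> as
      the maximizer \<open>G'\<close>, so it lies in the exposed face.\<close>
    then have "G0 \<in> D"
      using le[OF G0(1), of Xb] G0(1) G'(2) by (simp add: D_def inner_diff_left inner_commute[of Xb])
    have "(\<lambda>i. G (\<rho> i) \<bullet> d + 2 * \<alpha> * ((Xb - A) \<bullet> d) + \<alpha> * \<epsilon> (\<rho> i) * (norm d)\<^sup>2)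
        \<longlonglongrightarrow> G0 \<bullet> d + 2 * \<alpha> * ((Xb - A) \<bullet> d) + \<alpha> * 0 * (norm d)\<^sup>2"
      by (intro tendsto_intros lim)
    \<comment> \<open>As \<open>G j\<close> attains \<open>h\<close> at the perturbed point and
      stays below \<open>h\<close> at \<open>Xb\<close>, the difference quotient of \<open>h\<close>
      is at most \<open>G j \<bullet> d\<close>. Minimality of \<open>Xb\<close> divided by the step
      gives the claim.\<close>
    moreover have "0 \<le> G j \<bullet> d + 2 * \<alpha> * ((Xb - A) \<bullet> d) + \<alpha> * \<epsilon> j * (norm d)\<^sup>2" for j
    proof -
      let ?X = "Xb + \<epsilon> j *\<^sub>R d"
      have 1: "h Xb + \<alpha> * (norm (Xb - A))\<^sup>2 \<le> h ?X + \<alpha> * (norm (?X - A))\<^sup>2"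
        by (intro min e \<epsilon>)
      have 2: "h ?X = G j \<bullet> Xb + \<epsilon> j * (G j \<bullet> d)"
        using G(2)[of j] by (simp add: inner_add_right)
      have "?X - A = (Xb - A) + \<epsilon> j *\<^sub>R d" by simp
      then have 3: "(norm (?X - A))\<^sup>2 = (norm (Xb - A))\<^sup>2 + 2 * \<epsilon> j * ((Xb - A) \<bullet> d) + (\<epsilon> j)\<^sup>2 * (norm d)\<^sup>2"
        unfolding power2_norm_eq_inner
        by (simp only: inner_add_left inner_add_right inner_scaleR_left inner_scaleR_right inner_commute[of d "Xb - A"])
           (simp add: power2_eq_square algebra_simps)
      have "0 \<le> \<epsilon> j * (G j \<bullet> d) + \<alpha> * (2 * \<epsilon> j * ((Xb - A) \<bullet> d) + (\<epsilon> j)\<^sup>2 * (norm d)\<^sup>2)"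
        using 1 le[OF G(1), of j Xb] unfolding 2 3 by (simp add: algebra_simps)
      also have "\<dots> = \<epsilon> j * (G j \<bullet> d + 2 * \<alpha> * ((Xb - A) \<bullet> d) + \<alpha> * \<epsilon> j * (norm d)\<^sup>2)"
        by (simp add: power2_eq_square algebra_simps)
      finally show ?thesis using \<epsilon>(1)[of j] by (simp add: zero_le_mult_iff)
    qed
    ultimately have "0 \<le> G0 \<bullet> d + 2 * \<alpha> * ((Xb - A) \<bullet> d) + \<alpha> * 0 * (norm d)\<^sup>2"
      by (intro LIMSEQ_le_const) auto
    moreover have "d \<bullet> (?c + G0) = G0 \<bullet> d + 2 * \<alpha> * ((Xb - A) \<bullet> d)"
      by (simp add: inner_add_right inner_commute)
    ultimately show False using sep(1)[OF \<open>G0 \<in> D\<close>] b by simp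
  qed
  then obtain G where "G \<in> D" "?c + G \<in> N" by auto
  then show thesis
    by (intro that[of G]) (auto simp: D_def inner_commute add.commute)
qed

section \<open>Operators and feasible set of the traffic problem\<close>

lemma proj_on_simps [simp]:
  "proj_on \<Omega> (X + Y) = proj_on \<Omega> X + proj_on \<Omega> Y" "proj_on \<Omega> (X - Y) = proj_on \<Omega> X - proj_on \<Omega> Y"
  "proj_on \<Omega> (c *\<^sub>R X) = c *\<^sub>R proj_on \<Omega> X" "proj_on \<Omega> (- X) = - proj_on \<Omega> X" "proj_on \<Omega> 0 = 0"
  "proj_on \<Omega> (proj_on \<Omega> X) = proj_on \<Omega> X"
  by (simp_all add: proj_on_def vec_eq_iff)

lemma linear_proj_on: "linear (proj_on \<Omega>)"
  by (rule linearI) simp_all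

lemma proj_on_inner: "proj_on \<Omega> X \<bullet> Y = X \<bullet> proj_on \<Omega> Y"
  unfolding inner_vec_def proj_on_def
  by (intro sum.cong refl) (auto simp: if_distrib if_distribR cong: if_cong)

lemma outer_axis_inner: "outer u (axis j 1) \<bullet> (X :: real^'b^'a) = u \<bullet> (X *v axis j 1)"
proof -
  have "outer u (axis j 1) $ i = u $ i *\<^sub>R axis j 1" for i
    by (simp add: outer_def vec_eq_iff)
  then show ?thesis
    by (simp add: inner_vec_def[of "outer u (axis j 1)"] inner_vec_def[of u] matrix_vector_mul_component
        inner_commute[of "axis j 1"])
qed

lemma A_op_inner: "A_op R Q \<bullet> X = Q \<bullet> link_load R X"
proof -
  have "(transpose (block R j) *v Q) \<bullet> y = Q \<bullet> (block R j *v y)" for j y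
    by (metis dot_lmul_matrix vector_transpose_matrix transpose_transpose inner_commute)
  then show ?thesis
    by (simp add: A_op_def link_load_def inner_sum_left inner_sum_right outer_axis_inner)
qed

lemma linear_link_load: "linear (link_load R)"
  unfolding link_load_def
  by (intro linear_compose_sum ballI linearI)
     (simp_all add: matrix_vector_mult_add_rdistrib matrix_vector_right_distrib
       scaleR_matrix_vector_assoc[symmetric] matrix_vector_mult_scaleR)

lemma linear_A_op: "linear (A_op R)"
proof (rule linearI)
  show "A_op R (p + q) = A_op R p + A_op R q" for p q
    by (rule vector_eq_rdot[THEN iffD1]) (simp add: A_op_inner inner_add_left)
  show "A_op R (c *\<^sub>R p) = c *\<^sub>R A_op R p" for c p
    by (rule vector_eq_rdot[THEN iffD1]) (simp add: A_op_inner)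
qed

lemma adjoint_A_op: "adjoint (A_op R) = link_load R"
  by (rule adjoint_unique) (simp add: A_op_inner)

lemma nonneg_matrix_iff: "0 \<le> (X :: real^'b^'a) \<longleftrightarrow> (\<forall>b\<in>Basis. 0 \<le> X \<bullet> b)"
  by (auto simp: less_eq_vec_def Basis_vec_def inner_axis)

lemma inner_nonneg_matrix:
  fixes X Y :: "real^'b^'a"
  assumes "0 \<le> X" "0 \<le> Y"
  shows "0 \<le> X \<bullet> Y"
  using assms by (simp add: inner_vec_def less_eq_vec_def sum_nonneg)

definition traffic_set :: "real^('s::finite \<times> 's)^'m::finite \<Rightarrow> real^'m \<Rightarrow> ('s \<times> 's) set \<Rightarrow> 's sqmat set" where
  "traffic_set R L \<Omega> = {X. 0 \<le> X \<and> proj_on \<Omega> X = 0 \<and> link_load R X = L}"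

lemma closed_nonneg_matrix: "closed {X :: real^'b^'a. 0 \<le> X}"
proof -
  have "{X :: real^'b^'a. 0 \<le> X} = (\<Inter>b\<in>Basis. {X. 0 \<le> X \<bullet> b})"
    by (auto simp: nonneg_matrix_iff)
  also have "closed \<dots>"
    by (intro closed_INT ballI closed_Collect_le continuous_intros)
  finally show ?thesis .
qed

lemma closed_traffic_set:
  fixes R :: "real^('s::finite \<times> 's)^'m::finite"
  shows "closed (traffic_set R L \<Omega>)"
proof -
  have "continuous_on UNIV (proj_on \<Omega> :: 's sqmat \<Rightarrow> _)" "continuous_on UNIV (link_load R)"
    by (simp_all add: linear_continuous_on linear_conv_bounded_linear[symmetric] linear_proj_on linear_link_load)
  then show ?thesis
    unfolding traffic_set_def
    by (intro closed_Collect_conj closed_nonneg_matrix closed_Collect_eq continuous_intros)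
qed

text \<open>\<open>V\<close> is complementary to \<open>X\<close>, and \<open>G\<close> is a
  subgradient of the nuclear norm at \<open>X\<close>, expressed by norm duality. The equation for
  \<open>W\<close> is stationarity of the quadratic term of the dual objective with multiplier
  \<open>X\<close>.\<close>

definition kkt_point ::
  "real^('s::finite \<times> 's)^'m::finite \<Rightarrow> real^'m \<Rightarrow> ('s \<times> 's) set \<Rightarrow> real \<Rightarrow> 's sqmat
   \<Rightarrow> 's sqmat \<times> (real^'m) \<times> 's sqmat \<times> 's sqmat \<times> 's sqmat \<Rightarrow> 's sqmat \<Rightarrow> bool" where
  "kkt_point R L \<Omega> \<alpha> A = (\<lambda>(U, Q, V, W, G) X.
     X \<in> traffic_set R L \<Omega> \<and> 0 \<le> V \<and> V \<bullet> X = 0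
     \<and> spectral_norm G \<le> 1 \<and> G \<bullet> X = nuclear_norm X
     \<and> W = (2 * \<alpha>) *\<^sub>R (A - X) \<and> proj_on \<Omega> U + V + W + A_op R Q = G)"

text \<open>The normal cone of the polyhedron \<^const>\<open>traffic_set\<close> at \<open>X\<close> is finitely generated, hence closed.\<close>

lemma traffic_normal_cone:
  assumes X: "X \<in> traffic_set R L \<Omega>"
  obtains N where "convex_cone N" "closed N"
    "\<And>n. n \<in> N \<Longrightarrow> \<exists>U Q V. 0 \<le> V \<and> V \<bullet> X = 0 \<and> n = proj_on \<Omega> U + A_op R Q + V"
    "\<And>d. (\<And>n. n \<in> N \<Longrightarrow> 0 \<le> d \<bullet> n) \<Longrightarrow> \<forall>\<^sub>F \<epsilon> in at_right 0. X + \<epsilon> *\<^sub>R d \<in> traffic_set R L \<Omega>"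
proof -
  let ?A = "A_op R" and ?P = "proj_on \<Omega>"
  \<comment> \<open>Generators with both signs span the ranges of the two linear maps, which belong
    to the equality constraints; the basis matrices on which \<open>X\<close> vanishes belong to the
    active sign constraints.\<close>
  define S where "S = ?P ` Basis \<union> (\<lambda>b. ?P (- b)) ` Basis \<union> ?A ` Basis \<union> (\<lambda>b. ?A (- b)) ` Basis
      \<union> {b \<in> Basis. X \<bullet> b = 0}"
  define N' where "N' = {?P U + ?A Q + V | U Q V. 0 \<le> V \<and> V \<bullet> X = 0}"
  have lA: "?A (p + q) = ?A p + ?A q" "?A (c *\<^sub>R p) = c *\<^sub>R ?A p" "?A 0 = 0" for p q c
    using linear_A_op[of R] by (simp_all add: linear_add linear_scale linear_0)
  have inN': "?P U + ?A Q + V \<in> N'" if "0 \<le> V" "V \<bullet> X = 0" for U Q V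
    using that unfolding N'_def by blast
  show thesis
  proof
    show "convex_cone (convex_cone hull S)" by (rule convex_cone_convex_cone_hull)
    have "finite S" by (simp add: S_def)
    then show "closed (convex_cone hull S)" by (rule closed_convex_cone_hull)
    have "S \<subseteq> N'"
    proof -
      have "?P b \<in> N'" for b using inN'[of 0 b 0] by (simp add: lA)
      moreover have "?A b \<in> N'" for b using inN'[of 0 0 b] by simp
      moreover have "b \<in> N'" if "b \<in> Basis" "X \<bullet> b = 0" for b
        using inN'[of b 0 0] that by (auto simp: lA nonneg_matrix_iff inner_Basis inner_commute)
      ultimately show ?thesis by (auto simp: S_def simp del: proj_on_simps)
    qed
    moreover have "convex_cone N'"
      unfolding convex_cone_iff
    proof (intro conjI ballI allI impI)
      have "0 \<in> N'" using inN'[of 0 0 0] by (simp add: lA)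
      then show "0 \<in> N'" .
      fix x y assume "x \<in> N'" "y \<in> N'"
      then obtain U Q V U' Q' V' where *: "x = ?P U + ?A Q + V" "0 \<le> V" "V \<bullet> X = 0"
        "y = ?P U' + ?A Q' + V'" "0 \<le> V'" "V' \<bullet> X = 0"
        unfolding N'_def by blast
      have "x + y = ?P (U + U') + ?A (Q + Q') + (V + V')" by (simp add: * lA)
      also have "\<dots> \<in> N'" using * by (intro inN') (auto simp: inner_add_left)
      finally show "x + y \<in> N'" .
    next
      fix x and c :: real assume "x \<in> N'" "0 \<le> c"
      then obtain U Q V where *: "x = ?P U + ?A Q + V" "0 \<le> V" "V \<bullet> X = 0"
        unfolding N'_def by blast
      have "c *\<^sub>R x = ?P (c *\<^sub>R U) + ?A (c *\<^sub>R Q) + c *\<^sub>R V" by (simp add: * lA algebra_simps)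
      also have "\<dots> \<in> N'" using * \<open>0 \<le> c\<close>
        by (intro inN') (auto simp: less_eq_vec_def)
      finally show "c *\<^sub>R x \<in> N'" .
    qed
    ultimately have "convex_cone hull S \<subseteq> N'" by (rule hull_minimal)
    then show "\<exists>U Q V. 0 \<le> V \<and> V \<bullet> X = 0 \<and> n = ?P U + ?A Q + V" if "n \<in> convex_cone hull S" for n
      using that unfolding N'_def by blast
    fix d assume "\<And>n. n \<in> convex_cone hull S \<Longrightarrow> 0 \<le> d \<bullet> n"
    then have d: "0 \<le> d \<bullet> n" if "n \<in> S" for n using that by (simp add: hull_inc)
    have Pd: "?P d = 0"
    proof (rule euclidean_eqI)
      fix b :: "'a sqmat" assume b: "b \<in> Basis"
      have "0 \<le> d \<bullet> ?P b" "0 \<le> d \<bullet> ?P (- b)" using b by (auto intro!: d simp: S_def simp del: proj_on_simps)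
      then show "?P d \<bullet> b = 0 \<bullet> b" by (simp add: proj_on_inner)
    qed
    have Ld: "link_load R d = 0"
    proof (rule euclidean_eqI)
      fix b :: "real^'b" assume b: "b \<in> Basis"
      have "0 \<le> ?A b \<bullet> d" "0 \<le> ?A (- b) \<bullet> d" 
        using d[of "?A b"] d[of "?A (- b)"] b by (auto simp: S_def inner_commute)
      then show "link_load R d \<bullet> b = 0 \<bullet> b" 
        by (simp add: A_op_inner inner_commute[of "link_load R d"])
    qed
    \<comment> \<open>Where an entry of \<open>X\<close> is 0, the direction is nonnegative; where
      it is positive, it stays so for small steps. Finitely many entries allow a common
      step.\<close>
    have "\<forall>\<^sub>F \<epsilon> in at_right 0. 0 \<le> (X + \<epsilon> *\<^sub>R d) \<bullet> b" if b: "b \<in> Basis" for b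
    proof (cases "X \<bullet> b = 0")
      case True
      then have "0 \<le> d \<bullet> b" using b by (intro d) (simp add: S_def)
      then show ?thesis
        using True by (auto simp: inner_add_left eventually_at_right_field intro!: exI[of _ 1])
    next
      case False
      then have "0 < X \<bullet> b" using X b by (simp add: traffic_set_def nonneg_matrix_iff less_le)
      moreover have "((\<lambda>\<epsilon>. (X + \<epsilon> *\<^sub>R d) \<bullet> b) \<longlongrightarrow> (X + 0 *\<^sub>R d) \<bullet> b) (at_right 0)"
        by (intro tendsto_intros)
      ultimately have "\<forall>\<^sub>F \<epsilon> in at_right 0. 0 < (X + \<epsilon> *\<^sub>R d) \<bullet> b"
        by (intro order_tendstoD) simp_all
      then show ?thesis by (rule eventually_mono) simp
    qed
    then have "\<forall>\<^sub>F \<epsilon> in at_right 0. \<forall>b\<in>Basis. 0 \<le> (X + \<epsilon> *\<^sub>R d) \<bullet> b"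
      by (simp add: eventually_ball_finite_distrib)
    then show "\<forall>\<^sub>F \<epsilon> in at_right 0. X + \<epsilon> *\<^sub>R d \<in> traffic_set R L \<Omega>"
      using X Pd Ld linear_link_load[of R]
      by (simp add: traffic_set_def nonneg_matrix_iff linear_add linear_scale)
  qed
qed

text \<open>The traffic matrix \<open>T\<close> makes the primal feasible set nonempty, so a primal
  minimizer exists. Membership of \<open>G + 2 \<alpha> (X - A)\<close> in the dual cone is the dual
  feasibility equation once \<open>W\<close> is set to \<open>2 \<alpha> (A - X)\<close>.\<close>

lemma kkt_point_exists:
  assumes "T \<in> traffic_set R L \<Omega>" and \<alpha>: "0 < \<alpha>"
  obtains U Q V W G X where "kkt_point R L \<Omega> \<alpha> A (U, Q, V, W, G) X"
proof -
  let ?F = "traffic_set R L \<Omega>" and ?K = "{G. spectral_norm G \<le> 1}"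
  have le: "G \<bullet> X \<le> nuclear_norm X" if "G \<in> ?K" for G X :: "'a sqmat"
    using that inner_le_nuclear_norm by simp
  have att: "\<exists>G\<in>?K. G \<bullet> X = nuclear_norm X" for X :: "'a sqmat"
    using nuclear_norm_attained[of X] by (metis mem_Collect_eq)
  have cont: "continuous_on UNIV (nuclear_norm :: 'a sqmat \<Rightarrow> real)"
    by (rule support_function_continuous[OF compact_imp_bounded[OF spectral_ball_compact] le att])
  have pos: "0 \<le> nuclear_norm X" for X :: "'a sqmat"
    using inner_le_nuclear_norm[of 0 X] by (simp add: spectral_norm_le_1_iff)
  obtain X where X: "X \<in> ?F"
    "\<And>Y. Y \<in> ?F \<Longrightarrow> nuclear_norm X + \<alpha> * (norm (X - A))\<^sup>2 \<le> nuclear_norm Y + \<alpha> * (norm (Y - A))\<^sup>2"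
    by (rule support_prox_minimizer_exists[OF closed_traffic_set assms cont pos]) blast
  obtain N where N: "convex_cone N" "closed N"
    "\<And>n. n \<in> N \<Longrightarrow> \<exists>U Q V. 0 \<le> V \<and> V \<bullet> X = 0 \<and> n = proj_on \<Omega> U + A_op R Q + V"
    "\<And>d. (\<And>n. n \<in> N \<Longrightarrow> 0 \<le> d \<bullet> n) \<Longrightarrow> \<forall>\<^sub>F \<epsilon> in at_right 0. X + \<epsilon> *\<^sub>R d \<in> ?F"
    using traffic_normal_cone[OF X(1)] by blast
  obtain G where G: "G \<in> ?K" "G \<bullet> X = nuclear_norm X" "G + (2 * \<alpha>) *\<^sub>R (X - A) \<in> N"
    by (rule support_prox_multiplier[OF spectral_ball_compact spectral_ball_closed_convex(2) le att X(2) N(1,2) N(4)]) blast+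
  obtain U Q V where V: "0 \<le> V" "V \<bullet> X = 0" "G + (2 * \<alpha>) *\<^sub>R (X - A) = proj_on \<Omega> U + A_op R Q + V"
    using N(3)[OF G(3)] by blast
  have "G = proj_on \<Omega> U + V + (2 * \<alpha>) *\<^sub>R (A - X) + A_op R Q"
    using V(3) by (simp add: algebra_simps)
  then show thesis
    using X(1) G(1,2) V(1,2)
    by (intro that[of U Q V "(2 * \<alpha>) *\<^sub>R (A - X)" G X]) (simp add: kkt_point_def)
qed

text \<open>Both parts of the objective are minorized by their linearizations at \<open>X\<close>,
  the nuclear norm through its subgradient \<open>G\<close>. The total slope is
  \<open>G - W\<close>, which pairs with \<open>Y - X\<close> to \<open>V \<bullet> Y\<close>,
  because the equality constraints and complementarity remove the rest.\<close>

lemma kkt_point_primal_optimal: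
  assumes "kkt_point R L \<Omega> \<alpha> A (U, Q, V, W, G) X" and \<alpha>: "0 < \<alpha>"
  shows "primal_optimal R L \<Omega> \<alpha> A X"
proof -
  have k: "X \<in> traffic_set R L \<Omega>" "0 \<le> V" "V \<bullet> X = 0" "spectral_norm G \<le> 1" "G \<bullet> X = nuclear_norm X"
    "W = (2 * \<alpha>) *\<^sub>R (A - X)" "proj_on \<Omega> U + V + W + A_op R Q = G"
    using assms(1) by (auto simp: kkt_point_def)
  have le: "nuclear_norm X + \<alpha> * (norm (X - A))\<^sup>2 \<le> nuclear_norm Y + \<alpha> * (norm (Y - A))\<^sup>2"
    if Y: "Y \<in> traffic_set R L \<Omega>" for Y
  proof -
    have "(norm (Y - A))\<^sup>2 = (norm (X - A))\<^sup>2 + 2 * ((X - A) \<bullet> (Y - X)) + (norm (Y - X))\<^sup>2"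
      unfolding power2_norm_eq_inner by (simp add: algebra_simps inner_commute)
    then have "\<alpha> * (norm (Y - A))\<^sup>2 - \<alpha> * (norm (X - A))\<^sup>2
        = 2 * \<alpha> * ((X - A) \<bullet> (Y - X)) + \<alpha> * (norm (Y - X))\<^sup>2"
      by (simp add: distrib_left)
    moreover have "0 \<le> \<alpha> * (norm (Y - X))\<^sup>2" using \<alpha> by simp
    moreover have "G \<bullet> Y \<le> nuclear_norm Y" by (rule inner_le_nuclear_norm[OF k(4)])
    moreover have "0 \<le> G \<bullet> (Y - X) + 2 * \<alpha> * ((X - A) \<bullet> (Y - X))"
    proof -
      have "G \<bullet> (Y - X) + 2 * \<alpha> * ((X - A) \<bullet> (Y - X)) = (G - W) \<bullet> (Y - X)"
        unfolding k(6) by (simp add: inner_diff_left inner_diff_right algebra_simps)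
      also have "G - W = proj_on \<Omega> U + V + A_op R Q" using k(7) by (simp add: algebra_simps)
      also have "(proj_on \<Omega> U + V + A_op R Q) \<bullet> (Y - X) = V \<bullet> Y"
        using k(1,3) Y
        by (simp add: traffic_set_def inner_add_left proj_on_inner A_op_inner inner_diff_right
            linear_diff[OF linear_link_load])
      also have "0 \<le> V \<bullet> Y" using Y k(2) by (intro inner_nonneg_matrix) (auto simp: traffic_set_def)
      finally show ?thesis by simp
    qed
    ultimately show ?thesis using k(5) by (simp add: inner_diff_right)
  qed
  have "primal_objective \<alpha> (X, X, X - A) \<le> primal_objective \<alpha> p" if "primal_feasible R L \<Omega> A p" for p
  proof (cases p)
    case (fields X' Y' Z')
    then have "X' \<in> traffic_set R L \<Omega>" "Z' = X' - A"
      using that by (auto simp: primal_feasible_def traffic_set_def)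
    with le[of X'] show ?thesis by (simp add: fields primal_objective_def)
  qed
  moreover have "primal_feasible R L \<Omega> A (X, X, X - A)"
    using k(1) by (simp add: primal_feasible_def traffic_set_def)
  ultimately show ?thesis
    unfolding primal_optimal_def is_arg_min_linorder by simp
qed

lemma dual_objective_eq:
  "dual_objective L \<alpha> A (U, Q, V, W, G) = (if 0 \<le> V \<and> spectral_norm G \<le> 1
     then ereal (- (Q \<bullet> L) + 1 / (4 * \<alpha>) * (norm (W - (2 * \<alpha>) *\<^sub>R A))\<^sup>2) else \<infinity>)"
  by (simp add: dual_objective_def indicator_fn_def)

text \<open>The quadratic term has slope \<open>- X\<close> at \<open>W\<close>, so the comparison
  reduces to pairing \<open>X\<close> with \<open>W' - W\<close>. Feasibility expresses this through
  the other blocks, where the signs follow from \<open>X\<close> being nonnegative and from norm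
  duality.\<close>

lemma kkt_point_dual_optimal:
  assumes "kkt_point R L \<Omega> \<alpha> A (U, Q, V, W, G) X" and \<alpha>: "0 < \<alpha>"
  shows "dual_optimal R L \<Omega> \<alpha> A (U, Q, V, W, G)"
proof -
  have k: "X \<in> traffic_set R L \<Omega>" "0 \<le> V" "V \<bullet> X = 0" "spectral_norm G \<le> 1" "G \<bullet> X = nuclear_norm X"
    "W = (2 * \<alpha>) *\<^sub>R (A - X)" "proj_on \<Omega> U + V + W + A_op R Q = G"
    using assms(1) by (auto simp: kkt_point_def)
  have "dual_objective L \<alpha> A (U, Q, V, W, G) \<le> dual_objective L \<alpha> A (U', Q', V', W', G')"
    if feas: "dual_feasible R \<Omega> (U', Q', V', W', G')" for U' Q' V' W' G'
  proof (cases "0 \<le> V' \<and> spectral_norm G' \<le> 1")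
    case True
    have "(norm (W' - (2 * \<alpha>) *\<^sub>R A))\<^sup>2
        = (norm (W - (2 * \<alpha>) *\<^sub>R A))\<^sup>2 + 2 * ((W - (2 * \<alpha>) *\<^sub>R A) \<bullet> (W' - W)) + (norm (W' - W))\<^sup>2"
      unfolding power2_norm_eq_inner by (simp add: algebra_simps inner_commute)
    moreover have "W - (2 * \<alpha>) *\<^sub>R A = - ((2 * \<alpha>) *\<^sub>R X)"
      unfolding k(6) by (simp add: algebra_simps)
    ultimately have "(norm (W' - (2 * \<alpha>) *\<^sub>R A))\<^sup>2
        \<ge> (norm (W - (2 * \<alpha>) *\<^sub>R A))\<^sup>2 - 4 * \<alpha> * (X \<bullet> (W' - W))" by simp
    then have "1 / (4 * \<alpha>) * ((norm (W - (2 * \<alpha>) *\<^sub>R A))\<^sup>2 - 4 * \<alpha> * (X \<bullet> (W' - W)))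
        \<le> 1 / (4 * \<alpha>) * (norm (W' - (2 * \<alpha>) *\<^sub>R A))\<^sup>2"
      using \<alpha> by (intro mult_left_mono) auto
    then have 1: "1 / (4 * \<alpha>) * (norm (W - (2 * \<alpha>) *\<^sub>R A))\<^sup>2 - X \<bullet> (W' - W)
        \<le> 1 / (4 * \<alpha>) * (norm (W' - (2 * \<alpha>) *\<^sub>R A))\<^sup>2"
      using \<alpha> by (simp add: right_diff_distrib)
    have "W' - W = (G' - G) - proj_on \<Omega> (U' - U) - (V' - V) - (A_op R Q' - A_op R Q)"
      using k(7) feas by (simp add: dual_feasible_def algebra_simps)
    then have "X \<bullet> (W' - W) = X \<bullet> (G' - G) - X \<bullet> proj_on \<Omega> (U' - U) - X \<bullet> (V' - V) - X \<bullet> (A_op R Q' - A_op R Q)"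
      by (simp only: inner_diff_right)
    moreover have "X \<bullet> proj_on \<Omega> (U' - U) = 0"
      using k(1) by (simp only: proj_on_inner[symmetric] traffic_set_def) simp
    moreover have "X \<bullet> (A_op R Q' - A_op R Q) = Q' \<bullet> L - Q \<bullet> L"
      using k(1) by (simp add: inner_commute[of X] inner_diff_left A_op_inner traffic_set_def)
    moreover have "0 \<le> X \<bullet> (V' - V)"
      using k(1,3) True inner_nonneg_matrix[of X V'] by (simp add: inner_diff_right inner_commute traffic_set_def)
    moreover have "X \<bullet> (G' - G) \<le> 0"
      using True inner_le_nuclear_norm[of G' X] k(5) by (simp add: inner_diff_right inner_commute)
    ultimately show ?thesis
      using 1 k(2,4) True by (simp add: dual_objective_eq)
  next
    case False
    then show ?thesis by (auto simp: dual_objective_eq)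
  qed
  then have "dual_objective L \<alpha> A (U, Q, V, W, G) \<le> dual_objective L \<alpha> A p" if "dual_feasible R \<Omega> p" for p
    using that by (cases p) simp
  moreover have "dual_feasible R \<Omega> (U, Q, V, W, G)"
    using k(7) by (simp add: dual_feasible_def)
  ultimately show ?thesis
    unfolding dual_optimal_def is_arg_min_linorder by simp
qed

subsection \<open>The subproblems of the iteration\<close>

lemma selfadjoint_psdD:
  assumes "selfadjoint_psd H"
  shows "linear H" "H x \<bullet> y = x \<bullet> H y" "0 \<le> x \<bullet> H x"
  using assms adjoint_works[of H x y] by (auto simp: selfadjoint_psd_def)

lemma selfadjoint_psd_form:
  assumes "selfadjoint_psd H"
  shows "psd_form (\<lambda>x y. H x \<bullet> y)"
proof
  show "bilinear (\<lambda>x y. H x \<bullet> y)"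
    using selfadjoint_psdD(1)[OF assms]
    by (auto simp: bilinear_def linear_add linear_scale inner_add_left inner_add_right intro!: linearI)
qed (use selfadjoint_psdD[OF assms] in \<open>auto simp: inner_commute\<close>)

text \<open>Cauchy-Schwarz for the form of \<open>H\<close>, applied to \<open>x\<close> and
  \<open>H x\<close>.\<close>

lemma selfadjoint_psd_kernel:
  assumes "selfadjoint_psd H" "x \<bullet> H x = 0"
  shows "H x = 0"
proof -
  interpret psd_form "\<lambda>x y. H x \<bullet> y" by (rule selfadjoint_psd_form[OF assms(1)])
  have "H x \<bullet> x = 0" using assms(2) by (simp add: inner_commute)
  then show ?thesis using cauchy_schwarz[of x "H x"] by simp
qed

lemma selfadjoint_psd_bij_pos:
  assumes "selfadjoint_psd H" "bij H" "x \<noteq> 0"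
  shows "0 < x \<bullet> H x"
proof -
  have "H x \<noteq> 0"
    using assms bij_is_inj[OF assms(2)] linear_injective_0[OF selfadjoint_psdD(1)[OF assms(1)]] by blast
  then have "x \<bullet> H x \<noteq> 0" using selfadjoint_psd_kernel[OF assms(1)] by blast
  then show ?thesis using selfadjoint_psdD(3)[OF assms(1), of x] by simp
qed

text \<open>Substituting \<open>x = H y\<close> turns \<open>inv H x \<bullet> x\<close> into
  \<open>y \<bullet> H y\<close>, so the inverse inherits symmetry and definiteness.\<close>

lemma selfadjoint_posdef_inv:
  fixes H :: "'a::euclidean_space \<Rightarrow> 'a"
  assumes lin: "linear H" and sym: "\<And>x y. H x \<bullet> y = x \<bullet> H y" and posdef: "\<forall>x. x \<noteq> 0 \<longrightarrow> 0 < x \<bullet> H x"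
  shows "inv H (H x) = x" and "psd_form (\<lambda>x y. inv H x \<bullet> y)" and "inv H x \<bullet> x = 0 \<Longrightarrow> x = 0"
proof -
  note pos = posdef[rule_format]
  have inj: "inj H"
    unfolding linear_injective_0[OF lin] using pos by force
  let ?K = "inv H"
  have HK: "H (?K x) = x" for x by (rule surj_f_inv_f[OF linear_inj_imp_surj[OF lin inj]])
  have linK: "linear ?K" by (rule inj_linear_imp_inv_linear[OF lin inj])
  show "?K (H x) = x" by (rule inv_f_f[OF inj])
  show "psd_form (\<lambda>x y. ?K x \<bullet> y)"
  proof
    show "bilinear (\<lambda>x y. ?K x \<bullet> y)"
      using linK by (auto simp: bilinear_def linear_add linear_scale inner_add_left inner_add_right intro!: linearI)
    show "?K x \<bullet> y = ?K y \<bullet> x" for x y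
      using sym[of "?K y" "?K x"] by (simp add: HK inner_commute)
    show "0 \<le> ?K x \<bullet> x" for x
      using pos[of "?K x"] by (cases "?K x = 0") (auto simp: HK)
  qed
  show "x = 0" if "?K x \<bullet> x = 0"
  proof -
    have "?K x = 0" using pos[of "?K x"] that by (cases "?K x = 0") (auto simp: HK)
    then have "H (?K x) = 0" using linear_0[OF lin] by simp
    then show ?thesis by (simp add: HK)
  qed
qed

text \<open>The function is specified by its exact second-order expansion, so that slope and
  curvature are available without differentiation. The conclusion identifies the chosen
  \<open>arg_min\<close> with the only minimizer, which is what makes an iterate well
  defined.\<close>

lemma quadratic_argmin:
  fixes F :: "'a::euclidean_space \<Rightarrow> ereal" and \<phi> :: "'a \<Rightarrow> real" and M g
  assumes F: "\<And>u. F u = (if u \<in> C then ereal (\<phi> u) else \<infinity>)"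
    and C: "closed C" "convex C" "C \<noteq> {}"
    and M: "bilinear M" and posdef: "\<forall>d. d \<noteq> 0 \<longrightarrow> 0 < M d d"
    and g: "\<And>u. linear (g u)"
    and expand: "\<And>u v. \<phi> v = \<phi> u + g u (v - u) + M (v - u) (v - u) / 2"
  defines "m \<equiv> arg_min F (\<lambda>_. True)"
  shows "is_arg_min F (\<lambda>_. True) v \<longleftrightarrow> v = m" and "m \<in> C" and "v \<in> C \<Longrightarrow> 0 \<le> g m (v - m)"
proof -
  note pos = posdef[rule_format]
  interpret M: bounded_bilinear M using M by (simp add: bilinear_conv_bounded_bilinear)
  obtain c where c: "0 < c" "\<And>d. c * (norm d)\<^sup>2 \<le> M d d"
    using bilinear_coercive[OF M pos] by blast
  have M0: "0 \<le> M d d" for d using c(2)[of d] c(1) by (meson mult_nonneg_nonneg less_imp_le order_trans zero_le_power2)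
  obtain u0 where u0: "u0 \<in> C" using C(3) by blast
  obtain K where K: "0 < K" "\<And>d. norm (g u0 d) \<le> norm d * K"
    using bounded_linear.pos_bounded[OF g[of u0, unfolded linear_conv_bounded_linear]] by blast
  \<comment> \<open>Beyond distance \<open>2 K / c\<close> from \<open>u0\<close> the curvature
    term, at least \<open>c/2\<close> times the squared distance, outweighs a slope bounded by
    \<open>K\<close>.\<close>
  define S where "S = C \<inter> cball u0 (2 * K / c)"
  have far: "\<phi> u0 < \<phi> v" if "v \<notin> cball u0 (2 * K / c)" for v
  proof -
    let ?n = "norm (v - u0)"
    have n: "2 * K / c < ?n" using that by (simp add: dist_norm norm_minus_commute)
    then have n': "2 * K < c * ?n" using c(1) by (simp add: field_simps)
    have "0 \<le> 2 * K / c" using K(1) c(1) by simp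
    with n have n0: "0 < ?n" by linarith
    have "\<bar>g u0 (v - u0)\<bar> \<le> ?n * K" using K(2)[of "v - u0"] by simp
    then have "- (?n * K) \<le> g u0 (v - u0)" by (simp add: abs_le_iff)
    moreover have "?n * (2 * K) < ?n * (c * ?n)" by (rule mult_strict_left_mono[OF n' n0])
    moreover have "?n * (c * ?n) \<le> M (v - u0) (v - u0)"
      using c(2)[of "v - u0"] by (simp add: power2_eq_square ac_simps)
    ultimately show ?thesis using expand[of v u0] by simp
  qed
  have "continuous_on S \<phi>"
  proof -
    have "continuous_on S (\<lambda>v. \<phi> u0 + g u0 (v - u0) + M (v - u0) (v - u0) / 2)"
      by (intro continuous_intros M.continuous_on linear_continuous_on_compose[OF _ g])
         auto
    moreover have "(\<lambda>v. \<phi> u0 + g u0 (v - u0) + M (v - u0) (v - u0) / 2) = \<phi>"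
      by (rule ext) (rule expand[symmetric])
    ultimately show ?thesis by (simp only:)
  qed
  moreover have "compact S" unfolding S_def by (intro closed_Int_compact C compact_cball)
  moreover have u0S: "u0 \<in> S" using u0 K c by (simp add: S_def)
  ultimately obtain w where w: "w \<in> S" "\<And>v. v \<in> S \<Longrightarrow> \<phi> w \<le> \<phi> v"
    using continuous_attains_inf[of S \<phi>] by (metis empty_iff)
  have wC: "w \<in> C" using w(1) by (simp add: S_def)
  have wmin: "\<phi> w \<le> \<phi> v" if "v \<in> C" for v
  proof (cases "v \<in> cball u0 (2 * K / c)")
    case True
    then show ?thesis using that w(2) by (simp add: S_def)
  next
    case False
    then show ?thesis using far[of v] w(2)[OF u0S] by simp
  qed
  have vi: "0 \<le> g w (v - w)" if "v \<in> C" for v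
  proof -
    let ?d = "v - w"
    have *: "0 \<le> g w ?d + t / 2 * M ?d ?d" if t: "0 < t" "t \<le> 1" for t
    proof -
      have "(1 - t) *\<^sub>R w + t *\<^sub>R v \<in> C" using t wC \<open>v \<in> C\<close> C(2) by (simp add: convex_alt)
      then have "w + t *\<^sub>R ?d \<in> C" by (simp add: algebra_simps)
      then have "\<phi> w \<le> \<phi> (w + t *\<^sub>R ?d)" by (rule wmin)
      also have "\<dots> = \<phi> w + t * (g w ?d + t / 2 * M ?d ?d)"
        using expand[of "w + t *\<^sub>R ?d" w]
        by (simp add: linear_scale[OF g] M.scaleR_left M.scaleR_right distrib_left)
      finally show ?thesis using t by (simp add: zero_le_mult_iff)
    qed
    have "((\<lambda>t. g w ?d + t / 2 * M ?d ?d) \<longlongrightarrow> g w ?d + 0 / 2 * M ?d ?d) (at_right 0)"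
      by (intro tendsto_intros) auto
    moreover have "\<forall>\<^sub>F t in at_right 0. 0 \<le> g w ?d + t / 2 * M ?d ?d"
      unfolding eventually_at_right_field using * by (intro exI[of _ 1]) auto
    ultimately have "0 \<le> g w ?d + 0 / 2 * M ?d ?d"
      by (intro tendsto_lowerbound) auto
    then show ?thesis by simp
  qed
  have unique: "v = w" if v: "v \<in> C" "\<phi> v \<le> \<phi> w" for v
  proof (rule ccontr)
    assume "v \<noteq> w"
    then show False using expand[of v w] vi[OF v(1)] pos[of "v - w"] v(2) by simp
  qed
  have argmin: "is_arg_min F (\<lambda>_. True) v \<longleftrightarrow> v = w" for v
  proof
    assume "is_arg_min F (\<lambda>_. True) v"
    then have "F v \<le> F w" by (simp add: is_arg_min_linorder)
    then have "v \<in> C" "\<phi> v \<le> \<phi> w" using wC by (auto simp: F split: if_splits)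
    then show "v = w" by (rule unique)
  next
    assume "v = w"
    then show "is_arg_min F (\<lambda>_. True) v" using wC wmin by (simp add: is_arg_min_linorder F)
  qed
  have "m = w"
    unfolding m_def arg_min_def argmin by simp
  then show "is_arg_min F (\<lambda>_. True) v \<longleftrightarrow> v = m" "m \<in> C" "v \<in> C \<Longrightarrow> 0 \<le> g m (v - m)"
    using argmin wC vi by simp_all
qed

text \<open>One template for all subproblems: \<open>T\<close> is the map by which the block enters
  the residual and \<open>e\<close> collects the other blocks. The curvature \<open>\<kappa>\<close>
  is \<open>1 / (2 * \<alpha>)\<close> for \<open>W\<close> and 0 otherwise, and the linear term
  \<open>l\<close> is \<open>- L\<close> for \<open>Q\<close> and 0 otherwise.\<close>

lemma semi_prox_argmin:
  fixes f :: "'a::euclidean_space \<Rightarrow> ereal" and T :: "'a \<Rightarrow> 'b::euclidean_space" and uc :: 'a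
  assumes f: "\<And>u. f u = (if u \<in> C then ereal (c0 + l \<bullet> u + \<kappa> / 2 * (norm (u - a))\<^sup>2
       + x \<bullet> (T u + e) + \<beta> / 2 * (norm (T u + e))\<^sup>2) else \<infinity>)"
    and C: "closed C" "convex C" "C \<noteq> {}"
    and H: "selfadjoint_psd H" and T: "linear T"
    and pos: "\<forall>d. d \<noteq> 0 \<longrightarrow> 0 < \<kappa> * (d \<bullet> d) + \<beta> * (T d \<bullet> T d + d \<bullet> H d)"
  defines "m \<equiv> arg_min (semi_prox \<beta> H f uc) (\<lambda>_. True)"
  shows "is_arg_min (semi_prox \<beta> H f uc) (\<lambda>_. True) v \<longleftrightarrow> v = m" and "m \<in> C"
    and "v \<in> C \<Longrightarrow> 0 \<le> l \<bullet> (v - m) + \<kappa> * ((m - a) \<bullet> (v - m)) + (x + \<beta> *\<^sub>R (T m + e)) \<bullet> T (v - m)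
           + \<beta> * (H (m - uc) \<bullet> (v - m))"
proof -
  define \<phi> where "\<phi> u = c0 + l \<bullet> u + \<kappa> / 2 * (norm (u - a))\<^sup>2
       + x \<bullet> (T u + e) + \<beta> / 2 * (norm (T u + e))\<^sup>2 + \<beta> / 2 * ((u - uc) \<bullet> H (u - uc))" for u
  define g where "g u d = l \<bullet> d + \<kappa> * ((u - a) \<bullet> d) + (x + \<beta> *\<^sub>R (T u + e)) \<bullet> T d + \<beta> * (H (u - uc) \<bullet> d)" for u d
  define M where "M d d' = \<kappa> * (d \<bullet> d') + \<beta> * (T d \<bullet> T d' + H d \<bullet> d')" for d d'
  note lH = selfadjoint_psdD(1)[OF H] and sH = selfadjoint_psdD(2)[OF H]
  have F: "semi_prox \<beta> H f uc u = (if u \<in> C then ereal (\<phi> u) else \<infinity>)" for u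
    by (simp add: semi_prox_def f \<phi>_def)
  have M: "bilinear M"
    by (auto simp: bilinear_def M_def linear_add[OF T] linear_add[OF lH] linear_scale[OF T] linear_scale[OF lH]
        inner_add_left inner_add_right algebra_simps intro!: linearI)
  have g: "linear (g u)" for u
    by (rule linearI) (simp_all add: g_def linear_add[OF T] linear_scale[OF T] inner_add_right algebra_simps)
  have p: "\<forall>d. d \<noteq> 0 \<longrightarrow> 0 < M d d"
    using pos by (simp add: M_def inner_commute)
  have expand: "\<phi> v = \<phi> u + g u (v - u) + M (v - u) (v - u) / 2" for u v
  proof -
    define d where "d = v - u"
    have sq: "(norm (p + q))\<^sup>2 = (norm p)\<^sup>2 + 2 * (p \<bullet> q) + q \<bullet> q" for p q :: "'c::real_inner"
      unfolding power2_norm_eq_inner by (simp add: inner_add_left inner_add_right inner_commute)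
    have v: "v - a = (u - a) + d" "T v + e = (T u + e) + T d" "v - uc = (u - uc) + d" "l \<bullet> v = l \<bullet> u + l \<bullet> d"
      using linear_diff[OF T, of v u] by (simp_all add: d_def inner_diff_right)
    have q: "((u - uc) + d) \<bullet> H ((u - uc) + d) = (u - uc) \<bullet> H (u - uc) + 2 * (H (u - uc) \<bullet> d) + H d \<bullet> d"
      using sH[of "u - uc" d] sH[of d d]
      by (simp only: linear_add[OF lH] inner_add_left inner_add_right) (simp add: inner_commute)
    have x: "x \<bullet> ((T u + e) + T d) = x \<bullet> (T u + e) + x \<bullet> T d" by (rule inner_add_right)
    have b: "(x + \<beta> *\<^sub>R (T u + e)) \<bullet> T d = x \<bullet> T d + \<beta> * ((T u + e) \<bullet> T d)"
      by (simp only: inner_add_left[of x] inner_scaleR_left)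
    show ?thesis
      unfolding \<phi>_def g_def M_def d_def[symmetric] v(1-3) v(4) sq q x b
      by (simp add: field_simps del: inner_add_left inner_add_right)
  qed
  note res = quadratic_argmin[where F = "semi_prox \<beta> H f uc" and \<phi> = \<phi> and g = g and M = M,
      OF F C M p g expand, folded m_def]
  show "is_arg_min (semi_prox \<beta> H f uc) (\<lambda>_. True) v \<longleftrightarrow> v = m" by (rule res(1))
  show "m \<in> C" by (rule res(2))
  show "0 \<le> l \<bullet> (v - m) + \<kappa> * ((m - a) \<bullet> (v - m)) + (x + \<beta> *\<^sub>R (T m + e)) \<bullet> T (v - m)
           + \<beta> * (H (m - uc) \<bullet> (v - m))" if "v \<in> C"
    using res(3)[OF that] by (simp only: g_def)
qed

lemma aug_lagrangian_eq:
  "aug_lagrangian R L \<Omega> \<alpha> A \<beta> U Q V W G X =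
     (if 0 \<le> V \<and> spectral_norm G \<le> 1
      then ereal (- (Q \<bullet> L) + 1 / (4 * \<alpha>) * (norm (W - (2 * \<alpha>) *\<^sub>R A))\<^sup>2
        + X \<bullet> dual_residual R \<Omega> (U, Q, V, W, G)
        + \<beta> / 2 * (norm (dual_residual R \<Omega> (U, Q, V, W, G)))\<^sup>2)
      else \<infinity>)"
  by (simp add: aug_lagrangian_def dual_objective_eq)

section \<open>Optimality conditions of the block updates\<close>

context
  fixes R :: "real^('s::finite \<times> 's)^'m::finite" and L :: "real^'m" and \<Omega> :: "('s \<times> 's) set"
    and \<alpha> \<beta> :: real and A :: "'s sqmat"
    and U V W G X :: "'s sqmat" and Q :: "real^'m"
  assumes beta: "0 < \<beta>"
begin

text \<open>Penalty and proximal weight add up to \<open>\<beta>\<close> times the invertible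
  operator \<open>G\<^sub>U\<close>, hence strict convexity. The block is unconstrained, so testing
  with \<open>d\<close> and \<open>- d\<close> turns the variational inequality into an
  equation.\<close>

lemma U_step:
  fixes u u0 :: "'s sqmat" and H
  assumes G\<^sub>U: "selfadjoint_psd G\<^sub>U" "bij G\<^sub>U" and H: "H = (\<lambda>u. G\<^sub>U u - proj_on \<Omega> u)" "selfadjoint_psd H"
    and VG: "0 \<le> V" "spectral_norm G \<le> 1"
  defines "F \<equiv> semi_prox \<beta> H (\<lambda>u. aug_lagrangian R L \<Omega> \<alpha> A \<beta> u Q V W G X) u0"
  assumes u: "u = arg_min F (\<lambda>_. True)"
  shows "is_arg_min F (\<lambda>_. True) v \<longleftrightarrow> v = u"
    and "(X + \<beta> *\<^sub>R dual_residual R \<Omega> (u, Q, V, W, G)) \<bullet> proj_on \<Omega> d + \<beta> * (H (u - u0) \<bullet> d) = 0"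
proof -
  define e where "e = V + W + A_op R Q - G"
  have res: "dual_residual R \<Omega> (v, Q, V, W, G) = proj_on \<Omega> v + e" for v
    by (simp add: dual_residual_def e_def)
  have f: "aug_lagrangian R L \<Omega> \<alpha> A \<beta> v Q V W G X = (if v \<in> UNIV then
      ereal ((- (Q \<bullet> L) + 1 / (4 * \<alpha>) * (norm (W - (2 * \<alpha>) *\<^sub>R A))\<^sup>2) + 0 \<bullet> v + 0 / 2 * (norm (v - 0))\<^sup>2
        + X \<bullet> (proj_on \<Omega> v + e) + \<beta> / 2 * (norm (proj_on \<Omega> v + e))\<^sup>2) else \<infinity>)" for v
    using VG by (simp only: aug_lagrangian_eq res) simp
  have pos: "\<forall>d. d \<noteq> 0 \<longrightarrow> 0 < 0 * (d \<bullet> d) + \<beta> * (proj_on \<Omega> d \<bullet> proj_on \<Omega> d + d \<bullet> H d)"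
  proof (intro allI impI)
    fix d :: "'s sqmat" assume that: "d \<noteq> 0"
    show "0 < 0 * (d \<bullet> d) + \<beta> * (proj_on \<Omega> d \<bullet> proj_on \<Omega> d + d \<bullet> H d)"
      using selfadjoint_psd_bij_pos[OF G\<^sub>U that] beta
      by (simp add: H(1) proj_on_inner inner_diff_right)
  qed
  note m = semi_prox_argmin[where uc = u0, OF f closed_UNIV convex_UNIV UNIV_not_empty H(2) linear_proj_on pos,
      folded F_def, folded u]
  show "is_arg_min F (\<lambda>_. True) v \<longleftrightarrow> v = u" by (rule m(1))
  have "0 \<le> (X + \<beta> *\<^sub>R dual_residual R \<Omega> (u, Q, V, W, G)) \<bullet> proj_on \<Omega> d + \<beta> * (H (u - u0) \<bullet> d)" for d
    using m(3)[of "u + d"] by (simp only: res) simp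
  from this[of d] this[of "- d"]
  show "(X + \<beta> *\<^sub>R dual_residual R \<Omega> (u, Q, V, W, G)) \<bullet> proj_on \<Omega> d + \<beta> * (H (u - u0) \<bullet> d) = 0"
    by simp
qed

lemma Q_step:
  fixes q q0 :: "real^'m" and H
  assumes G\<^sub>Q: "selfadjoint_psd G\<^sub>Q" "bij G\<^sub>Q" and H: "H = (\<lambda>q. G\<^sub>Q q - adjoint (A_op R) (A_op R q))" "selfadjoint_psd H"
    and VG: "0 \<le> V" "spectral_norm G \<le> 1"
  defines "F \<equiv> semi_prox \<beta> H (\<lambda>q. aug_lagrangian R L \<Omega> \<alpha> A \<beta> U q V W G X) q0"
  assumes q: "q = arg_min F (\<lambda>_. True)"
  shows "is_arg_min F (\<lambda>_. True) v \<longleftrightarrow> v = q"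
    and "- (L \<bullet> d) + (X + \<beta> *\<^sub>R dual_residual R \<Omega> (U, q, V, W, G)) \<bullet> A_op R d + \<beta> * (H (q - q0) \<bullet> d) = 0"
proof -
  define e where "e = proj_on \<Omega> U + V + W - G"
  have res: "dual_residual R \<Omega> (U, v, V, W, G) = A_op R v + e" for v
    by (simp add: dual_residual_def e_def)
  have f: "aug_lagrangian R L \<Omega> \<alpha> A \<beta> U v V W G X = (if v \<in> UNIV then
      ereal (1 / (4 * \<alpha>) * (norm (W - (2 * \<alpha>) *\<^sub>R A))\<^sup>2 + (- L) \<bullet> v + 0 / 2 * (norm (v - 0))\<^sup>2
        + X \<bullet> (A_op R v + e) + \<beta> / 2 * (norm (A_op R v + e))\<^sup>2) else \<infinity>)" for v
    using VG by (simp only: aug_lagrangian_eq res) (simp add: inner_commute)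
  have pos: "\<forall>d. d \<noteq> 0 \<longrightarrow> 0 < 0 * (d \<bullet> d) + \<beta> * (A_op R d \<bullet> A_op R d + d \<bullet> H d)"
  proof (intro allI impI)
    fix d :: "real^'m" assume that: "d \<noteq> 0"
    show "0 < 0 * (d \<bullet> d) + \<beta> * (A_op R d \<bullet> A_op R d + d \<bullet> H d)"
      using selfadjoint_psd_bij_pos[OF G\<^sub>Q that] beta
      by (simp add: H(1) A_op_inner adjoint_A_op inner_diff_right)
  qed
  note m = semi_prox_argmin[where uc = q0, OF f closed_UNIV convex_UNIV UNIV_not_empty H(2) linear_A_op pos,
      folded F_def, folded q]
  show "is_arg_min F (\<lambda>_. True) v \<longleftrightarrow> v = q" by (rule m(1))
  have "0 \<le> - (L \<bullet> d) + (X + \<beta> *\<^sub>R dual_residual R \<Omega> (U, q, V, W, G)) \<bullet> A_op R d + \<beta> * (H (q - q0) \<bullet> d)" for d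
    using m(3)[of "q + d"] by (simp only: res) simp
  from this[of d] this[of "- d"]
  show "- (L \<bullet> d) + (X + \<beta> *\<^sub>R dual_residual R \<Omega> (U, q, V, W, G)) \<bullet> A_op R d + \<beta> * (H (q - q0) \<bullet> d) = 0"
    by (simp add: linear_neg[OF linear_A_op])
qed

text \<open>The curvature comes from the quadratic term of the dual objective; its gradient is the
  first summand of the optimality equation.\<close>

lemma W_step:
  fixes w w0 :: "'s sqmat" and H
  assumes H: "selfadjoint_psd H" and \<alpha>: "0 < \<alpha>"
    and VG: "0 \<le> V" "spectral_norm G \<le> 1"
  defines "F \<equiv> semi_prox \<beta> H (\<lambda>w. aug_lagrangian R L \<Omega> \<alpha> A \<beta> U Q V w G X) w0"
  assumes w: "w = arg_min F (\<lambda>_. True)"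
  shows "is_arg_min F (\<lambda>_. True) v \<longleftrightarrow> v = w"
    and "1 / (2 * \<alpha>) * ((w - (2 * \<alpha>) *\<^sub>R A) \<bullet> d) + (X + \<beta> *\<^sub>R dual_residual R \<Omega> (U, Q, V, w, G)) \<bullet> d
           + \<beta> * (H (w - w0) \<bullet> d) = 0"
proof -
  define e where "e = proj_on \<Omega> U + V + A_op R Q - G"
  have res: "dual_residual R \<Omega> (U, Q, V, v, G) = v + e" for v
    by (simp add: dual_residual_def e_def)
  have f: "aug_lagrangian R L \<Omega> \<alpha> A \<beta> U Q V v G X = (if v \<in> UNIV then
      ereal (- (Q \<bullet> L) + 0 \<bullet> v + (1 / (2 * \<alpha>)) / 2 * (norm (v - (2 * \<alpha>) *\<^sub>R A))\<^sup>2
        + X \<bullet> (v + e) + \<beta> / 2 * (norm (v + e))\<^sup>2) else \<infinity>)" for v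
    using VG by (simp only: aug_lagrangian_eq res) simp
  have pos: "\<forall>d. d \<noteq> 0 \<longrightarrow> 0 < 1 / (2 * \<alpha>) * (d \<bullet> d) + \<beta> * (d \<bullet> d + d \<bullet> H d)"
  proof (intro allI impI)
    fix d :: "'s sqmat" assume that: "d \<noteq> 0"
    show "0 < 1 / (2 * \<alpha>) * (d \<bullet> d) + \<beta> * (d \<bullet> d + d \<bullet> H d)"
      using that \<alpha> beta selfadjoint_psdD(3)[OF H, of d] by (intro add_pos_nonneg) auto
  qed
  note m = semi_prox_argmin[where uc = w0 and T = "\<lambda>w. w", OF f closed_UNIV convex_UNIV UNIV_not_empty H linear_ident pos,
      folded F_def, folded w]
  show "is_arg_min F (\<lambda>_. True) v \<longleftrightarrow> v = w" by (rule m(1))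
  have "0 \<le> 1 / (2 * \<alpha>) * ((w - (2 * \<alpha>) *\<^sub>R A) \<bullet> d) + (X + \<beta> *\<^sub>R dual_residual R \<Omega> (U, Q, V, w, G)) \<bullet> d
           + \<beta> * (H (w - w0) \<bullet> d)" for d
    using m(3)[of "w + d"] by (simp only: res) simp
  from this[of d] this[of "- d"]
  show "1 / (2 * \<alpha>) * ((w - (2 * \<alpha>) *\<^sub>R A) \<bullet> d) + (X + \<beta> *\<^sub>R dual_residual R \<Omega> (U, Q, V, w, G)) \<bullet> d
           + \<beta> * (H (w - w0) \<bullet> d) = 0"
    by simp
qed

lemma V_step:
  fixes v v0 :: "'s sqmat" and H
  assumes G\<^sub>V: "selfadjoint_psd G\<^sub>V" "bij G\<^sub>V" and H: "H = (\<lambda>v. G\<^sub>V v - v)" "selfadjoint_psd H"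
    and G: "spectral_norm G \<le> 1"
  defines "F \<equiv> semi_prox \<beta> H (\<lambda>v. aug_lagrangian R L \<Omega> \<alpha> A \<beta> U Q v W G X) v0"
  assumes v: "v = arg_min F (\<lambda>_. True)"
  shows "is_arg_min F (\<lambda>_. True) v' \<longleftrightarrow> v' = v" and "0 \<le> v"
    and "0 \<le> v' \<Longrightarrow> 0 \<le> (X + \<beta> *\<^sub>R dual_residual R \<Omega> (U, Q, v, W, G)) \<bullet> (v' - v) + \<beta> * (H (v - v0) \<bullet> (v' - v))"
proof -
  let ?C = "{v :: 's sqmat. 0 \<le> v}"
  define e where "e = proj_on \<Omega> U + W + A_op R Q - G"
  have res: "dual_residual R \<Omega> (U, Q, v, W, G) = v + e" for v
    by (simp add: dual_residual_def e_def)
  have f: "aug_lagrangian R L \<Omega> \<alpha> A \<beta> U Q v W G X = (if v \<in> ?C then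
      ereal ((- (Q \<bullet> L) + 1 / (4 * \<alpha>) * (norm (W - (2 * \<alpha>) *\<^sub>R A))\<^sup>2) + 0 \<bullet> v + 0 / 2 * (norm (v - 0))\<^sup>2
        + X \<bullet> (v + e) + \<beta> / 2 * (norm (v + e))\<^sup>2) else \<infinity>)" for v
    using G by (simp only: aug_lagrangian_eq res) simp
  have pos: "\<forall>d. d \<noteq> 0 \<longrightarrow> 0 < 0 * (d \<bullet> d) + \<beta> * (d \<bullet> d + d \<bullet> H d)"
  proof (intro allI impI)
    fix d :: "'s sqmat" assume that: "d \<noteq> 0"
    show "0 < 0 * (d \<bullet> d) + \<beta> * (d \<bullet> d + d \<bullet> H d)"
      using selfadjoint_psd_bij_pos[OF G\<^sub>V that] beta by (simp add: H(1) inner_diff_right)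
  qed
  have conv: "convex ?C"
    by (auto simp: convex_def nonneg_matrix_iff inner_add_left)
  have ne: "?C \<noteq> {}" by blast
  note m = semi_prox_argmin[where uc = v0 and T = "\<lambda>v. v", OF f closed_nonneg_matrix conv ne H(2) linear_ident pos,
      folded F_def, folded v]
  show "is_arg_min F (\<lambda>_. True) v' \<longleftrightarrow> v' = v" by (rule m(1))
  show "0 \<le> v" using m(2) by simp
  show "0 \<le> (X + \<beta> *\<^sub>R dual_residual R \<Omega> (U, Q, v, W, G)) \<bullet> (v' - v) + \<beta> * (H (v - v0) \<bullet> (v' - v))" if "0 \<le> v'"
    using m(3)[of v'] that by (simp only: res) simp
qed

lemma G_step:
  fixes g g0 :: "'s sqmat" and H
  assumes G\<^sub>G: "selfadjoint_psd G\<^sub>G" "bij G\<^sub>G" and H: "H = (\<lambda>g. G\<^sub>G g - g)" "selfadjoint_psd H"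
    and V: "0 \<le> V"
  defines "F \<equiv> semi_prox \<beta> H (\<lambda>g. aug_lagrangian R L \<Omega> \<alpha> A \<beta> U Q V W g X) g0"
  assumes g: "g = arg_min F (\<lambda>_. True)"
  shows "is_arg_min F (\<lambda>_. True) g' \<longleftrightarrow> g' = g" and "spectral_norm g \<le> 1"
    and "spectral_norm g' \<le> 1 \<Longrightarrow>
      0 \<le> - ((X + \<beta> *\<^sub>R dual_residual R \<Omega> (U, Q, V, W, g)) \<bullet> (g' - g)) + \<beta> * (H (g - g0) \<bullet> (g' - g))"
proof -
  let ?C = "{g :: 's sqmat. spectral_norm g \<le> 1}"
  define e where "e = proj_on \<Omega> U + V + W + A_op R Q"
  have res: "dual_residual R \<Omega> (U, Q, V, W, g) = - g + e" for g
    by (simp add: dual_residual_def e_def)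
  have f: "aug_lagrangian R L \<Omega> \<alpha> A \<beta> U Q V W g X = (if g \<in> ?C then
      ereal ((- (Q \<bullet> L) + 1 / (4 * \<alpha>) * (norm (W - (2 * \<alpha>) *\<^sub>R A))\<^sup>2) + 0 \<bullet> g + 0 / 2 * (norm (g - 0))\<^sup>2
        + X \<bullet> (- g + e) + \<beta> / 2 * (norm (- g + e))\<^sup>2) else \<infinity>)" for g
    using V by (simp only: aug_lagrangian_eq res) simp
  have pos: "\<forall>d. d \<noteq> 0 \<longrightarrow> 0 < 0 * (d \<bullet> d) + \<beta> * (- d \<bullet> - d + d \<bullet> H d)"
  proof (intro allI impI)
    fix d :: "'s sqmat" assume that: "d \<noteq> 0"
    show "0 < 0 * (d \<bullet> d) + \<beta> * (- d \<bullet> - d + d \<bullet> H d)"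
      using selfadjoint_psd_bij_pos[OF G\<^sub>G that] beta by (simp add: H(1) inner_diff_right)
  qed
  have "(0 :: 's sqmat) \<in> ?C" by (simp add: spectral_norm_le_1_iff)
  then have ne: "?C \<noteq> {}" by blast
  have lin: "linear (\<lambda>g :: 's sqmat. - g)" by (rule linearI) simp_all
  note m = semi_prox_argmin[where uc = g0 and T = uminus, OF f spectral_ball_closed_convex ne H(2) lin pos,
      folded F_def, folded g]
  show "is_arg_min F (\<lambda>_. True) g' \<longleftrightarrow> g' = g" by (rule m(1))
  show "spectral_norm g \<le> 1" using m(2) by simp
  show "0 \<le> - ((X + \<beta> *\<^sub>R dual_residual R \<Omega> (U, Q, V, W, g)) \<bullet> (g' - g)) + \<beta> * (H (g - g0) \<bullet> (g' - g))"
    if "spectral_norm g' \<le> 1"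
    using m(3)[of g'] that by (simp only: res) (simp only: inner_minus_right inner_zero_left mult_zero_left add_0_left mem_Collect_eq)
qed

end

subsection \<open>Symmetric Gauss--Seidel sweeps as proximal steps\<close>

lemma psd_form_add:
  assumes "psd_form s" "psd_form t"
  shows "psd_form (\<lambda>x y. s x y + t x y)"
proof -
  interpret s: psd_form s by (rule assms(1))
  interpret t: psd_form t by (rule assms(2))
  show ?thesis
  proof
    show "bilinear (\<lambda>x y. s x y + t x y)"
      by (auto simp: bilinear_def s.add_left s.add_right s.scaleR_left s.scaleR_right
          t.add_left t.add_right t.scaleR_left t.scaleR_right distrib_left intro!: linearI)
    show "s x y + t x y = s y x + t y x" for x y by (simp only: s.sym[of x] t.sym[of x])
    show "0 \<le> s x x + t x x" for x by (intro add_nonneg_nonneg s.nonneg t.nonneg)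
  qed
qed

lemma psd_form_pullback:
  assumes "psd_form s" and f: "linear f"
  shows "psd_form (\<lambda>x y. s (f x) (f y))"
proof -
  interpret s: psd_form s by (rule assms(1))
  show ?thesis
  proof
    show "bilinear (\<lambda>x y. s (f x) (f y))"
      by (auto simp: bilinear_def s.add_left s.add_right s.scaleR_left s.scaleR_right
          linear_add[OF f] linear_scale[OF f] intro!: linearI)
    show "s (f x) (f y) = s (f y) (f x)" for x y by (rule s.sym)
    show "0 \<le> s (f x) (f x)" for x by (rule s.nonneg)
  qed
qed

text \<open>
  Eliminating the half iterates from a symmetric Gauss--Seidel sweep leaves a single proximal step
  whose weight is the following form: \<open>2 H\<^sub>U + P\<^sub>\<Omega> = \<G>\<^sub>U + H\<^sub>U\<close> recovers the increment of the
  second \<open>U\<close>-update from the joint increment, and \<open>2 H\<^sub>Q + \<A>\<^sup>*\<A>\<close> that of the second \<open>Q\<close>-update.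
\<close>

definition sGS_form_UQV ::
  "real^('s::finite \<times> 's)^'m::finite \<Rightarrow> ('s \<times> 's) set \<Rightarrow> ('s sqmat \<Rightarrow> 's sqmat) \<Rightarrow> (real^'m \<Rightarrow> real^'m)
   \<Rightarrow> ('s sqmat \<Rightarrow> 's sqmat) \<Rightarrow> 's sqmat \<times> (real^'m) \<times> 's sqmat \<Rightarrow> 's sqmat \<times> (real^'m) \<times> 's sqmat \<Rightarrow> real" where
  "sGS_form_UQV R \<Omega> H\<^sub>U H\<^sub>Q H\<^sub>V x y =
     (let b\<^sub>U = \<lambda>(u, q, v). H\<^sub>U u - proj_on \<Omega> (v + A_op R q);
          b\<^sub>Q = \<lambda>(u, q, v). H\<^sub>Q q - link_load R v
      in inv (\<lambda>u. H\<^sub>U u + H\<^sub>U u + proj_on \<Omega> u) (b\<^sub>U x) \<bullet> b\<^sub>U y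
         + inv (\<lambda>q. H\<^sub>Q q + H\<^sub>Q q + link_load R (A_op R q)) (b\<^sub>Q x) \<bullet> b\<^sub>Q y
         + H\<^sub>V (snd (snd x)) \<bullet> snd (snd y))"

text \<open>Subtracting the two conditions for the same block determines its last half increment
  from the joint increment, through an invertible operator. Inserting this into the conditions at
  the end of the sweep leaves no half iterate.\<close>

lemma sGS_sweep_UQV:
  fixes R :: "real^('s::finite \<times> 's)^'m::finite" and H\<^sub>U H\<^sub>V :: "'s sqmat \<Rightarrow> 's sqmat"
    and H\<^sub>Q :: "real^'m \<Rightarrow> real^'m" and U\<^sub>0 U\<^sub>h U\<^sub>1 V\<^sub>0 V\<^sub>1 W G X u v :: "'s sqmat" and Q\<^sub>0 Q\<^sub>h Q\<^sub>1 L q :: "real^'m"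
  assumes beta: "0 < \<beta>"
    and H: "selfadjoint_psd H\<^sub>U" "selfadjoint_psd H\<^sub>Q" "selfadjoint_psd H\<^sub>V"
    and posU: "\<forall>u. u \<noteq> 0 \<longrightarrow> 0 < u \<bullet> (H\<^sub>U u + proj_on \<Omega> u)"
    and posQ: "\<forall>q. q \<noteq> 0 \<longrightarrow> 0 < q \<bullet> (H\<^sub>Q q + link_load R (A_op R q))"
  defines "s \<equiv> sGS_form_UQV R \<Omega> H\<^sub>U H\<^sub>Q H\<^sub>V"
  shows "psd_form s"
    and "s (u, q, v) (u, q, v) = 0 \<Longrightarrow> proj_on \<Omega> u + v + A_op R q = 0 \<Longrightarrow> (u, q, v) = 0"
    and "(\<And>d. (X + \<beta> *\<^sub>R dual_residual R \<Omega> (U\<^sub>h, Q\<^sub>0, V\<^sub>0, W, G)) \<bullet> proj_on \<Omega> d + \<beta> * (H\<^sub>U (U\<^sub>h - U\<^sub>0) \<bullet> d) = 0)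
      \<Longrightarrow> (\<And>d. - (L \<bullet> d) + (X + \<beta> *\<^sub>R dual_residual R \<Omega> (U\<^sub>h, Q\<^sub>h, V\<^sub>0, W, G)) \<bullet> A_op R d + \<beta> * (H\<^sub>Q (Q\<^sub>h - Q\<^sub>0) \<bullet> d) = 0)
      \<Longrightarrow> 0 \<le> (X + \<beta> *\<^sub>R dual_residual R \<Omega> (U\<^sub>h, Q\<^sub>h, V\<^sub>1, W, G)) \<bullet> v + \<beta> * (H\<^sub>V (V\<^sub>1 - V\<^sub>0) \<bullet> v)
      \<Longrightarrow> (\<And>d. - (L \<bullet> d) + (X + \<beta> *\<^sub>R dual_residual R \<Omega> (U\<^sub>h, Q\<^sub>1, V\<^sub>1, W, G)) \<bullet> A_op R d + \<beta> * (H\<^sub>Q (Q\<^sub>1 - Q\<^sub>h) \<bullet> d) = 0)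
      \<Longrightarrow> (\<And>d. (X + \<beta> *\<^sub>R dual_residual R \<Omega> (U\<^sub>1, Q\<^sub>1, V\<^sub>1, W, G)) \<bullet> proj_on \<Omega> d + \<beta> * (H\<^sub>U (U\<^sub>1 - U\<^sub>h) \<bullet> d) = 0)
      \<Longrightarrow> 0 \<le> - (L \<bullet> q) + (X + \<beta> *\<^sub>R dual_residual R \<Omega> (U\<^sub>1, Q\<^sub>1, V\<^sub>1, W, G)) \<bullet> (proj_on \<Omega> u + v + A_op R q)
            + \<beta> * s (U\<^sub>1 - U\<^sub>0, Q\<^sub>1 - Q\<^sub>0, V\<^sub>1 - V\<^sub>0) (u, q, v)"
proof -
  let ?P = "proj_on \<Omega>" and ?A = "A_op R" and ?B = "link_load R"
  note lin = selfadjoint_psdD(1)[OF H(1)] selfadjoint_psdD(1)[OF H(2)] selfadjoint_psdD(1)[OF H(3)]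
    linear_A_op[of R] linear_link_load[of R]
  note simps = lin[THEN linear_add] lin[THEN linear_diff] lin[THEN linear_scale] lin[THEN linear_0]
  note sym = selfadjoint_psdD(2)[OF H(1)] selfadjoint_psdD(2)[OF H(2)] selfadjoint_psdD(2)[OF H(3)]
  define M\<^sub>U where "M\<^sub>U u = H\<^sub>U u + H\<^sub>U u + ?P u" for u
  define M\<^sub>Q where "M\<^sub>Q q = H\<^sub>Q q + H\<^sub>Q q + ?B (?A q)" for q
  have BA: "?B (?A p) \<bullet> q = ?A p \<bullet> ?A q" for p q
    by (metis A_op_inner inner_commute)
  define K\<^sub>U where "K\<^sub>U = inv M\<^sub>U"
  define K\<^sub>Q where "K\<^sub>Q = inv M\<^sub>Q"
  have linU: "linear M\<^sub>U" by (rule linearI) (simp_all add: M\<^sub>U_def simps algebra_simps)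
  have symU: "M\<^sub>U x \<bullet> y = x \<bullet> M\<^sub>U y" for x y
    by (simp only: M\<^sub>U_def inner_add_left inner_add_right sym(1) proj_on_inner)
  have "0 < x \<bullet> M\<^sub>U x" if "x \<noteq> 0" for x
    using posU[rule_format, OF that] selfadjoint_psdD(3)[OF H(1), of x] unfolding M\<^sub>U_def inner_add_right by linarith
  then have "\<forall>x. x \<noteq> 0 \<longrightarrow> 0 < x \<bullet> M\<^sub>U x" by blast
  note K\<^sub>U = selfadjoint_posdef_inv[OF linU symU this, folded K\<^sub>U_def]
  have linQ: "linear M\<^sub>Q" by (rule linearI) (simp_all add: M\<^sub>Q_def simps algebra_simps)
  have symQ: "M\<^sub>Q x \<bullet> y = x \<bullet> M\<^sub>Q y" for x y
    by (simp only: M\<^sub>Q_def inner_add_left inner_add_right sym(2) BA inner_commute[of x "?B _"] inner_commute[of "?A x"])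
  have "0 < x \<bullet> M\<^sub>Q x" if "x \<noteq> 0" for x
    using posQ[rule_format, OF that] selfadjoint_psdD(3)[OF H(2), of x] unfolding M\<^sub>Q_def inner_add_right by linarith
  then have "\<forall>x. x \<noteq> 0 \<longrightarrow> 0 < x \<bullet> M\<^sub>Q x" by blast
  note K\<^sub>Q = selfadjoint_posdef_inv[OF linQ symQ this, folded K\<^sub>Q_def]
  define b\<^sub>U where "b\<^sub>U = (\<lambda>(u, q, v). H\<^sub>U u - ?P (v + ?A q))"
  define b\<^sub>Q where "b\<^sub>Q = (\<lambda>(u :: 's sqmat, q, v). H\<^sub>Q q - ?B v)"
  have s_eq: "s x y = K\<^sub>U (b\<^sub>U x) \<bullet> b\<^sub>U y + K\<^sub>Q (b\<^sub>Q x) \<bullet> b\<^sub>Q y + H\<^sub>V (snd (snd x)) \<bullet> snd (snd y)" for x y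
    by (simp only: s_def sGS_form_UQV_def Let_def K\<^sub>U_def K\<^sub>Q_def M\<^sub>U_def[abs_def] M\<^sub>Q_def[abs_def] b\<^sub>U_def b\<^sub>Q_def)
  have linb: "linear b\<^sub>U" "linear b\<^sub>Q" "linear (\<lambda>x :: 's sqmat \<times> (real^'m) \<times> 's sqmat. snd (snd x))"
    by (rule linearI; auto simp: b\<^sub>U_def b\<^sub>Q_def simps algebra_simps)+
  have "psd_form (\<lambda>x y. K\<^sub>U (b\<^sub>U x) \<bullet> b\<^sub>U y + K\<^sub>Q (b\<^sub>Q x) \<bullet> b\<^sub>Q y + H\<^sub>V (snd (snd x)) \<bullet> snd (snd y))"
    by (intro psd_form_add psd_form_pullback[OF K\<^sub>U(2) linb(1)] psd_form_pullback[OF K\<^sub>Q(2) linb(2)]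
        psd_form_pullback[OF selfadjoint_psd_form[OF H(3)] linb(3)])
  then show "psd_form s" by (simp only: s_eq[abs_def])
  show "(u, q, v) = 0" if s0: "s (u, q, v) (u, q, v) = 0" and r0: "?P u + v + ?A q = 0"
  proof -
    have "K\<^sub>U (b\<^sub>U (u, q, v)) \<bullet> b\<^sub>U (u, q, v) = 0" "K\<^sub>Q (b\<^sub>Q (u, q, v)) \<bullet> b\<^sub>Q (u, q, v) = 0"
      using s0 psd_form.nonneg[OF K\<^sub>U(2), of "b\<^sub>U (u, q, v)"] psd_form.nonneg[OF K\<^sub>Q(2), of "b\<^sub>Q (u, q, v)"]
        selfadjoint_psdD(3)[OF H(3), of v]
      by (auto simp: s_eq inner_commute[of v])
    then have "b\<^sub>U (u, q, v) = 0" "b\<^sub>Q (u, q, v) = 0"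
      by (simp_all only: K\<^sub>U(3) K\<^sub>Q(3))
    then have b: "H\<^sub>U u = ?P (v + ?A q)" "H\<^sub>Q q = ?B v"
      by (simp_all add: b\<^sub>U_def b\<^sub>Q_def)
    \<comment> \<open>Projecting the residual equation and inserting \<open>H\<^sub>U u\<close>
      makes \<open>H\<^sub>U + P\<close> vanish at \<open>u\<close>; then \<open>v = - A q\<close>,
      and the same argument applies to \<open>q\<close>.\<close>
    have "?P (?P u + v + ?A q) = 0" by (simp only: r0 proj_on_simps)
    then have "H\<^sub>U u + ?P u = 0" by (simp add: b algebra_simps)
    then have u: "u = 0" using posU[rule_format, of u] by auto
    then have v: "v = - ?A q" using r0 by (simp add: add_eq_0_iff2)
    then have "H\<^sub>Q q + ?B (?A q) = 0" using b(2) by (simp add: linear_neg[OF linear_link_load])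
    then have "q = 0" using posQ[rule_format, of q] by auto
    with u v show "(u, q, v) = 0" by (simp add: simps zero_prod_def)
  qed
  let ?r = "dual_residual R \<Omega>"
  show "0 \<le> - (L \<bullet> q) + (X + \<beta> *\<^sub>R ?r (U\<^sub>1, Q\<^sub>1, V\<^sub>1, W, G)) \<bullet> (?P u + v + ?A q)
            + \<beta> * s (U\<^sub>1 - U\<^sub>0, Q\<^sub>1 - Q\<^sub>0, V\<^sub>1 - V\<^sub>0) (u, q, v)"
    if U1: "\<And>d. (X + \<beta> *\<^sub>R ?r (U\<^sub>h, Q\<^sub>0, V\<^sub>0, W, G)) \<bullet> ?P d + \<beta> * (H\<^sub>U (U\<^sub>h - U\<^sub>0) \<bullet> d) = 0"
      and Q1: "\<And>d. - (L \<bullet> d) + (X + \<beta> *\<^sub>R ?r (U\<^sub>h, Q\<^sub>h, V\<^sub>0, W, G)) \<bullet> ?A d + \<beta> * (H\<^sub>Q (Q\<^sub>h - Q\<^sub>0) \<bullet> d) = 0"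
      and V: "0 \<le> (X + \<beta> *\<^sub>R ?r (U\<^sub>h, Q\<^sub>h, V\<^sub>1, W, G)) \<bullet> v + \<beta> * (H\<^sub>V (V\<^sub>1 - V\<^sub>0) \<bullet> v)"
      and Q2: "\<And>d. - (L \<bullet> d) + (X + \<beta> *\<^sub>R ?r (U\<^sub>h, Q\<^sub>1, V\<^sub>1, W, G)) \<bullet> ?A d + \<beta> * (H\<^sub>Q (Q\<^sub>1 - Q\<^sub>h) \<bullet> d) = 0"
      and U2: "\<And>d. (X + \<beta> *\<^sub>R ?r (U\<^sub>1, Q\<^sub>1, V\<^sub>1, W, G)) \<bullet> ?P d + \<beta> * (H\<^sub>U (U\<^sub>1 - U\<^sub>h) \<bullet> d) = 0"
  proof -
    define a where "a = U\<^sub>1 - U\<^sub>h"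
    define c where "c = Q\<^sub>1 - Q\<^sub>h"
    define \<Delta> where "\<Delta> = (U\<^sub>1 - U\<^sub>0, Q\<^sub>1 - Q\<^sub>0, V\<^sub>1 - V\<^sub>0)"
    define Y where "Y = X + \<beta> *\<^sub>R ?r (U\<^sub>1, Q\<^sub>1, V\<^sub>1, W, G)"
    have a: "K\<^sub>U (b\<^sub>U \<Delta>) = a"
    proof -
      have "M\<^sub>U a - b\<^sub>U \<Delta> = 0"
      proof (rule vector_eq_rdot[THEN iffD1], rule allI)
        fix d
        have "?r (U\<^sub>1, Q\<^sub>1, V\<^sub>1, W, G) - ?r (U\<^sub>h, Q\<^sub>0, V\<^sub>0, W, G) = ?P a + ((V\<^sub>1 - V\<^sub>0) + ?A (Q\<^sub>1 - Q\<^sub>0))"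
          by (simp add: dual_residual_def a_def simps)
        moreover have "\<beta> * ((?r (U\<^sub>1, Q\<^sub>1, V\<^sub>1, W, G) - ?r (U\<^sub>h, Q\<^sub>0, V\<^sub>0, W, G)) \<bullet> ?P d
            + (H\<^sub>U (U\<^sub>1 - U\<^sub>h) - H\<^sub>U (U\<^sub>h - U\<^sub>0)) \<bullet> d) = 0"
          using U1[of d] U2[of d] by (simp add: inner_add_left inner_diff_left algebra_simps)
        ultimately have "(?P a + ((V\<^sub>1 - V\<^sub>0) + ?A (Q\<^sub>1 - Q\<^sub>0))) \<bullet> ?P d + (H\<^sub>U (U\<^sub>1 - U\<^sub>h) - H\<^sub>U (U\<^sub>h - U\<^sub>0)) \<bullet> d = 0"
          using beta by simp
        moreover have "H\<^sub>U (U\<^sub>1 - U\<^sub>h) - H\<^sub>U (U\<^sub>h - U\<^sub>0) = H\<^sub>U a + H\<^sub>U a - H\<^sub>U (U\<^sub>1 - U\<^sub>0)"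
          by (simp add: a_def simps)
        moreover have "x \<bullet> ?P d = ?P x \<bullet> d" for x by (rule proj_on_inner[symmetric])
        ultimately have "(?P (?P a + ((V\<^sub>1 - V\<^sub>0) + ?A (Q\<^sub>1 - Q\<^sub>0))) + (H\<^sub>U a + H\<^sub>U a - H\<^sub>U (U\<^sub>1 - U\<^sub>0))) \<bullet> d = 0"
          by (simp only: inner_add_left)
        also have "?P (?P a + ((V\<^sub>1 - V\<^sub>0) + ?A (Q\<^sub>1 - Q\<^sub>0))) + (H\<^sub>U a + H\<^sub>U a - H\<^sub>U (U\<^sub>1 - U\<^sub>0)) = M\<^sub>U a - b\<^sub>U \<Delta>"
          by (simp add: M\<^sub>U_def b\<^sub>U_def \<Delta>_def algebra_simps)
        finally show "(M\<^sub>U a - b\<^sub>U \<Delta>) \<bullet> d = 0 \<bullet> d" by simp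
      qed
      then have "b\<^sub>U \<Delta> = M\<^sub>U a" by simp
      then show ?thesis by (simp only: K\<^sub>U(1))
    qed
    have c: "K\<^sub>Q (b\<^sub>Q \<Delta>) = c"
    proof -
      have "M\<^sub>Q c - b\<^sub>Q \<Delta> = 0"
      proof (rule vector_eq_rdot[THEN iffD1], rule allI)
        fix d
        have "?r (U\<^sub>h, Q\<^sub>1, V\<^sub>1, W, G) - ?r (U\<^sub>h, Q\<^sub>h, V\<^sub>0, W, G) = (V\<^sub>1 - V\<^sub>0) + ?A c"
          by (simp add: dual_residual_def c_def simps)
        moreover have "\<beta> * ((?r (U\<^sub>h, Q\<^sub>1, V\<^sub>1, W, G) - ?r (U\<^sub>h, Q\<^sub>h, V\<^sub>0, W, G)) \<bullet> ?A d
            + (H\<^sub>Q (Q\<^sub>1 - Q\<^sub>h) - H\<^sub>Q (Q\<^sub>h - Q\<^sub>0)) \<bullet> d) = 0"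
          using Q1[of d] Q2[of d] by (simp add: inner_add_left inner_diff_left algebra_simps)
        ultimately have "((V\<^sub>1 - V\<^sub>0) + ?A c) \<bullet> ?A d + (H\<^sub>Q (Q\<^sub>1 - Q\<^sub>h) - H\<^sub>Q (Q\<^sub>h - Q\<^sub>0)) \<bullet> d = 0"
          using beta by simp
        moreover have "H\<^sub>Q (Q\<^sub>1 - Q\<^sub>h) - H\<^sub>Q (Q\<^sub>h - Q\<^sub>0) = H\<^sub>Q c + H\<^sub>Q c - H\<^sub>Q (Q\<^sub>1 - Q\<^sub>0)"
          by (simp add: c_def simps)
        moreover have "x \<bullet> ?A d = ?B x \<bullet> d" for x by (metis A_op_inner inner_commute)
        ultimately have "(?B ((V\<^sub>1 - V\<^sub>0) + ?A c) + (H\<^sub>Q c + H\<^sub>Q c - H\<^sub>Q (Q\<^sub>1 - Q\<^sub>0))) \<bullet> d = 0"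
          by (simp only: inner_add_left)
        also have "?B ((V\<^sub>1 - V\<^sub>0) + ?A c) + (H\<^sub>Q c + H\<^sub>Q c - H\<^sub>Q (Q\<^sub>1 - Q\<^sub>0)) = M\<^sub>Q c - b\<^sub>Q \<Delta>"
          by (simp add: M\<^sub>Q_def b\<^sub>Q_def \<Delta>_def simps algebra_simps)
        finally show "(M\<^sub>Q c - b\<^sub>Q \<Delta>) \<bullet> d = 0 \<bullet> d" by simp
      qed
      then have "b\<^sub>Q \<Delta> = M\<^sub>Q c" by simp
      then show ?thesis by (simp only: K\<^sub>Q(1))
    qed
    \<comment> \<open>Moved to the increments by symmetry, the cross terms of the form are precisely
      the changes of residual between the half iterates and the end of the sweep. The three
      conditions below therefore add up exactly.\<close>
    have "s \<Delta> (u, q, v) = a \<bullet> (H\<^sub>U u - ?P (v + ?A q)) + c \<bullet> (H\<^sub>Q q - ?B v) + H\<^sub>V (V\<^sub>1 - V\<^sub>0) \<bullet> v"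
      by (simp only: s_eq a c) (simp add: b\<^sub>U_def b\<^sub>Q_def \<Delta>_def)
    also have "\<dots> = H\<^sub>U a \<bullet> u - ?P a \<bullet> v - ?P a \<bullet> ?A q + H\<^sub>Q c \<bullet> q - ?A c \<bullet> v + H\<^sub>V (V\<^sub>1 - V\<^sub>0) \<bullet> v"
      by (simp only: inner_diff_right sym proj_on_inner[symmetric] A_op_inner inner_add_right)
    finally have s: "s \<Delta> (u, q, v) = H\<^sub>U a \<bullet> u - ?P a \<bullet> v - ?P a \<bullet> ?A q + H\<^sub>Q c \<bullet> q - ?A c \<bullet> v + H\<^sub>V (V\<^sub>1 - V\<^sub>0) \<bullet> v" .
    have 1: "Y \<bullet> ?P u + \<beta> * (H\<^sub>U a \<bullet> u) = 0"
      using U2[of u] by (simp only: Y_def a_def)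
    have "X + \<beta> *\<^sub>R ?r (U\<^sub>h, Q\<^sub>1, V\<^sub>1, W, G) = Y - \<beta> *\<^sub>R ?P a"
      by (simp add: Y_def dual_residual_def a_def algebra_simps)
    then have 2: "- (L \<bullet> q) + (Y \<bullet> ?A q - \<beta> * (?P a \<bullet> ?A q)) + \<beta> * (H\<^sub>Q c \<bullet> q) = 0"
      using Q2[of q] by (simp only: c_def inner_diff_left inner_scaleR_left)
    have "X + \<beta> *\<^sub>R ?r (U\<^sub>h, Q\<^sub>h, V\<^sub>1, W, G) = Y - \<beta> *\<^sub>R ?P a - \<beta> *\<^sub>R ?A c"
      by (simp add: Y_def dual_residual_def a_def c_def simps algebra_simps)
    then have 3: "0 \<le> (Y \<bullet> v - \<beta> * (?P a \<bullet> v) - \<beta> * (?A c \<bullet> v)) + \<beta> * (H\<^sub>V (V\<^sub>1 - V\<^sub>0) \<bullet> v)"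
      using V by (simp only: inner_diff_left inner_scaleR_left)
    have "0 \<le> - (L \<bullet> q) + Y \<bullet> (?P u + v + ?A q) + \<beta> * s \<Delta> (u, q, v)"
      unfolding s inner_add_right using 1 2 3 by (simp add: algebra_simps)
    then show "0 \<le> - (L \<bullet> q) + (X + \<beta> *\<^sub>R ?r (U\<^sub>1, Q\<^sub>1, V\<^sub>1, W, G)) \<bullet> (?P u + v + ?A q)
            + \<beta> * s (U\<^sub>1 - U\<^sub>0, Q\<^sub>1 - Q\<^sub>0, V\<^sub>1 - V\<^sub>0) (u, q, v)"
      by (simp only: Y_def \<Delta>_def)
  qed
qed

text \<open>The inverted operator recovers the last half increment of \<open>W\<close> from the
  joint increment: the 1 stems from the residual, \<open>1 / (2 * \<alpha> * \<beta>)\<close> from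
  the Hessian of the dual objective divided by \<open>\<beta>\<close>. The plus sign in
  \<open>b\<close> reflects that \<open>G\<close> enters the residual negatively.\<close>

definition sGS_form_WG ::
  "real \<Rightarrow> real \<Rightarrow> ('a::real_inner \<Rightarrow> 'a) \<Rightarrow> ('a \<Rightarrow> 'a) \<Rightarrow> 'a \<times> 'a \<Rightarrow> 'a \<times> 'a \<Rightarrow> real" where
  "sGS_form_WG \<alpha> \<beta> H\<^sub>W H\<^sub>G x y =
     (let b = \<lambda>(w, g). H\<^sub>W w + g
      in inv (\<lambda>w. H\<^sub>W w + H\<^sub>W w + (1 + 1 / (2 * \<alpha> * \<beta>)) *\<^sub>R w) (b x) \<bullet> b y + H\<^sub>G (snd x) \<bullet> snd y)"

text \<open>The elimination is the same as for the other block, with \<open>G\<close> updated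
  between the two \<open>W\<close> steps. For definiteness, \<open>w = g\<close> and a vanishing
  form give \<open>H\<^sub>W w + w = 0\<close>, which forces \<open>w = 0\<close>.\<close>

lemma sGS_sweep_WG:
  fixes R :: "real^('s::finite \<times> 's)^'m::finite" and H\<^sub>W H\<^sub>G :: "'s sqmat \<Rightarrow> 's sqmat"
    and W\<^sub>0 W\<^sub>h W\<^sub>1 G\<^sub>0 G\<^sub>1 A U V X w g :: "'s sqmat" and Q :: "real^'m"
  assumes beta: "0 < \<beta>" and \<alpha>: "0 < \<alpha>"
    and H: "selfadjoint_psd H\<^sub>W" "selfadjoint_psd H\<^sub>G"
  defines "t \<equiv> sGS_form_WG \<alpha> \<beta> H\<^sub>W H\<^sub>G"
  shows "psd_form t"
    and "t (w, g) (w, g) = 0 \<Longrightarrow> w - g = 0 \<Longrightarrow> (w, g) = 0"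
    and "(\<And>d. 1 / (2 * \<alpha>) * ((W\<^sub>h - (2 * \<alpha>) *\<^sub>R A) \<bullet> d) + (X + \<beta> *\<^sub>R dual_residual R \<Omega> (U, Q, V, W\<^sub>h, G\<^sub>0)) \<bullet> d
           + \<beta> * (H\<^sub>W (W\<^sub>h - W\<^sub>0) \<bullet> d) = 0)
      \<Longrightarrow> 0 \<le> - ((X + \<beta> *\<^sub>R dual_residual R \<Omega> (U, Q, V, W\<^sub>h, G\<^sub>1)) \<bullet> g) + \<beta> * (H\<^sub>G (G\<^sub>1 - G\<^sub>0) \<bullet> g)
      \<Longrightarrow> (\<And>d. 1 / (2 * \<alpha>) * ((W\<^sub>1 - (2 * \<alpha>) *\<^sub>R A) \<bullet> d) + (X + \<beta> *\<^sub>R dual_residual R \<Omega> (U, Q, V, W\<^sub>1, G\<^sub>1)) \<bullet> d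
           + \<beta> * (H\<^sub>W (W\<^sub>1 - W\<^sub>h) \<bullet> d) = 0)
      \<Longrightarrow> 0 \<le> 1 / (2 * \<alpha>) * ((W\<^sub>1 - (2 * \<alpha>) *\<^sub>R A) \<bullet> w)
            + (X + \<beta> *\<^sub>R dual_residual R \<Omega> (U, Q, V, W\<^sub>1, G\<^sub>1)) \<bullet> (w - g)
            + \<beta> * t (W\<^sub>1 - W\<^sub>0, G\<^sub>1 - G\<^sub>0) (w, g)"
proof -
  note lin = selfadjoint_psdD(1)[OF H(1)] selfadjoint_psdD(1)[OF H(2)]
  note simps = lin[THEN linear_add] lin[THEN linear_diff] lin[THEN linear_scale] lin[THEN linear_0]
  define \<kappa> where "\<kappa> = 1 + 1 / (2 * \<alpha> * \<beta>)"
  have \<kappa>: "0 < \<kappa>" "\<beta> * \<kappa> = \<beta> + 1 / (2 * \<alpha>)"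
    using \<alpha> beta by (simp_all add: \<kappa>_def add_pos_pos field_simps)
  define M where "M w = H\<^sub>W w + H\<^sub>W w + \<kappa> *\<^sub>R w" for w
  define K where "K = inv M"
  have linM: "linear M" by (rule linearI) (simp_all add: M_def simps algebra_simps)
  have symM: "M x \<bullet> y = x \<bullet> M y" for x y
    by (simp only: M_def inner_add_left inner_add_right inner_scaleR_left inner_scaleR_right selfadjoint_psdD(2)[OF H(1)])
  have "0 < x \<bullet> M x" if "x \<noteq> 0" for x
  proof -
    have "0 < \<kappa> * (x \<bullet> x)" using \<kappa>(1) that by simp
    then show ?thesis
      using selfadjoint_psdD(3)[OF H(1), of x] unfolding M_def inner_add_right inner_scaleR_right by linarith
  qed
  then have "\<forall>x. x \<noteq> 0 \<longrightarrow> 0 < x \<bullet> M x" by blast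
  note K = selfadjoint_posdef_inv[OF linM symM this, folded K_def]
  define b where "b = (\<lambda>(w, g). H\<^sub>W w + g)"
  have t_eq: "t x y = K (b x) \<bullet> b y + H\<^sub>G (snd x) \<bullet> snd y" for x y
    by (simp only: t_def sGS_form_WG_def Let_def K_def M_def[abs_def] \<kappa>_def b_def)
  have linb: "linear b" "linear (snd :: 's sqmat \<times> 's sqmat \<Rightarrow> _)"
    by (rule linearI; auto simp: b_def simps algebra_simps)+
  have "psd_form (\<lambda>x y. K (b x) \<bullet> b y + H\<^sub>G (snd x) \<bullet> snd y)"
    by (intro psd_form_add psd_form_pullback[OF K(2) linb(1)]
        psd_form_pullback[OF selfadjoint_psd_form[OF H(2)] linb(2)])
  then show "psd_form t" by (simp only: t_eq[abs_def])
  show "(w, g) = 0" if t0: "t (w, g) (w, g) = 0" and "w - g = 0"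
  proof -
    have g: "g = w" using that(2) by simp
    have "K (b (w, g)) \<bullet> b (w, g) = 0"
      using t0 psd_form.nonneg[OF K(2), of "b (w, g)"] selfadjoint_psdD(3)[OF H(2), of g]
      by (auto simp: t_eq inner_commute[of g])
    then have "b (w, g) = 0" by (rule K(3))
    then have "H\<^sub>W w + w = 0" using g by (simp add: b_def)
    then have "w \<bullet> H\<^sub>W w + w \<bullet> w = 0" by (metis inner_add_right inner_zero_right)
    moreover have "0 \<le> w \<bullet> H\<^sub>W w" by (rule selfadjoint_psdD(3)[OF H(1)])
    moreover have "0 \<le> w \<bullet> w" by simp
    ultimately have "w \<bullet> w = 0" by linarith
    then show "(w, g) = 0" using g by (simp add: zero_prod_def)
  qed
  let ?r = "dual_residual R \<Omega>"
  show "0 \<le> 1 / (2 * \<alpha>) * ((W\<^sub>1 - (2 * \<alpha>) *\<^sub>R A) \<bullet> w)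
            + (X + \<beta> *\<^sub>R ?r (U, Q, V, W\<^sub>1, G\<^sub>1)) \<bullet> (w - g)
            + \<beta> * t (W\<^sub>1 - W\<^sub>0, G\<^sub>1 - G\<^sub>0) (w, g)"
    if W1: "\<And>d. 1 / (2 * \<alpha>) * ((W\<^sub>h - (2 * \<alpha>) *\<^sub>R A) \<bullet> d) + (X + \<beta> *\<^sub>R ?r (U, Q, V, W\<^sub>h, G\<^sub>0)) \<bullet> d
           + \<beta> * (H\<^sub>W (W\<^sub>h - W\<^sub>0) \<bullet> d) = 0"
      and G: "0 \<le> - ((X + \<beta> *\<^sub>R ?r (U, Q, V, W\<^sub>h, G\<^sub>1)) \<bullet> g) + \<beta> * (H\<^sub>G (G\<^sub>1 - G\<^sub>0) \<bullet> g)"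
      and W2: "\<And>d. 1 / (2 * \<alpha>) * ((W\<^sub>1 - (2 * \<alpha>) *\<^sub>R A) \<bullet> d) + (X + \<beta> *\<^sub>R ?r (U, Q, V, W\<^sub>1, G\<^sub>1)) \<bullet> d
           + \<beta> * (H\<^sub>W (W\<^sub>1 - W\<^sub>h) \<bullet> d) = 0"
  proof -
    define D where "D = W\<^sub>1 - W\<^sub>h"
    define \<Delta> where "\<Delta> = (W\<^sub>1 - W\<^sub>0, G\<^sub>1 - G\<^sub>0)"
    define Y where "Y = X + \<beta> *\<^sub>R ?r (U, Q, V, W\<^sub>1, G\<^sub>1)"
    have D: "K (b \<Delta>) = D"
    proof -
      have "M D - b \<Delta> = 0"
      proof (rule vector_eq_rdot[THEN iffD1], rule allI)
        fix d
        have X1: "X + \<beta> *\<^sub>R ?r (U, Q, V, W\<^sub>h, G\<^sub>0) = Y - \<beta> *\<^sub>R (D - (G\<^sub>1 - G\<^sub>0))"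
          by (simp add: Y_def dual_residual_def D_def algebra_simps)
        have Wh: "W\<^sub>h - (2 * \<alpha>) *\<^sub>R A = (W\<^sub>1 - (2 * \<alpha>) *\<^sub>R A) - D" by (simp add: D_def)
        have Hh: "H\<^sub>W (W\<^sub>h - W\<^sub>0) = H\<^sub>W (W\<^sub>1 - W\<^sub>0) - H\<^sub>W D" by (simp add: D_def simps)
        have w1: "1 / (2 * \<alpha>) * ((W\<^sub>1 - (2 * \<alpha>) *\<^sub>R A) \<bullet> d - D \<bullet> d) + (Y \<bullet> d - \<beta> * (D \<bullet> d - (G\<^sub>1 - G\<^sub>0) \<bullet> d))
            + \<beta> * (H\<^sub>W (W\<^sub>1 - W\<^sub>0) \<bullet> d - H\<^sub>W D \<bullet> d) = 0"
          using W1[of d] unfolding X1 Wh Hh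
          by (simp only: inner_diff_left[of "W\<^sub>1 - (2 * \<alpha>) *\<^sub>R A"] inner_diff_left[of Y]
              inner_diff_left[of D] inner_diff_left[of "H\<^sub>W _"] inner_scaleR_left)
        have w2: "1 / (2 * \<alpha>) * ((W\<^sub>1 - (2 * \<alpha>) *\<^sub>R A) \<bullet> d) + Y \<bullet> d + \<beta> * (H\<^sub>W D \<bullet> d) = 0"
          using W2[of d] by (simp only: Y_def D_def)
        have "1 / (2 * \<alpha>) * (D \<bullet> d) + \<beta> * (D \<bullet> d) + \<beta> * (2 * (H\<^sub>W D \<bullet> d) - (G\<^sub>1 - G\<^sub>0) \<bullet> d - H\<^sub>W (W\<^sub>1 - W\<^sub>0) \<bullet> d) = 0"
          using w1 w2 by (simp add: right_diff_distrib)
        then have "\<beta> * (\<kappa> * (D \<bullet> d) + 2 * (H\<^sub>W D \<bullet> d) - (G\<^sub>1 - G\<^sub>0) \<bullet> d - H\<^sub>W (W\<^sub>1 - W\<^sub>0) \<bullet> d) = 0"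
          using \<kappa>(2) by (simp add: right_diff_distrib distrib_left distrib_right mult.assoc[symmetric])
        then have "\<kappa> * (D \<bullet> d) + 2 * (H\<^sub>W D \<bullet> d) - (G\<^sub>1 - G\<^sub>0) \<bullet> d - H\<^sub>W (W\<^sub>1 - W\<^sub>0) \<bullet> d = 0"
          using beta by simp
        moreover have "(M D - b \<Delta>) \<bullet> d = \<kappa> * (D \<bullet> d) + 2 * (H\<^sub>W D \<bullet> d) - (G\<^sub>1 - G\<^sub>0) \<bullet> d - H\<^sub>W (W\<^sub>1 - W\<^sub>0) \<bullet> d"
          unfolding M_def b_def \<Delta>_def split_conv inner_add_left inner_diff_left inner_scaleR_left by linarith
        ultimately show "(M D - b \<Delta>) \<bullet> d = 0 \<bullet> d" by simp
      qed
      then have "b \<Delta> = M D" by simp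
      then show ?thesis by (simp only: K(1))
    qed
    have t: "t \<Delta> (w, g) = H\<^sub>W D \<bullet> w + D \<bullet> g + H\<^sub>G (G\<^sub>1 - G\<^sub>0) \<bullet> g"
      by (simp only: t_eq D) (simp add: b_def \<Delta>_def inner_add_right selfadjoint_psdD(2)[OF H(1)])
    have 1: "1 / (2 * \<alpha>) * ((W\<^sub>1 - (2 * \<alpha>) *\<^sub>R A) \<bullet> w) + Y \<bullet> w + \<beta> * (H\<^sub>W D \<bullet> w) = 0"
      using W2[of w] by (simp only: Y_def D_def)
    have "X + \<beta> *\<^sub>R ?r (U, Q, V, W\<^sub>h, G\<^sub>1) = Y - \<beta> *\<^sub>R D"
      by (simp add: Y_def dual_residual_def D_def algebra_simps)
    then have 2: "0 \<le> - (Y \<bullet> g - \<beta> * (D \<bullet> g)) + \<beta> * (H\<^sub>G (G\<^sub>1 - G\<^sub>0) \<bullet> g)"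
      using G by (simp only: inner_diff_left inner_scaleR_left)
    have "0 \<le> 1 / (2 * \<alpha>) * ((W\<^sub>1 - (2 * \<alpha>) *\<^sub>R A) \<bullet> w) + Y \<bullet> (w - g) + \<beta> * t \<Delta> (w, g)"
      unfolding t inner_diff_right[of Y] using 1 2 by (simp add: distrib_left)
    then show "0 \<le> 1 / (2 * \<alpha>) * ((W\<^sub>1 - (2 * \<alpha>) *\<^sub>R A) \<bullet> w)
            + (X + \<beta> *\<^sub>R ?r (U, Q, V, W\<^sub>1, G\<^sub>1)) \<bullet> (w - g)
            + \<beta> * t (W\<^sub>1 - W\<^sub>0, G\<^sub>1 - G\<^sub>0) (w, g)"
      by (simp only: Y_def \<Delta>_def)
  qed
qed

subsection \<open>Convergence of SCB-spADMM\<close>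

text \<open>Bridges the gradient in the condition of the \<open>W\<close> step and the objective
  difference demanded by the abstract scheme.\<close>

lemma quadratic_above_tangent:
  fixes w a w' :: "'a::real_inner"
  assumes "0 < \<alpha>"
  shows "1 / (2 * \<alpha>) * ((w - a) \<bullet> (w' - w)) \<le> 1 / (4 * \<alpha>) * (norm (w' - a))\<^sup>2 - 1 / (4 * \<alpha>) * (norm (w - a))\<^sup>2"
proof -
  have "(norm (w' - a))\<^sup>2 = (norm (w - a))\<^sup>2 + 2 * ((w - a) \<bullet> (w' - w)) + (norm (w' - w))\<^sup>2"
    unfolding power2_norm_eq_inner by (simp add: inner_diff_left inner_diff_right inner_commute)
  then have "1 / (4 * \<alpha>) * (norm (w' - a))\<^sup>2
      = 1 / (4 * \<alpha>) * (norm (w - a))\<^sup>2 + 1 / (2 * \<alpha>) * ((w - a) \<bullet> (w' - w)) + 1 / (4 * \<alpha>) * (norm (w' - w))\<^sup>2"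
    using assms by (simp add: field_simps)
  then show ?thesis using assms by simp
qed

text \<open>With the next lemma, this translates between the matrix conditions and the abstract KKT
  condition of the two-block scheme. Testing against \<open>X\<close> removes \<open>U\<close> and
  cancels the load term; complementarity, norm duality and convexity give the signs.\<close>

lemma kkt_point_variational:
  assumes "kkt_point R L \<Omega> \<alpha> A (U, Q, V, W, G) X" and \<alpha>: "0 < \<alpha>"
  shows "0 \<le> V' \<Longrightarrow> 0 \<le> - (Q' \<bullet> L) - - (Q \<bullet> L) + X \<bullet> (proj_on \<Omega> (U' - U) + (V' - V) + A_op R (Q' - Q))"
    and "spectral_norm G' \<le> 1 \<Longrightarrow>
      0 \<le> 1 / (4 * \<alpha>) * (norm (W' - (2 * \<alpha>) *\<^sub>R A))\<^sup>2 - 1 / (4 * \<alpha>) * (norm (W - (2 * \<alpha>) *\<^sub>R A))\<^sup>2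
        + X \<bullet> ((W' - W) - (G' - G))"
proof -
  have k: "0 \<le> X" "proj_on \<Omega> X = 0" "link_load R X = L" "V \<bullet> X = 0" "G \<bullet> X = nuclear_norm X"
    "W = (2 * \<alpha>) *\<^sub>R (A - X)"
    using assms(1) by (auto simp: kkt_point_def traffic_set_def)
  show "0 \<le> - (Q' \<bullet> L) - - (Q \<bullet> L) + X \<bullet> (proj_on \<Omega> (U' - U) + (V' - V) + A_op R (Q' - Q))" if "0 \<le> V'"
  proof -
    have "X \<bullet> proj_on \<Omega> (U' - U) = 0"
      by (simp only: proj_on_inner[symmetric] k(2) inner_zero_left)
    moreover have "X \<bullet> (V' - V) = V' \<bullet> X"
      using k(4) by (simp only: inner_commute[of X] inner_diff_left)
    moreover have "X \<bullet> A_op R (Q' - Q) = Q' \<bullet> L - Q \<bullet> L"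
      by (simp only: inner_commute[of X] A_op_inner k(3) inner_diff_left)
    ultimately show ?thesis
      using inner_nonneg_matrix[OF that k(1)] by (simp only: inner_add_right)
  qed
  show "0 \<le> 1 / (4 * \<alpha>) * (norm (W' - (2 * \<alpha>) *\<^sub>R A))\<^sup>2 - 1 / (4 * \<alpha>) * (norm (W - (2 * \<alpha>) *\<^sub>R A))\<^sup>2
        + X \<bullet> ((W' - W) - (G' - G))" if G': "spectral_norm G' \<le> 1"
  proof -
    have "W - (2 * \<alpha>) *\<^sub>R A = - ((2 * \<alpha>) *\<^sub>R X)" by (simp add: k(6) algebra_simps)
    then have "1 / (2 * \<alpha>) * ((W - (2 * \<alpha>) *\<^sub>R A) \<bullet> (W' - W)) = - (X \<bullet> (W' - W))"
      using \<alpha> by simp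
    moreover have "X \<bullet> (G' - G) \<le> 0"
      using inner_le_nuclear_norm[OF G', of X] k(5) by (simp only: inner_commute[of X] inner_diff_left)
    ultimately show ?thesis
      using quadratic_above_tangent[OF \<alpha>, of W "(2 * \<alpha>) *\<^sub>R A" W']
      unfolding inner_diff_right[of X "W' - W"] by linarith
  qed
qed

text \<open>Each condition is read off from one test point: shifting \<open>U\<close> by
  \<open>- X\<close>, \<open>Q\<close> by the load defect with a minus sign, \<open>V\<close> by a
  basis matrix; then \<open>V' = 0\<close> for complementarity, a maximizer of the pairing with
  \<open>X\<close> for \<open>G'\<close>, and the stationary point of the quadratic term for
  \<open>W'\<close>.\<close>

lemma kkt_pointI_variational:
  assumes feas: "proj_on \<Omega> U + V + W + A_op R Q = G" and V: "0 \<le> V" and G: "spectral_norm G \<le> 1" and \<alpha>: "0 < \<alpha>"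
    and first: "\<And>U' Q' V'. 0 \<le> V' \<Longrightarrow>
      0 \<le> - (Q' \<bullet> L) - - (Q \<bullet> L) + X \<bullet> (proj_on \<Omega> (U' - U) + (V' - V) + A_op R (Q' - Q))"
    and second: "\<And>W' G'. spectral_norm G' \<le> 1 \<Longrightarrow>
      0 \<le> 1 / (4 * \<alpha>) * (norm (W' - (2 * \<alpha>) *\<^sub>R A))\<^sup>2 - 1 / (4 * \<alpha>) * (norm (W - (2 * \<alpha>) *\<^sub>R A))\<^sup>2
        + X \<bullet> ((W' - W) - (G' - G))"
  shows "kkt_point R L \<Omega> \<alpha> A (U, Q, V, W, G) X"
proof -
  have lA: "A_op R 0 = 0" by (rule linear_0[OF linear_A_op])
  have "proj_on \<Omega> X \<bullet> proj_on \<Omega> X = X \<bullet> proj_on \<Omega> X" by (simp add: proj_on_inner)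
  also have "\<dots> \<le> 0" using first[OF V, of Q "U - X"] by (simp add: lA)
  finally have PX: "proj_on \<Omega> X = 0"
    by (metis inner_ge_zero inner_eq_zero_iff order_antisym)
  have load: "link_load R X = L"
  proof -
    let ?d = "link_load R X - L"
    have "0 \<le> - ((Q - ?d) \<bullet> L) + Q \<bullet> L + X \<bullet> A_op R (- ?d)"
      using first[OF V, of "Q - ?d" U] by simp
    also have "\<dots> = - (?d \<bullet> ?d)"
      by (simp only: inner_commute[of X] A_op_inner) (simp add: inner_diff_left inner_diff_right)
    finally have "?d \<bullet> ?d = 0" by (metis inner_ge_zero neg_0_le_iff_le order_antisym)
    then show ?thesis by simp
  qed
  have nn: "0 \<le> X"
  proof -
    have "0 \<le> X \<bullet> b" if "b \<in> Basis" for b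
    proof -
      have "0 \<le> V + b" using V that by (auto simp: nonneg_matrix_iff inner_add_left inner_Basis)
      from first[OF this, of Q U] show ?thesis by (simp add: lA)
    qed
    then show ?thesis by (simp add: nonneg_matrix_iff)
  qed
  have VX: "V \<bullet> X = 0"
    using first[of 0 Q U] inner_nonneg_matrix[OF V nn] by (simp add: lA inner_commute)
  have GX: "G \<bullet> X = nuclear_norm X"
  proof -
    obtain G' where G': "spectral_norm G' \<le> 1" "G' \<bullet> X = nuclear_norm X" by (rule nuclear_norm_attained)
    have "0 \<le> X \<bullet> ((W - W) - (G' - G))" using second[OF G'(1), of W] by simp
    then have "G' \<bullet> X \<le> G \<bullet> X" by (simp add: inner_diff_right inner_commute)
    then show ?thesis using G'(2) inner_le_nuclear_norm[OF G, of X] by simp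
  qed
  have W: "W = (2 * \<alpha>) *\<^sub>R (A - X)"
  proof -
    define W' where "W' = (2 * \<alpha>) *\<^sub>R (A - X)"
    have W': "W' - (2 * \<alpha>) *\<^sub>R A = - ((2 * \<alpha>) *\<^sub>R X)" by (simp add: W'_def algebra_simps)
    \<comment> \<open>Expansion around the minimizer \<open>W'\<close> of the quadratic term plus
      the pairing with \<open>X\<close>: the excess of \<open>W\<close> is a multiple of the squared
      distance and cannot be positive.\<close>
    have "(norm (W - (2 * \<alpha>) *\<^sub>R A))\<^sup>2 = (norm ((W' - (2 * \<alpha>) *\<^sub>R A) + (W - W')))\<^sup>2" by simp
    also have "\<dots> = (norm (W' - (2 * \<alpha>) *\<^sub>R A))\<^sup>2 - 4 * \<alpha> * (X \<bullet> (W - W')) + (norm (W - W'))\<^sup>2"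
      unfolding W' power2_norm_eq_inner
      by (simp only: inner_add_left inner_add_right inner_commute[of "W - W'" "- _"]) simp
    finally have "1 / (4 * \<alpha>) * (norm (W - (2 * \<alpha>) *\<^sub>R A))\<^sup>2
        = 1 / (4 * \<alpha>) * (norm (W' - (2 * \<alpha>) *\<^sub>R A))\<^sup>2 - X \<bullet> (W - W') + 1 / (4 * \<alpha>) * (norm (W - W'))\<^sup>2"
      using \<alpha> by (simp add: right_diff_distrib distrib_left)
    moreover have "0 \<le> 1 / (4 * \<alpha>) * (norm (W' - (2 * \<alpha>) *\<^sub>R A))\<^sup>2 - 1 / (4 * \<alpha>) * (norm (W - (2 * \<alpha>) *\<^sub>R A))\<^sup>2
        + X \<bullet> (W' - W)"
      using second[OF G, of W'] by simp
    moreover have "X \<bullet> (W' - W) = - (X \<bullet> (W - W'))" by (simp add: inner_diff_right)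
    ultimately have "1 / (4 * \<alpha>) * (norm (W - W'))\<^sup>2 \<le> 0" by linarith
    then have "norm (W - W') = 0" using \<alpha> by (simp add: divide_le_0_iff)
    then show ?thesis by (simp add: W'_def)
  qed
  show ?thesis
    unfolding kkt_point_def traffic_set_def using nn PX load V VX G GX W feas by simp
qed

theorem theorem3p1:
  fixes R :: "real^('s::finite \<times> 's)^'m::finite"
    and L :: "real^'m"
    and \<Omega> :: "('s \<times> 's) set"
    and \<rho>\<^sub>1 \<rho>\<^sub>2 \<alpha> \<beta> \<tau> :: real
    and Xbar Xhat A :: "'s sqmat"
    and G\<^sub>U G\<^sub>V G\<^sub>W G\<^sub>G H\<^sub>U H\<^sub>V H\<^sub>W H\<^sub>G :: "'s sqmat \<Rightarrow> 's sqmat"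
    and G\<^sub>Q H\<^sub>Q :: "real^'m \<Rightarrow> real^'m"
    and U Uh V W Wh G X :: "nat \<Rightarrow> 's sqmat"
    and Q Qh :: "nat \<Rightarrow> real^'m"
  defines "\<alpha> \<equiv> \<rho>\<^sub>1 + \<rho>\<^sub>2"
    and "A \<equiv> (1 / (\<rho>\<^sub>1 + \<rho>\<^sub>2)) *\<^sub>R (\<rho>\<^sub>1 *\<^sub>R Xbar + \<rho>\<^sub>2 *\<^sub>R Xhat)"
    and "H\<^sub>U \<equiv> \<lambda>u. G\<^sub>U u - proj_on \<Omega> u"
    and "H\<^sub>Q \<equiv> \<lambda>q. G\<^sub>Q q - adjoint (A_op R) (A_op R q)"
    and "H\<^sub>W \<equiv> \<lambda>w. G\<^sub>W w - (1 / \<beta> + 1) *\<^sub>R w"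
    and "H\<^sub>V \<equiv> \<lambda>v. G\<^sub>V v - v"
    and "H\<^sub>G \<equiv> \<lambda>g. G\<^sub>G g - g"
    and "L\<^sub>\<beta> \<equiv> aug_lagrangian R L \<Omega> \<alpha> A \<beta>"
  defines "objU\<^sub>1 \<equiv> \<lambda>k. semi_prox \<beta> H\<^sub>U (\<lambda>u. L\<^sub>\<beta> u (Q k) (V k) (W k) (G k) (X k)) (U k)"
    and "objQ\<^sub>1 \<equiv> \<lambda>k. semi_prox \<beta> H\<^sub>Q (\<lambda>q. L\<^sub>\<beta> (Uh k) q (V k) (W k) (G k) (X k)) (Q k)"
    and "objV \<equiv> \<lambda>k. semi_prox \<beta> H\<^sub>V (\<lambda>v. L\<^sub>\<beta> (Uh k) (Qh k) v (W k) (G k) (X k)) (V k)"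
    and "objQ\<^sub>2 \<equiv> \<lambda>k. semi_prox \<beta> H\<^sub>Q
           (\<lambda>q. L\<^sub>\<beta> (Uh k) q (V (Suc k)) (W k) (G k) (X k)) (Qh k)"
    and "objU\<^sub>2 \<equiv> \<lambda>k. semi_prox \<beta> H\<^sub>U
           (\<lambda>u. L\<^sub>\<beta> u (Q (Suc k)) (V (Suc k)) (W k) (G k) (X k)) (Uh k)"
    and "objW\<^sub>1 \<equiv> \<lambda>k. semi_prox \<beta> H\<^sub>W
           (\<lambda>w. L\<^sub>\<beta> (U (Suc k)) (Q (Suc k)) (V (Suc k)) w (G k) (X k)) (W k)"
    and "objG \<equiv> \<lambda>k. semi_prox \<beta> H\<^sub>G
           (\<lambda>g. L\<^sub>\<beta> (U (Suc k)) (Q (Suc k)) (V (Suc k)) (Wh k) g (X k)) (G k)"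
    and "objW\<^sub>2 \<equiv> \<lambda>k. semi_prox \<beta> H\<^sub>W
           (\<lambda>w. L\<^sub>\<beta> (U (Suc k)) (Q (Suc k)) (V (Suc k)) w (G (Suc k)) (X k)) (Wh k)"
    and "\<Gamma> \<equiv> \<lambda>k. dual_residual R \<Omega> (U k, Q k, V k, W k, G k)"
    and "z \<equiv> \<lambda>k. (U k, Q k, W k, V k, G k, X k)"
  assumes R01: "\<forall>i c. R $ i $ c \<in> {0, 1}"
    and rho: "\<rho>\<^sub>1 > 0" "\<rho>\<^sub>2 > 0"
    and traffic: "\<exists>T. 0 \<le> T \<and> proj_on \<Omega> T = 0 \<and> link_load R T = L"
    and G_psd: "selfadjoint_psd G\<^sub>U" "selfadjoint_psd G\<^sub>Q" "selfadjoint_psd G\<^sub>W"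
      "selfadjoint_psd G\<^sub>V" "selfadjoint_psd G\<^sub>G"
    and G_inv: "bij G\<^sub>U" "bij G\<^sub>Q" "bij G\<^sub>W" "bij G\<^sub>V" "bij G\<^sub>G"
    and H_psd: "selfadjoint_psd H\<^sub>U" "selfadjoint_psd H\<^sub>Q" "selfadjoint_psd H\<^sub>W"
      "selfadjoint_psd H\<^sub>V" "selfadjoint_psd H\<^sub>G"
    and beta: "\<beta> > 0"
    and tau: "\<tau> > 0"
    and init: "U 0 = 0" "Q 0 = 0" "V 0 = 0" "W 0 = 0" "G 0 = 0" "X 0 = 0"
    and iterU\<^sub>1: "\<And>k. Uh k = arg_min (objU\<^sub>1 k) (\<lambda>_. True)"
    and iterQ\<^sub>1: "\<And>k. Qh k = arg_min (objQ\<^sub>1 k) (\<lambda>_. True)"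
    and iterV: "\<And>k. V (Suc k) = arg_min (objV k) (\<lambda>_. True)"
    and iterQ\<^sub>2: "\<And>k. Q (Suc k) = arg_min (objQ\<^sub>2 k) (\<lambda>_. True)"
    and iterU\<^sub>2: "\<And>k. U (Suc k) = arg_min (objU\<^sub>2 k) (\<lambda>_. True)"
    and iterW\<^sub>1: "\<And>k. Wh k = arg_min (objW\<^sub>1 k) (\<lambda>_. True)"
    and iterG: "\<And>k. G (Suc k) = arg_min (objG k) (\<lambda>_. True)"
    and iterW\<^sub>2: "\<And>k. W (Suc k) = arg_min (objW\<^sub>2 k) (\<lambda>_. True)"
    and iterX: "\<And>k. X (Suc k) = X k + (\<tau> * \<beta>) *\<^sub>R \<Gamma> (Suc k)"
    and step: "\<tau> \<in> {0<..<(sqrt 5 + 1) / 2} \<or>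
      (\<tau> \<ge> (sqrt 5 + 1) / 2 \<and>
       summable (\<lambda>k. (norm ((G (Suc k) - G k) + (W (Suc k) - W k)))\<^sup>2
                      + 1 / \<tau> * (norm (\<Gamma> (Suc k)))\<^sup>2))"
  shows
    "(\<forall>k. (\<forall>u. is_arg_min (objU\<^sub>1 k) (\<lambda>_. True) u \<longleftrightarrow> u = Uh k)
        \<and> (\<forall>q. is_arg_min (objQ\<^sub>1 k) (\<lambda>_. True) q \<longleftrightarrow> q = Qh k)
        \<and> (\<forall>v. is_arg_min (objV k) (\<lambda>_. True) v \<longleftrightarrow> v = V (Suc k))
        \<and> (\<forall>q. is_arg_min (objQ\<^sub>2 k) (\<lambda>_. True) q \<longleftrightarrow> q = Q (Suc k))
        \<and> (\<forall>u. is_arg_min (objU\<^sub>2 k) (\<lambda>_. True) u \<longleftrightarrow> u = U (Suc k))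
        \<and> (\<forall>w. is_arg_min (objW\<^sub>1 k) (\<lambda>_. True) w \<longleftrightarrow> w = Wh k)
        \<and> (\<forall>g. is_arg_min (objG k) (\<lambda>_. True) g \<longleftrightarrow> g = G (Suc k))
        \<and> (\<forall>w. is_arg_min (objW\<^sub>2 k) (\<lambda>_. True) w \<longleftrightarrow> w = W (Suc k)))
     \<and> (\<exists>Uinf Qinf Winf Vinf Ginf Xinf.
          (\<lambda>k. z (Suc k)) \<longlonglongrightarrow> (Uinf, Qinf, Winf, Vinf, Ginf, Xinf)
        \<and> (\<forall>p. (\<exists>r. strict_mono r \<and> ((\<lambda>k. z (Suc k)) \<circ> r) \<longlonglongrightarrow> p)
                 \<longleftrightarrow> p = (Uinf, Qinf, Winf, Vinf, Ginf, Xinf))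
        \<and> dual_optimal R L \<Omega> \<alpha> A (Uinf, Qinf, Vinf, Winf, Ginf)
        \<and> primal_optimal R L \<Omega> \<alpha> A Xinf)"
proof -
  have \<alpha>: "0 < \<alpha>" using rho by (simp add: \<alpha>_def)
  note H\<^sub>U_eq = H\<^sub>U_def[THEN meta_eq_to_obj_eq] and H\<^sub>Q_eq = H\<^sub>Q_def[THEN meta_eq_to_obj_eq]
    and H\<^sub>V_eq = H\<^sub>V_def[THEN meta_eq_to_obj_eq] and H\<^sub>G_eq = H\<^sub>G_def[THEN meta_eq_to_obj_eq]
  \<comment> \<open>The other blocks must stay feasible, since otherwise the augmented Lagrangian is
    infinite and a subproblem does not determine its iterate. The zero start satisfies this at index
    0; the \<open>V\<close> step needs the old \<open>G\<close>, the \<open>G\<close> step the new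
    \<open>V\<close>.\<close>
  have inv: "0 \<le> V k \<and> spectral_norm (G k) \<le> 1" for k
  proof (induction k)
    case 0
    show ?case by (simp add: init spectral_norm_le_1_iff)
  next
    case (Suc k)
    have V: "0 \<le> V (Suc k)"
      by (rule V_step(2)[OF beta G_psd(4) G_inv(4) H\<^sub>V_eq H_psd(4) conjunct2[OF Suc] iterV[unfolded objV_def L\<^sub>\<beta>_def]])
    have "spectral_norm (G (Suc k)) \<le> 1"
      by (rule G_step(2)[OF beta G_psd(5) G_inv(5) H\<^sub>G_eq H_psd(5) V iterG[unfolded objG_def L\<^sub>\<beta>_def]])
    with V show ?case by simp
  qed
  then have V0: "0 \<le> V k" and G0: "spectral_norm (G k) \<le> 1" for k by blast+

  note U1 = U_step[OF beta G_psd(1) G_inv(1) H\<^sub>U_eq H_psd(1) V0 G0 iterU\<^sub>1[unfolded objU\<^sub>1_def L\<^sub>\<beta>_def]]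
  note Q1 = Q_step[OF beta G_psd(2) G_inv(2) H\<^sub>Q_eq H_psd(2) V0 G0 iterQ\<^sub>1[unfolded objQ\<^sub>1_def L\<^sub>\<beta>_def]]
  note V1 = V_step[OF beta G_psd(4) G_inv(4) H\<^sub>V_eq H_psd(4) G0 iterV[unfolded objV_def L\<^sub>\<beta>_def]]
  note Q2 = Q_step[OF beta G_psd(2) G_inv(2) H\<^sub>Q_eq H_psd(2) V0 G0 iterQ\<^sub>2[unfolded objQ\<^sub>2_def L\<^sub>\<beta>_def]]
  note U2 = U_step[OF beta G_psd(1) G_inv(1) H\<^sub>U_eq H_psd(1) V0 G0 iterU\<^sub>2[unfolded objU\<^sub>2_def L\<^sub>\<beta>_def]]
  note W1 = W_step[OF beta H_psd(3) \<alpha> V0 G0 iterW\<^sub>1[unfolded objW\<^sub>1_def L\<^sub>\<beta>_def]]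
  note G1 = G_step[OF beta G_psd(5) G_inv(5) H\<^sub>G_eq H_psd(5) V0 iterG[unfolded objG_def L\<^sub>\<beta>_def]]
  note W2 = W_step[OF beta H_psd(3) \<alpha> V0 G0 iterW\<^sub>2[unfolded objW\<^sub>2_def L\<^sub>\<beta>_def]]

  have well_defined: "\<forall>k. (\<forall>u. is_arg_min (objU\<^sub>1 k) (\<lambda>_. True) u \<longleftrightarrow> u = Uh k)
        \<and> (\<forall>q. is_arg_min (objQ\<^sub>1 k) (\<lambda>_. True) q \<longleftrightarrow> q = Qh k)
        \<and> (\<forall>v. is_arg_min (objV k) (\<lambda>_. True) v \<longleftrightarrow> v = V (Suc k))
        \<and> (\<forall>q. is_arg_min (objQ\<^sub>2 k) (\<lambda>_. True) q \<longleftrightarrow> q = Q (Suc k))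
        \<and> (\<forall>u. is_arg_min (objU\<^sub>2 k) (\<lambda>_. True) u \<longleftrightarrow> u = U (Suc k))
        \<and> (\<forall>w. is_arg_min (objW\<^sub>1 k) (\<lambda>_. True) w \<longleftrightarrow> w = Wh k)
        \<and> (\<forall>g. is_arg_min (objG k) (\<lambda>_. True) g \<longleftrightarrow> g = G (Suc k))
        \<and> (\<forall>w. is_arg_min (objW\<^sub>2 k) (\<lambda>_. True) w \<longleftrightarrow> w = W (Suc k))"
    unfolding objU\<^sub>1_def objQ\<^sub>1_def objV_def objQ\<^sub>2_def objU\<^sub>2_def objW\<^sub>1_def objG_def objW\<^sub>2_def L\<^sub>\<beta>_def
    by (intro allI conjI U1(1) Q1(1) V1(1) Q2(1) U2(1) W1(1) G1(1) W2(1))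

  \<comment> \<open>The correction subtracted in \<open>H\<^sub>U\<close> is added back, so these
    are the operators \<open>G\<^sub>U\<close> and, in the next fact, \<open>G\<^sub>Q\<close>,
    which are definite because they are semidefinite and invertible.\<close>
  have posU: "\<forall>u. u \<noteq> 0 \<longrightarrow> 0 < u \<bullet> (H\<^sub>U u + proj_on \<Omega> u)"
    using selfadjoint_psd_bij_pos[OF G_psd(1) G_inv(1)] by (simp add: H\<^sub>U_def)
  have posQ: "\<forall>q. q \<noteq> 0 \<longrightarrow> 0 < q \<bullet> (H\<^sub>Q q + link_load R (A_op R q))"
    using selfadjoint_psd_bij_pos[OF G_psd(2) G_inv(2)] by (simp add: H\<^sub>Q_def adjoint_A_op)
  define s where "s = sGS_form_UQV R \<Omega> H\<^sub>U H\<^sub>Q H\<^sub>V"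
  define t where "t = sGS_form_WG \<alpha> \<beta> H\<^sub>W H\<^sub>G"
  note s = sGS_sweep_UQV[OF beta H_psd(1,2,4) posU posQ, folded s_def]
  note t = sGS_sweep_WG[OF beta \<alpha> H_psd(3,5), folded t_def]

  define f where "f = (\<lambda>(u :: 's sqmat, q, v :: 's sqmat). - (q \<bullet> L))"
  define h where "h = (\<lambda>(w, g :: 's sqmat). 1 / (4 * \<alpha>) * (norm (w - (2 * \<alpha>) *\<^sub>R A))\<^sup>2)"
  define Cy :: "('s sqmat \<times> (real^'m) \<times> 's sqmat) set" where "Cy = UNIV \<times> UNIV \<times> {v. 0 \<le> v}"
  define Cz :: "('s sqmat \<times> 's sqmat) set" where "Cz = UNIV \<times> {g. spectral_norm g \<le> 1}"
  define a where "a = (\<lambda>(u, q, v). proj_on \<Omega> u + v + A_op R q)"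
  define b where "b = (\<lambda>(w, g). w - g :: 's sqmat)"
  define y where "y k = (U k, Q k, V k)" for k
  define w where "w k = (W k, G k)" for k
  have ab: "a (u, q, v) + b (w, g) = dual_residual R \<Omega> (u, q, v, w, g)" for u q v w g
    by (simp add: a_def b_def dual_residual_def)
  have lin_a: "linear a"
    by (rule linearI) (auto simp: a_def linear_add[OF linear_A_op] linear_scale[OF linear_A_op] algebra_simps)
  have lin_b: "linear b"
    by (rule linearI) (auto simp: b_def algebra_simps)

  interpret sp_admm s t f h Cy Cz a b \<beta> \<tau> y w X
  proof (intro sp_admm.intro s(1) t(1) sp_admm_axioms.intro lin_a lin_b beta tau)
    show "continuous_on UNIV f" "continuous_on UNIV h"
      unfolding f_def h_def case_prod_beta by (intro continuous_intros)+
    show "closed Cy" "closed Cz"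
      unfolding Cy_def Cz_def
      by (intro closed_Times closed_UNIV closed_nonneg_matrix spectral_ball_closed_convex)+
    show "v = 0" if "s v v = 0" "a v = 0" for v
      using that s(2) by (cases v) (simp add: a_def)
    show "v = 0" if "t v v = 0" "b v = 0" for v
      using that t(2) by (cases v) (simp add: b_def)
    show "y (Suc k) \<in> Cy" "w (Suc k) \<in> Cz" for k
      by (simp_all add: y_def w_def Cy_def Cz_def V0 G0)
    show "X (Suc k) = X k + (\<tau> * \<beta>) *\<^sub>R (a (y (Suc k)) + b (w (Suc k)))" for k
      by (simp only: y_def w_def ab iterX \<Gamma>_def)
    show "0 \<le> f v - f (y (Suc k)) + (X k + \<beta> *\<^sub>R (a (y (Suc k)) + b (w k))) \<bullet> a (v - y (Suc k))
          + \<beta> * s (y (Suc k) - y k) (v - y (Suc k))" if v: "v \<in> Cy" for k v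
    proof -
      obtain u' q' v' where v': "v = (u', q', v')" "0 \<le> v'" using v by (auto simp: Cy_def)
      have "0 \<le> - (L \<bullet> (q' - Q (Suc k)))
          + (X k + \<beta> *\<^sub>R dual_residual R \<Omega> (U (Suc k), Q (Suc k), V (Suc k), W k, G k))
             \<bullet> (proj_on \<Omega> (u' - U (Suc k)) + (v' - V (Suc k)) + A_op R (q' - Q (Suc k)))
          + \<beta> * s (U (Suc k) - U k, Q (Suc k) - Q k, V (Suc k) - V k) (u' - U (Suc k), q' - Q (Suc k), v' - V (Suc k))"
        by (rule s(3)[OF U1(2) Q1(2) V1(3)[OF v'(2)] Q2(2) U2(2)])
      moreover have "f v - f (y (Suc k)) = - (L \<bullet> (q' - Q (Suc k)))"
        by (simp add: f_def y_def v' inner_diff_right inner_commute)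
      moreover have "a (v - y (Suc k)) = proj_on \<Omega> (u' - U (Suc k)) + (v' - V (Suc k)) + A_op R (q' - Q (Suc k))"
        by (simp add: a_def y_def v')
      ultimately show ?thesis
        by (simp only: y_def w_def ab v'(1) diff_Pair)
    qed
    show "0 \<le> h v - h (w (Suc k)) + (X k + \<beta> *\<^sub>R (a (y (Suc k)) + b (w (Suc k)))) \<bullet> b (v - w (Suc k))
          + \<beta> * t (w (Suc k) - w k) (v - w (Suc k))" if v: "v \<in> Cz" for k v
    proof -
      obtain w' g' where v': "v = (w', g')" "spectral_norm g' \<le> 1" using v by (auto simp: Cz_def)
      have "0 \<le> 1 / (2 * \<alpha>) * ((W (Suc k) - (2 * \<alpha>) *\<^sub>R A) \<bullet> (w' - W (Suc k)))
          + (X k + \<beta> *\<^sub>R dual_residual R \<Omega> (U (Suc k), Q (Suc k), V (Suc k), W (Suc k), G (Suc k)))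
             \<bullet> ((w' - W (Suc k)) - (g' - G (Suc k)))
          + \<beta> * t (W (Suc k) - W k, G (Suc k) - G k) (w' - W (Suc k), g' - G (Suc k))"
        by (rule t(3)[OF W1(2) G1(3)[OF v'(2)] W2(2)])
      \<comment> \<open>The sweep supplies the gradient of the quadratic term; convexity replaces it
        by the objective difference.\<close>
      moreover have "1 / (2 * \<alpha>) * ((W (Suc k) - (2 * \<alpha>) *\<^sub>R A) \<bullet> (w' - W (Suc k))) \<le> h v - h (w (Suc k))"
        using quadratic_above_tangent[OF \<alpha>, of "W (Suc k)" "(2 * \<alpha>) *\<^sub>R A" w']
        by (simp only: h_def w_def v'(1) split_conv)
      moreover have "b (v - w (Suc k)) = (w' - W (Suc k)) - (g' - G (Suc k))"
        by (simp add: b_def w_def v')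
      ultimately have "0 \<le> h v - h (w (Suc k))
          + (X k + \<beta> *\<^sub>R dual_residual R \<Omega> (U (Suc k), Q (Suc k), V (Suc k), W (Suc k), G (Suc k))) \<bullet> b (v - w (Suc k))
          + \<beta> * t (W (Suc k) - W k, G (Suc k) - G k) (w' - W (Suc k), g' - G (Suc k))"
        by (simp only:)
      then show ?thesis
        by (simp only: y_def w_def ab v'(1) diff_Pair)
    qed
    show "\<tau> < (1 + sqrt 5) / 2 \<or> summable (\<lambda>k. (norm (a (y (Suc k)) + b (w (Suc k))))\<^sup>2)"
      using step
    proof
      assume "\<tau> \<in> {0<..<(sqrt 5 + 1) / 2}"
      then show ?thesis by (simp add: add.commute)
    next
      assume "\<tau> \<ge> (sqrt 5 + 1) / 2 \<and> summable (\<lambda>k. (norm ((G (Suc k) - G k) + (W (Suc k) - W k)))\<^sup>2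
                      + 1 / \<tau> * (norm (\<Gamma> (Suc k)))\<^sup>2)"
      \<comment> \<open>Multiplication by \<open>\<tau>\<close> cancels the weight
        \<open>1 / \<tau>\<close>, so the rescaled series dominates the squared residuals.\<close>
      then have "summable (\<lambda>k. \<tau> * ((norm ((G (Suc k) - G k) + (W (Suc k) - W k)))\<^sup>2
                      + 1 / \<tau> * (norm (\<Gamma> (Suc k)))\<^sup>2))"
        by (intro summable_mult) simp
      then have "summable (\<lambda>k. (norm (\<Gamma> (Suc k)))\<^sup>2)"
      proof (rule summable_comparison_test'[where N = 0])
        show "norm ((norm (\<Gamma> (Suc k)))\<^sup>2) \<le> \<tau> * ((norm ((G (Suc k) - G k) + (W (Suc k) - W k)))\<^sup>2
                      + 1 / \<tau> * (norm (\<Gamma> (Suc k)))\<^sup>2)" for k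
          using tau by (simp add: distrib_left)
      qed
      then show ?thesis by (simp only: y_def w_def ab \<Gamma>_def) simp
    qed
  qed

  obtain U\<^sub>0 Q\<^sub>0 W\<^sub>0 V\<^sub>0 G\<^sub>0 X\<^sub>0 where k0: "kkt_point R L \<Omega> \<alpha> A (U\<^sub>0, Q\<^sub>0, V\<^sub>0, W\<^sub>0, G\<^sub>0) X\<^sub>0"
  proof -
    obtain T where "T \<in> traffic_set R L \<Omega>" using traffic by (auto simp: traffic_set_def)
    from kkt_point_exists[OF this \<alpha>] that show thesis by metis
  qed
  have "kkt (U\<^sub>0, Q\<^sub>0, V\<^sub>0) (W\<^sub>0, G\<^sub>0) X\<^sub>0"
  proof -
    have "a (U\<^sub>0, Q\<^sub>0, V\<^sub>0) + b (W\<^sub>0, G\<^sub>0) = 0" "0 \<le> V\<^sub>0" "spectral_norm G\<^sub>0 \<le> 1"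
      using k0 by (auto simp: ab dual_residual_def kkt_point_def algebra_simps)
    moreover have "0 \<le> f v - f (U\<^sub>0, Q\<^sub>0, V\<^sub>0) + X\<^sub>0 \<bullet> a (v - (U\<^sub>0, Q\<^sub>0, V\<^sub>0))" if v: "v \<in> Cy" for v
    proof -
      obtain u' q' v' where "v = (u', q', v')" "0 \<le> v'" using v by (auto simp: Cy_def)
      then show ?thesis
        using kkt_point_variational(1)[OF k0 \<alpha>, of v' q' u'] by (simp only: f_def a_def split_conv diff_Pair)
    qed
    moreover have "0 \<le> h v - h (W\<^sub>0, G\<^sub>0) + X\<^sub>0 \<bullet> b (v - (W\<^sub>0, G\<^sub>0))" if v: "v \<in> Cz" for v
    proof -
      obtain w' g' where "v = (w', g')" "spectral_norm g' \<le> 1" using v by (auto simp: Cz_def)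
      then show ?thesis
        using kkt_point_variational(2)[OF k0 \<alpha>, of g' w'] by (simp only: h_def b_def split_conv diff_Pair)
    qed
    ultimately show ?thesis
      unfolding kkt_def by (simp add: Cy_def Cz_def)
  qed
  then obtain yinf winf Xinf where kkt: "kkt yinf winf Xinf" and lim: "y \<longlonglongrightarrow> yinf" "w \<longlonglongrightarrow> winf" "X \<longlonglongrightarrow> Xinf"
    by (rule converges)
  obtain Uinf Qinf Vinf where yinf: "yinf = (Uinf, Qinf, Vinf)" by (cases yinf)
  obtain Winf Ginf where winf: "winf = (Winf, Ginf)" by (cases winf)
  have lims: "U \<longlonglongrightarrow> Uinf" "Q \<longlonglongrightarrow> Qinf" "V \<longlonglongrightarrow> Vinf" "W \<longlonglongrightarrow> Winf" "G \<longlonglongrightarrow> Ginf"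
    using tendsto_fst[OF lim(1)] tendsto_fst[OF tendsto_snd[OF lim(1)]] tendsto_snd[OF tendsto_snd[OF lim(1)]]
      tendsto_fst[OF lim(2)] tendsto_snd[OF lim(2)]
    by (simp_all add: yinf winf y_def w_def)
  have z_lim: "(\<lambda>k. z (Suc k)) \<longlonglongrightarrow> (Uinf, Qinf, Winf, Vinf, Ginf, Xinf)"
    unfolding z_def by (rule LIMSEQ_Suc) (intro tendsto_Pair lims lim(3))
  have z_acc: "(\<exists>r. strict_mono r \<and> ((\<lambda>k. z (Suc k)) \<circ> r) \<longlonglongrightarrow> p) \<longleftrightarrow> p = (Uinf, Qinf, Winf, Vinf, Ginf, Xinf)" for p
  proof
    assume "\<exists>r. strict_mono r \<and> ((\<lambda>k. z (Suc k)) \<circ> r) \<longlonglongrightarrow> p"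
    then show "p = (Uinf, Qinf, Winf, Vinf, Ginf, Xinf)"
      using LIMSEQ_subseq_LIMSEQ[OF z_lim] LIMSEQ_unique by blast
  next
    assume "p = (Uinf, Qinf, Winf, Vinf, Ginf, Xinf)"
    then show "\<exists>r. strict_mono r \<and> ((\<lambda>k. z (Suc k)) \<circ> r) \<longlonglongrightarrow> p"
      using z_lim by (intro exI[of _ id]) (simp add: strict_mono_id)
  qed
  have kinf: "kkt_point R L \<Omega> \<alpha> A (Uinf, Qinf, Vinf, Winf, Ginf) Xinf"
  proof (rule kkt_pointI_variational[OF _ _ _ \<alpha>])
    have "dual_residual R \<Omega> (Uinf, Qinf, Vinf, Winf, Ginf) = 0"
      using kkt by (simp add: kkt_def yinf winf ab)
    then show "proj_on \<Omega> Uinf + Vinf + Winf + A_op R Qinf = Ginf"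
      by (simp add: dual_residual_def)
    show "0 \<le> Vinf" "spectral_norm Ginf \<le> 1"
      using kkt unfolding kkt_def yinf winf by (simp_all add: Cy_def Cz_def)
    show "0 \<le> - (Q' \<bullet> L) - - (Qinf \<bullet> L)
        + Xinf \<bullet> (proj_on \<Omega> (U' - Uinf) + (V' - Vinf) + A_op R (Q' - Qinf))" if "0 \<le> V'" for U' Q' V'
    proof -
      have "0 \<le> f (U', Q', V') - f yinf + Xinf \<bullet> a ((U', Q', V') - yinf)"
        using kkt that unfolding kkt_def by (auto simp: Cy_def)
      then show ?thesis by (simp only: f_def a_def yinf split_conv diff_Pair)
    qed
    show "0 \<le> 1 / (4 * \<alpha>) * (norm (W' - (2 * \<alpha>) *\<^sub>R A))\<^sup>2 - 1 / (4 * \<alpha>) * (norm (Winf - (2 * \<alpha>) *\<^sub>R A))\<^sup>2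
        + Xinf \<bullet> ((W' - Winf) - (G' - Ginf))" if "spectral_norm G' \<le> 1" for W' G'
    proof -
      have "0 \<le> h (W', G') - h winf + Xinf \<bullet> b ((W', G') - winf)"
        using kkt that unfolding kkt_def by (auto simp: Cz_def)
      then show ?thesis by (simp only: h_def b_def winf split_conv diff_Pair)
    qed
  qed
  show ?thesis
    using well_defined z_lim z_acc kkt_point_dual_optimal[OF kinf \<alpha>] kkt_point_primal_optimal[OF kinf \<alpha>] by blast
qed

end
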